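(* Let $K\in\mathbb{R}$ and let $(M,g)$ be a semi-Riemannian manifold satisfying $\mathcal{R}\le K$. Let $q\in M$, and let $U\subset M$ be the diffeomorphic image under $\exp_q$ of a star-shaped region in $T_qM$ about the origin $O$. Assume that the signed energy function $E_q:U\to\mathbb{R}$ satisfies $E_q<\pi^2/(4K)$ on $U$ if $K>0$, and $E_q>\pi^2/(4K)$ on $U$ if $K<0$ (no condition if $K=0$). Then $1-Kf_{K,q}>0$ on $U$, and $f_{K,q}:U\to\mathbb{R}$ is $\lambda$-convex with $\lambda=1-Kf_{K,q}$, that is, $$\overline{\nabla}^2 f_{K,q}\ \ge\ (1-Kf_{K,q})\,g \quad\text{on } U.$$ Moreover, if $M$ is Lorentzian, then $f_{K,q}$ is space-time convex on a neighborhood of $q$.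
   Context: Curvature bound: a semi-Riemannian manifold $(M,g)$ satisfies $\mathcal{R}\le K$ if for all tangent vectors $v,w$ at each point, $$g(R(v,w)v,w)\le K\bigl(g(v,v)g(w,w)-g(v,w)^2\bigr),$$ where the sign convention for the curvature tensor $R$ is such that the sectional curvature of a nondegenerate plane spanned by $v,w$ is $g(R(v,w)v,w)/(g(v,v)g(w,w)-g(v,w)^2)$. Equivalently, spacelike sectional curvatures (those of planes on which $g$ is definite) are $\le K$ and timelike sectional curvatures (those of planes on which $g$ is nondegenerate and indefinite) are $\ge K$. Star-shaped regions about $O$ are open and contain $O$. Signed energy: for $p\in U$, let $\gamma_{p,q}$ be the geodesic in $U$ between $p$ and $q$ distinguished by the diffeomorphism $\exp_q$ (the image of the radial segment from $O$ to $v=\exp_q^{-1}(p)$). Define $E_q(p)=(\operatorname{sgn}\gamma_{p,q})(\operatorname{length}\gamma_{p,q})^2$, where $\operatorname{sgn}\gamma_{p,q}$ is $1,0,-1$ according to whether $\gamma_{p,q}$ is spacelike, null or timelike; equivalently $E_q(p)=g_q(v,v)$. The function $f_{K,q}:U\to\mathbb{R}$ is $$f_{K,q}=\sum_{n=1}^\infty\frac{(-K)^{n-1}(E_q)^n}{(2n)!}=\begin{cases}E_q/2,&K=0,\\ (1-\cos\sqrt{KE_q})/K,&K\neq0,\end{cases}$$ where the argument of $\cos$ may be imaginary, with $\cos(it)=\cosh t$. $\overline{\nabla}$ is the Levi-Civita covariant derivative of $M$ and $\overline{\nabla}^2$ denotes the Hessian. For smooth functions $f,\lambda$ on a semi-Riemannian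 manifold, $f$ is $\lambda$-convex if $\overline{\nabla}^2 f\ge\lambda g$, i.e. $\overline{\nabla}^2 f(x,x)\ge\lambda\, g(x,x)$ for all tangent vectors $x$. If the manifold is Lorentzian, $f$ is space-time convex (space-time $\lambda$-convex) if $f$ is $\lambda$-convex for some positive function $\lambda$ and $\overline{\nabla}^2 f$ has Lorentzian signature at each point. *)

theory Defs
  imports "HOL-Analysis.Analysis"
begin

section \<open>Smooth maps between open subsets of vector spaces\<close>

text \<open>Only meant for open \<open>S\<close>. In finite dimensions the existence and continuity of all
  directional derivatives of all orders is the usual \<open>C\<^sup>\<infinity>\<close> condition.\<close>

fun times_differentiable_on ::
    "nat \<Rightarrow> ('a::euclidean_space \<Rightarrow> 'b::real_normed_vector) \<Rightarrow> 'a set \<Rightarrow> bool" where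
  "times_differentiable_on 0 f S \<longleftrightarrow> continuous_on S f"
| "times_differentiable_on (Suc n) f S \<longleftrightarrow>
     (\<forall>x\<in>S. f differentiable (at x)) \<and>
     (\<forall>v. times_differentiable_on n (\<lambda>x. frechet_derivative f (at x) v) S)"

definition smooth_on :: "'a::euclidean_space set \<Rightarrow> ('a \<Rightarrow> 'b::real_normed_vector) \<Rightarrow> bool" where
  "smooth_on S f \<longleftrightarrow> (\<forall>n. times_differentiable_on n f S)"


section \<open>Manifolds\<close>

text \<open>A chart is a pair of its domain and its coordinate map; the values of the coordinate map
  outside the domain are irrelevant. The manifold is the whole type \<open>'m\<close>, which is assumed
  Hausdorff and second countable, and its model space is \<open>'e\<close>.\<close>

type_synonym ('m, 'e) chart = "'m set \<times> ('m \<Rightarrow> 'e)"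

abbreviation cdom :: "('m, 'e) chart \<Rightarrow> 'm set" where "cdom \<equiv> fst"
abbreviation coord :: "('m, 'e) chart \<Rightarrow> 'm \<Rightarrow> 'e" where "coord \<equiv> snd"
abbreviation cimage :: "('m, 'e) chart \<Rightarrow> 'e set" where "cimage c \<equiv> coord c ` cdom c"

definition param :: "('m, 'e) chart \<Rightarrow> 'e \<Rightarrow> 'm" where
  "param c = inv_into (cdom c) (coord c)"

definition smooth_atlas ::
    "('m::{t2_space, second_countable_topology}, 'e::euclidean_space) chart set \<Rightarrow> bool" where
  "smooth_atlas A \<longleftrightarrow>
     (\<Union>c\<in>A. cdom c) = UNIV \<and>
     (\<forall>c\<in>A. open (cdom c) \<and> open (cimage c) \<and>
        homeomorphism (cdom c) (cimage c) (coord c) (param c)) \<and>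
     (\<forall>c\<in>A. \<forall>c'\<in>A. smooth_on (coord c ` (cdom c \<inter> cdom c')) (coord c' \<circ> param c))"

definition charts_at :: "('m, 'e) chart set \<Rightarrow> 'm \<Rightarrow> ('m, 'e) chart set" where
  "charts_at A p = {c \<in> A. p \<in> cdom c}"

definition chart_at :: "('m, 'e) chart set \<Rightarrow> 'm \<Rightarrow> ('m, 'e) chart" where
  "chart_at A p = (SOME c. c \<in> charts_at A p)"

text \<open>Smoothness, on an open subset \<open>S\<close>, of maps out of and into the manifold.\<close>

definition smooth_from ::
    "('m, 'e::euclidean_space) chart set \<Rightarrow> 'm set \<Rightarrow> ('m \<Rightarrow> 'b::real_normed_vector) \<Rightarrow> bool" where
  "smooth_from A S f \<longleftrightarrow> (\<forall>c\<in>A. smooth_on (coord c ` (S \<inter> cdom c)) (f \<circ> param c))"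

definition smooth_into ::
    "('m::topological_space, 'e::euclidean_space) chart set \<Rightarrow> 'a::euclidean_space set \<Rightarrow>
     ('a \<Rightarrow> 'm) \<Rightarrow> bool" where
  "smooth_into A S F \<longleftrightarrow>
     continuous_on S F \<and> (\<forall>c\<in>A. smooth_on (S \<inter> F -` cdom c) (coord c \<circ> F))"


section \<open>Tangent vectors\<close>

text \<open>A tangent vector at \<open>p\<close> is the family of its components in all charts around \<open>p\<close>, related to
  each other by the derivatives of the coordinate changes. Components in all other charts are set
  to \<open>0\<close>, so that equality of tangent vectors is equality of families. By \<open>bij_betw_tangent_space\<close>
  below, the component in any single chart around \<open>p\<close> identifies the tangent space with \<open>'e\<close>; the
  vector space operations are componentwise.\<close>

type_synonym ('m, 'e) tangent = "('m, 'e) chart \<Rightarrow> 'e"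

definition change_deriv :: "('m, 'e::euclidean_space) chart \<Rightarrow> ('m, 'e) chart \<Rightarrow> 'm \<Rightarrow> 'e \<Rightarrow> 'e" where
  "change_deriv c c' p = frechet_derivative (coord c' \<circ> param c) (at (coord c p))"

definition tangent_space ::
    "('m, 'e::euclidean_space) chart set \<Rightarrow> 'm \<Rightarrow> ('m, 'e) tangent set" where
  "tangent_space A p =
     {v. (\<forall>c\<in>charts_at A p. \<forall>c'\<in>charts_at A p. v c' = change_deriv c c' p (v c)) \<and>
         (\<forall>c. c \<notin> charts_at A p \<longrightarrow> v c = 0)}"

text \<open>The tangent vector at \<open>p\<close> whose component in the chart \<open>c\<close> is \<open>x\<close>.\<close>

definition tangent_of ::
    "('m, 'e::euclidean_space) chart set \<Rightarrow> 'm \<Rightarrow> ('m, 'e) chart \<Rightarrow> 'e \<Rightarrow> ('m, 'e) tangent" where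
  "tangent_of A p c x = (\<lambda>c'. if c' \<in> charts_at A p then change_deriv c c' p x else 0)"

definition scale_tangent :: "real \<Rightarrow> ('m, 'e::euclidean_space) tangent \<Rightarrow> ('m, 'e) tangent" where
  "scale_tangent t v = (\<lambda>c. t *\<^sub>R v c)"

definition velocity ::
    "('m, 'e::euclidean_space) chart set \<Rightarrow> (real \<Rightarrow> 'm) \<Rightarrow> real \<Rightarrow> ('m, 'e) tangent" where
  "velocity A \<gamma> t =
     (\<lambda>c. if c \<in> charts_at A (\<gamma> t) then vector_derivative (coord c \<circ> \<gamma>) (at t) else 0)"

lemma change_deriv_compose:
  fixes A :: "('m::{t2_space, second_countable_topology}, 'e::euclidean_space) chart set"
  assumes A: "smooth_atlas A"
    and c: "c \<in> charts_at A p" "c' \<in> charts_at A p" "c'' \<in> charts_at A p"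
  shows "linear (change_deriv c c' p)"
    and "change_deriv c c p = id"
    and "change_deriv c c'' p = change_deriv c' c'' p \<circ> change_deriv c c' p"
proof -
  have deriv: "((coord b \<circ> param a) has_derivative change_deriv a b p) (at (coord a p))"
    if "a \<in> charts_at A p" "b \<in> charts_at A p" for a b
  proof -
    have "smooth_on (coord a ` (cdom a \<inter> cdom b)) (coord b \<circ> param a)"
      using A that unfolding smooth_atlas_def charts_at_def by blast
    then have "times_differentiable_on (Suc 0) (coord b \<circ> param a) (coord a ` (cdom a \<inter> cdom b))"
      by (simp add: smooth_on_def del: times_differentiable_on.simps)
    then have "(coord b \<circ> param a) differentiable (at (coord a p))"
      using that by (auto simp: charts_at_def)
    then show ?thesis
      by (simp add: change_deriv_def frechet_derivative_works)
  qed
  have hom: "homeomorphism (cdom a) (cimage a) (coord a) (param a)" "open (cdom a)"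
       "open (cimage a)" "p \<in> cdom a" if "a \<in> charts_at A p" for a
    using A that unfolding smooth_atlas_def charts_at_def by blast+
  have nbhd: "open (coord c ` (cdom c \<inter> cdom c'))"
  proof -
    have "openin (top_of_set (cimage c)) (coord c ` (cdom c \<inter> cdom c'))"
      by (rule homeomorphism_imp_open_map[OF hom(1)[OF c(1)]])
        (use hom(2)[OF c(2)] in \<open>auto simp: openin_open\<close>)
    then show ?thesis
      using hom(3)[OF c(1)] by (simp add: openin_open_eq)
  qed
  show "linear (change_deriv c c' p)"
    using deriv[OF c(1,2)] by (rule has_derivative_linear)
  have "((\<lambda>x. x) has_derivative change_deriv c c p) (at (coord c p))"
    by (rule has_derivative_transform_within_open[OF deriv[OF c(1) c(1)] hom(3)[OF c(1)]])
      (use hom[OF c(1)] in \<open>auto simp: homeomorphism_def\<close>)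
  then show "change_deriv c c p = id"
    using has_derivative_unique[OF _ has_derivative_ident] by (simp only: id_def)
  have pc: "param c (coord c p) = p"
    using hom[OF c(1)] by (auto simp: homeomorphism_def)
  have "((coord c'' \<circ> param c') has_derivative change_deriv c' c'' p)
          (at ((coord c' \<circ> param c) (coord c p)))"
    using deriv[OF c(2,3)] by (simp add: pc)
  from diff_chain_at[OF deriv[OF c(1,2)] this]
  have "(((coord c'' \<circ> param c') \<circ> (coord c' \<circ> param c)) has_derivative
          change_deriv c' c'' p \<circ> change_deriv c c' p) (at (coord c p))" .
  then have "((coord c'' \<circ> param c) has_derivative change_deriv c' c'' p \<circ> change_deriv c c' p)
               (at (coord c p))"
    by (rule has_derivative_transform_within_open[OF _ nbhd])
      (use hom[OF c(1)] hom[OF c(2)] in \<open>auto simp: homeomorphism_def\<close>)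
  then show "change_deriv c c'' p = change_deriv c' c'' p \<circ> change_deriv c c' p"
    by (rule has_derivative_unique[OF deriv[OF c(1,3)]])
qed

lemma tangent_of_in_tangent_space:
  assumes "smooth_atlas A" "c \<in> charts_at A p"
  shows "tangent_of A p c x \<in> tangent_space A p"
proof -
  have "change_deriv c' c'' p (change_deriv c c' p x) = change_deriv c c'' p x"
    if "c' \<in> charts_at A p" "c'' \<in> charts_at A p" for c' c''
    using fun_cong[OF change_deriv_compose(3)[OF assms that]] by (simp only: o_apply)
  then show ?thesis
    unfolding tangent_space_def tangent_of_def by simp
qed

lemma bij_betw_tangent_space:
  assumes "smooth_atlas A" "c \<in> charts_at A p"
  shows "bij_betw (\<lambda>v. v c) (tangent_space A p) UNIV"
proof (rule bij_betw_byWitness[where f' = "tangent_of A p c"])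
  show "\<forall>v\<in>tangent_space A p. tangent_of A p c (v c) = v"
  proof
    fix v assume v: "v \<in> tangent_space A p"
    show "tangent_of A p c (v c) = v"
    proof
      fix c'
      show "tangent_of A p c (v c) c' = v c'"
      proof (cases "c' \<in> charts_at A p")
        case True
        then have "v c' = change_deriv c c' p (v c)"
          using v assms(2) unfolding tangent_space_def by blast
        then show ?thesis
          using True by (simp only: tangent_of_def if_True)
      next
        case False
        then have "v c' = 0"
          using v unfolding tangent_space_def by blast
        then show ?thesis
          using False by (simp only: tangent_of_def if_False)
      qed
    qed
  qed
  show "\<forall>x\<in>UNIV. tangent_of A p c x c = x"
    using assms(2) change_deriv_compose(2)[OF assms assms(2) assms(2)]
    by (simp add: tangent_of_def)
qed (use tangent_of_in_tangent_space[OF assms] in auto)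


section \<open>Semi-Riemannian metrics\<close>

text \<open>Matrix of a form on the tangent space at \<open>p\<close> in the chart \<open>c\<close>.\<close>

definition form_in_chart ::
    "('m, 'e::euclidean_space) chart set \<Rightarrow> 'm \<Rightarrow> (('m, 'e) tangent \<Rightarrow> ('m, 'e) tangent \<Rightarrow> real) \<Rightarrow>
     ('m, 'e) chart \<Rightarrow> 'e \<Rightarrow> 'e \<Rightarrow> real" where
  "form_in_chart A p b c x y = b (tangent_of A p c x) (tangent_of A p c y)"

definition scalar_product :: "('e::euclidean_space \<Rightarrow> 'e \<Rightarrow> real) \<Rightarrow> bool" where
  "scalar_product b \<longleftrightarrow>
     bilinear b \<and> (\<forall>x y. b x y = b y x) \<and> (\<forall>x. (\<forall>y. b x y = 0) \<longrightarrow> x = 0)"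

definition form_index :: "('e::euclidean_space \<Rightarrow> 'e \<Rightarrow> real) \<Rightarrow> nat" where
  "form_index b = Max {dim S | S. subspace S \<and> (\<forall>x\<in>S. x \<noteq> 0 \<longrightarrow> b x x < 0)}"

type_synonym ('m, 'e) metric = "'m \<Rightarrow> ('m, 'e) tangent \<Rightarrow> ('m, 'e) tangent \<Rightarrow> real"

text \<open>The metric tensor at the point with coordinates \<open>x\<close> in the chart \<open>c\<close>.\<close>

definition metric_in_chart ::
    "('m, 'e::euclidean_space) chart set \<Rightarrow> ('m, 'e) metric \<Rightarrow> ('m, 'e) chart \<Rightarrow> 'e \<Rightarrow> 'e \<Rightarrow> 'e \<Rightarrow> real"
  where
  "metric_in_chart A g c x = form_in_chart A (param c x) (g (param c x)) c"

definition semi_riemannian ::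
    "('m::{t2_space, second_countable_topology}, 'e::euclidean_space) chart set \<Rightarrow>
     ('m, 'e) metric \<Rightarrow> bool" where
  "semi_riemannian A g \<longleftrightarrow>
     smooth_atlas A \<and>
     (\<forall>c\<in>A. \<forall>u v. smooth_on (cimage c) (\<lambda>x. metric_in_chart A g c x u v)) \<and>
     (\<forall>c\<in>A. \<forall>x\<in>cimage c. scalar_product (metric_in_chart A g c x)) \<and>
     (\<exists>\<nu>. \<forall>c\<in>A. \<forall>x\<in>cimage c. form_index (metric_in_chart A g c x) = \<nu>)"

definition lorentzian_signature :: "('e::euclidean_space \<Rightarrow> 'e \<Rightarrow> real) \<Rightarrow> bool" where
  "lorentzian_signature b \<longleftrightarrow> scalar_product b \<and> form_index b = 1 \<and> DIM('e) \<ge> 2"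

definition lorentzian ::
    "('m::{t2_space, second_countable_topology}, 'e::euclidean_space) chart set \<Rightarrow>
     ('m, 'e) metric \<Rightarrow> bool" where
  "lorentzian A g \<longleftrightarrow>
     semi_riemannian A g \<and>
     (\<forall>p. \<forall>c\<in>charts_at A p. lorentzian_signature (form_in_chart A p (g p) c))"


section \<open>Levi-Civita connection, curvature and Hessian\<close>

text \<open>The Christoffel form \<open>\<Gamma>\<^sub>x(u,v)\<close>, i.e. the covariant derivative of the constant coordinate field
  \<open>v\<close> in direction \<open>u\<close>. It is given by the Koszul formula, in which the Lie brackets of constant
  coordinate fields vanish.\<close>

definition christoffel ::
    "('m, 'e::euclidean_space) chart set \<Rightarrow> ('m, 'e) metric \<Rightarrow> ('m, 'e) chart \<Rightarrow> 'e \<Rightarrow> 'e \<Rightarrow> 'e \<Rightarrow> 'e"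
  where
  "christoffel A g c x u v = (THE z. \<forall>w. metric_in_chart A g c x z w =
     (frechet_derivative (\<lambda>y. metric_in_chart A g c y v w) (at x) u
    + frechet_derivative (\<lambda>y. metric_in_chart A g c y u w) (at x) v
    - frechet_derivative (\<lambda>y. metric_in_chart A g c y u v) (at x) w) / 2)"

text \<open>Covariant derivative of a vector field \<open>Y\<close> along a vector field \<open>X\<close>, both given by their
  components in the chart \<open>c\<close>.\<close>

definition cov_deriv ::
    "('m, 'e::euclidean_space) chart set \<Rightarrow> ('m, 'e) metric \<Rightarrow> ('m, 'e) chart \<Rightarrow>
     ('e \<Rightarrow> 'e) \<Rightarrow> ('e \<Rightarrow> 'e) \<Rightarrow> 'e \<Rightarrow> 'e" where
  "cov_deriv A g c X Y x = frechet_derivative Y (at x) (X x) + christoffel A g c x (X x) (Y x)"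

text \<open>Curvature with the sign convention
  \<open>R(X,Y)Z = \<nabla>\<^bsub>[X,Y]\<^esub>Z - \<nabla>\<^sub>X\<nabla>\<^sub>YZ + \<nabla>\<^sub>Y\<nabla>\<^sub>XZ\<close>, evaluated on constant coordinate fields, for which
  \<open>[X,Y] = 0\<close>. With this sign the sectional curvature of a nondegenerate plane spanned by \<open>v\<close> and
  \<open>w\<close> is \<open>g(R(v,w)v,w) / (g(v,v)g(w,w) - g(v,w)\<^sup>2)\<close>. Curvature and Hessian are tensorial,
  so the choice of the chart around \<open>p\<close> is immaterial.\<close>

definition curvature_in_chart ::
    "('m, 'e::euclidean_space) chart set \<Rightarrow> ('m, 'e) metric \<Rightarrow> ('m, 'e) chart \<Rightarrow>
     'e \<Rightarrow> 'e \<Rightarrow> 'e \<Rightarrow> 'e \<Rightarrow> 'e" where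
  "curvature_in_chart A g c x u v w =
     cov_deriv A g c (\<lambda>_. v) (cov_deriv A g c (\<lambda>_. u) (\<lambda>_. w)) x
   - cov_deriv A g c (\<lambda>_. u) (cov_deriv A g c (\<lambda>_. v) (\<lambda>_. w)) x"

definition curvature ::
    "('m, 'e::euclidean_space) chart set \<Rightarrow> ('m, 'e) metric \<Rightarrow> 'm \<Rightarrow>
     ('m, 'e) tangent \<Rightarrow> ('m, 'e) tangent \<Rightarrow> ('m, 'e) tangent \<Rightarrow> ('m, 'e) tangent" where
  "curvature A g p u v w =
     (let c = chart_at A p
      in tangent_of A p c (curvature_in_chart A g c (coord c p) (u c) (v c) (w c)))"

definition curvature_le ::
    "('m, 'e::euclidean_space) chart set \<Rightarrow> ('m, 'e) metric \<Rightarrow> real \<Rightarrow> bool" where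
  "curvature_le A g K \<longleftrightarrow>
     (\<forall>p. \<forall>v\<in>tangent_space A p. \<forall>w\<in>tangent_space A p.
        g p (curvature A g p v w v) w \<le> K * (g p v v * g p w w - (g p v w)\<^sup>2))"

text \<open>\<open>(\<nabla>\<^sup>2f)(X,Y) = X(Yf) - (\<nabla>\<^sub>XY)f\<close> on constant coordinate fields.\<close>

definition hessian_in_chart ::
    "('m, 'e::euclidean_space) chart set \<Rightarrow> ('m, 'e) metric \<Rightarrow> ('m, 'e) chart \<Rightarrow>
     ('e \<Rightarrow> real) \<Rightarrow> 'e \<Rightarrow> 'e \<Rightarrow> 'e \<Rightarrow> real" where
  "hessian_in_chart A g c F x u v =
     frechet_derivative (\<lambda>y. frechet_derivative F (at y) v) (at x) u
   - frechet_derivative F (at x) (cov_deriv A g c (\<lambda>_. u) (\<lambda>_. v) x)"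

definition hessian ::
    "('m, 'e::euclidean_space) chart set \<Rightarrow> ('m, 'e) metric \<Rightarrow> ('m \<Rightarrow> real) \<Rightarrow> 'm \<Rightarrow>
     ('m, 'e) tangent \<Rightarrow> ('m, 'e) tangent \<Rightarrow> real" where
  "hessian A g f p u v =
     (let c = chart_at A p in hessian_in_chart A g c (f \<circ> param c) (coord c p) (u c) (v c))"


section \<open>Convexity\<close>

definition lambda_convex_on ::
    "('m, 'e::euclidean_space) chart set \<Rightarrow> ('m, 'e) metric \<Rightarrow> 'm set \<Rightarrow>
     ('m \<Rightarrow> real) \<Rightarrow> ('m \<Rightarrow> real) \<Rightarrow> bool" where
  "lambda_convex_on A g S lam f \<longleftrightarrow>
     smooth_from A S f \<and> smooth_from A S lam \<and>
     (\<forall>p\<in>S. \<forall>x\<in>tangent_space A p. hessian A g f p x x \<ge> lam p * g p x x)"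

definition space_time_convex_on ::
    "('m::{t2_space, second_countable_topology}, 'e::euclidean_space) chart set \<Rightarrow>
     ('m, 'e) metric \<Rightarrow> 'm set \<Rightarrow> ('m \<Rightarrow> real) \<Rightarrow> bool" where
  "space_time_convex_on A g S f \<longleftrightarrow>
     lorentzian A g \<and>
     (\<exists>lam. (\<forall>p\<in>S. lam p > 0) \<and> lambda_convex_on A g S lam f) \<and>
     (\<forall>p\<in>S. \<forall>c\<in>charts_at A p. lorentzian_signature (form_in_chart A p (hessian A g f p) c))"


section \<open>Geodesics and the exponential map\<close>

definition geodesic_on ::
    "('m::topological_space, 'e::euclidean_space) chart set \<Rightarrow> ('m, 'e) metric \<Rightarrow> real set \<Rightarrow>
     (real \<Rightarrow> 'm) \<Rightarrow> bool" where
  "geodesic_on A g I \<gamma> \<longleftrightarrow>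
     open I \<and> is_interval I \<and> continuous_on I \<gamma> \<and>
     (\<forall>t\<in>I. \<forall>c\<in>charts_at A (\<gamma> t).
        let x = coord c \<circ> \<gamma>; x' = (\<lambda>s. vector_derivative x (at s))
        in x differentiable (at t) \<and>
           (x' has_vector_derivative - christoffel A g c (x t) (x' t) (x' t)) (at t))"

definition exp_curve ::
    "('m::topological_space, 'e::euclidean_space) chart set \<Rightarrow> ('m, 'e) metric \<Rightarrow> 'm \<Rightarrow>
     ('m, 'e) tangent \<Rightarrow> (real \<Rightarrow> 'm) \<Rightarrow> bool" where
  "exp_curve A g q v \<gamma> \<longleftrightarrow>
     (\<exists>I. {0..1} \<subseteq> I \<and> geodesic_on A g I \<gamma>) \<and> \<gamma> 0 = q \<and> velocity A \<gamma> 0 = v"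

definition exp_domain ::
    "('m::topological_space, 'e::euclidean_space) chart set \<Rightarrow> ('m, 'e) metric \<Rightarrow> 'm \<Rightarrow>
     ('m, 'e) tangent set" where
  "exp_domain A g q = {v \<in> tangent_space A q. \<exists>\<gamma>. exp_curve A g q v \<gamma>}"

definition exp_map ::
    "('m::topological_space, 'e::euclidean_space) chart set \<Rightarrow> ('m, 'e) metric \<Rightarrow> 'm \<Rightarrow>
     ('m, 'e) tangent \<Rightarrow> 'm" where
  "exp_map A g q v = (THE p. \<exists>\<gamma>. exp_curve A g q v \<gamma> \<and> \<gamma> 1 = p)"

definition star_region ::
    "('m, 'e::euclidean_space) chart set \<Rightarrow> 'm \<Rightarrow> ('m, 'e) tangent set \<Rightarrow> bool" where
  "star_region A q \<Omega> \<longleftrightarrow>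
     \<Omega> \<subseteq> tangent_space A q \<and>
     (\<forall>c\<in>charts_at A q. let S = (\<lambda>v. v c) ` \<Omega>
        in open S \<and> 0 \<in> S \<and> (\<forall>x\<in>S. closed_segment 0 x \<subseteq> S))"

text \<open>\<open>exp\<^sub>q\<close> is defined on the open subset \<open>\<Omega>\<close> of the tangent space at \<open>q\<close> and maps it
  diffeomorphically onto the open set \<open>U\<close>.\<close>

definition exp_diffeo ::
    "('m::topological_space, 'e::euclidean_space) chart set \<Rightarrow> ('m, 'e) metric \<Rightarrow> 'm \<Rightarrow>
     ('m, 'e) tangent set \<Rightarrow> 'm set \<Rightarrow> bool" where
  "exp_diffeo A g q \<Omega> U \<longleftrightarrow>
     \<Omega> \<subseteq> exp_domain A g q \<and> open U \<and> bij_betw (exp_map A g q) \<Omega> U \<and>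
     (\<forall>c\<in>charts_at A q.
        smooth_into A ((\<lambda>v. v c) ` \<Omega>) (\<lambda>x. exp_map A g q (tangent_of A q c x)) \<and>
        smooth_from A U (\<lambda>p. inv_into \<Omega> (exp_map A g q) p c))"


section \<open>Signed energy\<close>

text \<open>Sign and length of a curve parametrised by \<open>[0,1]\<close>. Geodesics have constant causal
  character. A constant geodesic gets sign \<open>0\<close>, which does not matter as its length is \<open>0\<close>.\<close>

definition causal_sign ::
    "('m, 'e::euclidean_space) chart set \<Rightarrow> ('m, 'e) metric \<Rightarrow> (real \<Rightarrow> 'm) \<Rightarrow> real" where
  "causal_sign A g \<gamma> =
     (let speed2 = (\<lambda>t. g (\<gamma> t) (velocity A \<gamma> t) (velocity A \<gamma> t))
      in if \<forall>t\<in>{0..1}. speed2 t > 0 then 1 else if \<forall>t\<in>{0..1}. speed2 t < 0 then -1 else 0)"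

definition curve_length ::
    "('m, 'e::euclidean_space) chart set \<Rightarrow> ('m, 'e) metric \<Rightarrow> (real \<Rightarrow> 'm) \<Rightarrow> real" where
  "curve_length A g \<gamma> =
     integral {0..1} (\<lambda>t. sqrt \<bar>g (\<gamma> t) (velocity A \<gamma> t) (velocity A \<gamma> t)\<bar>)"

definition radial_geodesic ::
    "('m::topological_space, 'e::euclidean_space) chart set \<Rightarrow> ('m, 'e) metric \<Rightarrow> 'm \<Rightarrow>
     ('m, 'e) tangent set \<Rightarrow> 'm \<Rightarrow> real \<Rightarrow> 'm" where
  "radial_geodesic A g q \<Omega> p =
     (\<lambda>t. exp_map A g q (scale_tangent t (inv_into \<Omega> (exp_map A g q) p)))"

definition signed_energy ::
    "('m::topological_space, 'e::euclidean_space) chart set \<Rightarrow> ('m, 'e) metric \<Rightarrow> 'm \<Rightarrow>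
     ('m, 'e) tangent set \<Rightarrow> 'm \<Rightarrow> real" where
  "signed_energy A g q \<Omega> p =
     causal_sign A g (radial_geodesic A g q \<Omega> p) * (curve_length A g (radial_geodesic A g q \<Omega> p))\<^sup>2"

text \<open>The series \<open>\<Sum>n\<ge>1. (-K)\<^bsup>n-1\<^esup> e\<^bsup>n\<^esup> / (2n)!\<close>, with the summation index shifted by one.\<close>

definition energy_series :: "real \<Rightarrow> real \<Rightarrow> real" where
  "energy_series K e = (\<Sum>n. (- K) ^ n * e ^ Suc n / fact (2 * Suc n))"

definition f_energy ::
    "('m::topological_space, 'e::euclidean_space) chart set \<Rightarrow> ('m, 'e) metric \<Rightarrow> real \<Rightarrow> 'm \<Rightarrow>
     ('m, 'e) tangent set \<Rightarrow> 'm \<Rightarrow> real" where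
  "f_energy A g K q \<Omega> p = energy_series K (signed_energy A g q \<Omega> p)"

lemma energy_series_0: "energy_series 0 e = e / 2"
proof -
  have "(\<Sum>n. (- 0) ^ n * e ^ Suc n / fact (2 * Suc n)) =
        (\<Sum>n\<in>{0::nat}. (- 0) ^ n * e ^ Suc n / fact (2 * Suc n))"
    by (rule suminf_finite) auto
  then show ?thesis
    by (simp add: energy_series_def fact_numeral)
qed

lemma energy_series_closed_form:
  assumes "K \<noteq> 0"
  shows "complex_of_real (energy_series K e) =
         (1 - cos (csqrt (complex_of_real (K * e)))) / complex_of_real K"
proof -
  define z where "z = csqrt (complex_of_real (K * e))"
  have "(\<lambda>n. \<Sum>k = n * 2..<n * 2 + 2. cos_coeff k *\<^sub>R z ^ k) sums cos z"
    by (rule sums_group) (use cos_converges[of z] in auto)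
  moreover have "(\<Sum>k = n * 2..<n * 2 + 2. cos_coeff k *\<^sub>R z ^ k) =
      complex_of_real ((- 1) ^ n * (K * e) ^ n / fact (2 * n))" for n
  proof -
    have "z ^ (n * 2) = complex_of_real ((K * e) ^ n)"
      by (simp add: z_def power_mult mult.commute[of n 2])
    then show ?thesis
      by (simp add: cos_coeff_def scaleR_conv_of_real ac_simps)
  qed
  ultimately have *: "(\<lambda>n. complex_of_real ((- 1) ^ n * (K * e) ^ n / fact (2 * n))) sums cos z"
    by (simp only:)
  have S: "(\<lambda>n. (- 1) ^ n * (K * e) ^ n / fact (2 * n)) sums Re (cos z)"
    using sums_Re[OF *] by (simp only: Re_complex_of_real)
  have "(\<lambda>n::nat. 0) sums Im (cos z)"
    using sums_Im[OF *] by (simp only: Im_complex_of_real)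
  then have im: "Im (cos z) = 0"
    using sums_unique2 sums_zero by blast
  have "(\<lambda>n. (- 1) ^ Suc n * (K * e) ^ Suc n / fact (2 * Suc n)) sums (Re (cos z) - 1)"
    using S by (subst sums_Suc_iff) simp
  then have "(\<lambda>n. - (1 / K) * ((- 1) ^ Suc n * (K * e) ^ Suc n / fact (2 * Suc n)))
      sums (- (1 / K) * (Re (cos z) - 1))"
    by (rule sums_mult)
  moreover have "- (1 / K) * ((- 1) ^ Suc n * (K * e) ^ Suc n / fact (2 * Suc n)) =
      (- K) ^ n * e ^ Suc n / fact (2 * Suc n)" for n
  proof -
    have "(- K) ^ n = (- 1) ^ n * K ^ n"
      by (metis mult_minus1 power_mult_distrib)
    then show ?thesis
      using assms by (simp add: power_mult_distrib del: fact_Suc)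
  qed
  ultimately have "(\<lambda>n. (- K) ^ n * e ^ Suc n / fact (2 * Suc n)) sums (- (1 / K) * (Re (cos z) - 1))"
    by (simp only:)
  then have "energy_series K e = (1 - Re (cos z)) / K"
    unfolding energy_series_def by (simp only: sums_unique[symmetric]) (simp add: diff_divide_distrib)
  then show ?thesis
    using im unfolding z_def[symmetric] by (simp add: complex_eq_iff)
qed

end

theory Submission
  imports Defs
begin

text \<open>
  The exponential map pulls \<open>g\<close> back to a field \<open>b\<close> of scalar products on a star-shaped open set
  of vectors \<open>x\<close>, with Christoffel form \<open>\<Gamma>\<close> (\<open>koszul\<close>). The rays through \<open>0\<close> are geodesics there,
  which says \<open>\<Gamma>\<^sub>x(x,x) = 0\<close>. This gives the Gauss lemma \<open>b\<^sub>x(x,w) = b\<^sub>0(x,w)\<close>, so the signed energy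
  is the quadratic polynomial \<open>e(x) = b\<^sub>0(x,x)\<close>, and half its gradient is the position field \<open>x\<close>.
  With \<open>N u = \<Gamma>\<^sub>x(x,u)\<close> the form \<open>n(u,w) = b(N u, w)\<close> is symmetric, the Hessian of \<open>e/2\<close> is
  \<open>b + n\<close>, and along the rays \<open>n\<close> satisfies the Riccati equation (\<open>radial_form_riccati\<close>)
  \<open>\<partial>\<^sub>x n(u,u) = b(N u, N u) - b(R(x,u)x, u) - n(u,u)\<close>.

  The function in question is \<open>f = \<phi> \<circ> e\<close> with the energy series \<open>\<phi>\<close>, which solves
  \<open>2\<phi>' + 4e\<phi>'' = 1 - K\<phi>\<close> (\<open>energy_series_ode\<close>). Let \<open>D\<close> be the Hessian of \<open>f\<close> minus
  \<open>(1 - Kf) b\<close>; the theorem claims \<open>D \<ge> 0\<close>. In terms of \<open>D\<close> the Riccati equation becomes linear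
  (\<open>defect_radial_derivative\<close>):
  \<open>\<partial>\<^sub>x D(u,u) = 2\<phi>' (K (e b(u,u) - b(x,u)\<^sup>2) - b(R(x,u)x,u)) - D(u,u) + D(u, N u)\<close>.
  The first term is nonnegative by the curvature bound, because \<open>1 - K\<phi> > 0\<close> along the ray forces
  \<open>\<phi>' \<ge> 0\<close>. Hence \<open>Y(t) = t D\<^bsub>tx\<^esub>\<close> satisfies \<open>Y(0) = 0\<close> and
  \<open>Y'(u,u) \<ge> Y(u, \<Gamma>\<^bsub>tx\<^esub>(x,u))\<close>, and such a differential inequality keeps a quadratic form
  nonnegative (\<open>form_ode_nonneg\<close>). Only the sign of \<open>Y\<close> is at stake here, so the argument works in
  every signature of \<open>b\<close>, whereas a comparison of index forms relies on a definite metric.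
  Positivity of \<open>1 - Kf\<close>, which is \<open>cos\<close> of the square root of \<open>Ke\<close>, is what the bound on the
  energy provides.

  Two facts connect this computation with the manifold. Christoffel form, curvature and Hessian are
  natural under local isometries (\<open>push_koszul\<close>, \<open>push_riem\<close>, \<open>hess_pullback\<close>), so any chart
  around \<open>exp\<^sub>q x\<close> may be exchanged for \<open>x\<close> itself. Geodesics are determined by their initial
  velocity (\<open>geodesic_unique\<close>), so that the exponential map sends rays to geodesics
  (\<open>exp_map_ray\<close>, \<open>koszul_radial\<close>).

  In the Lorentzian case the Hessian of \<open>f\<close> at \<open>q\<close> is \<open>g\<close>, and having Lorentzian signature is an
  open condition (\<open>eventually_lorentzian_signature\<close>).
\<close>

section \<open>Calculus of smooth maps\<close>

abbreviation fderiv :: "('a::euclidean_space \<Rightarrow> 'b::real_normed_vector) \<Rightarrow> 'a \<Rightarrow> 'a \<Rightarrow> 'b" where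
  "fderiv f x \<equiv> frechet_derivative f (at x)"

lemma fderiv_works: "f differentiable (at x) \<Longrightarrow> (f has_derivative fderiv f x) (at x)"
  using frechet_derivative_works by blast

lemma fderiv_eqI: "(f has_derivative f') (at x) \<Longrightarrow> fderiv f x = f'"
  using frechet_derivative_at by metis

lemma fderiv_cong_open:
  assumes "open S" "x \<in> S" "\<And>y. y \<in> S \<Longrightarrow> f y = g y"
  shows "fderiv f x = fderiv g x"
proof -
  have "(f has_derivative f') (at x) \<longleftrightarrow> (g has_derivative f') (at x)" for f'
    using assms has_derivative_transform_within_open[of f f' x UNIV S g]
      has_derivative_transform_within_open[of g f' x UNIV S f] by auto
  then show ?thesis by (simp add: frechet_derivative_def)
qed

abbreviation Ck_on where "Ck_on \<equiv> times_differentiable_on"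

lemma Ck_on_cong:
  assumes "open S"
  shows "\<lbrakk>Ck_on n f S; \<And>y. y \<in> S \<Longrightarrow> f y = g y\<rbrakk> \<Longrightarrow> Ck_on n g S"
proof (induction n arbitrary: f g)
  case 0
  then show ?case by (simp cong: continuous_on_cong_simp)
next
  case (Suc n)
  have "g differentiable (at x)" if "x \<in> S" for x
  proof -
    have "(f has_derivative fderiv f x) (at x)" using Suc.prems that by (auto intro: fderiv_works)
    then have "(g has_derivative fderiv f x) (at x)"
      by (rule has_derivative_transform_within_open[OF _ assms that]) (rule Suc.prems(2))
    then show ?thesis by (auto simp: differentiable_def)
  qed
  moreover have "Ck_on n (\<lambda>x. fderiv g x v) S" for v
  proof (rule Suc.IH)
    show "Ck_on n (\<lambda>x. fderiv f x v) S" using Suc.prems by simp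
    show "fderiv f y v = fderiv g y v" if "y \<in> S" for y
      using fderiv_cong_open[OF assms that] Suc.prems by metis
  qed
  ultimately show ?case by simp
qed

lemma Ck_on_subset: "\<lbrakk>Ck_on n f S; T \<subseteq> S\<rbrakk> \<Longrightarrow> Ck_on n f T"
  by (induction n arbitrary: f) (auto intro: continuous_on_subset)

lemma Ck_on_local:
  "(\<And>x. x \<in> S \<Longrightarrow> \<exists>T. open T \<and> x \<in> T \<and> Ck_on n f T)
   \<Longrightarrow> Ck_on n f S"
proof (induction n arbitrary: f)
  case 0
  have "isCont f x" if "x \<in> S" for x
    using 0[OF that] by (auto simp: continuous_on_eq_continuous_at)
  then show ?case by (simp add: continuous_at_imp_continuous_on)
next
  case (Suc n)
  have "f differentiable (at x)" if "x \<in> S" for x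
    using Suc.prems[OF that] by auto
  moreover have "Ck_on n (\<lambda>x. fderiv f x v) S" for v
    by (rule Suc.IH) (use Suc.prems in \<open>fastforce\<close>)
  ultimately show ?case by simp
qed

lemma Ck_on_Suc_imp: "Ck_on (Suc n) f S \<Longrightarrow> Ck_on n f S"
proof (induction n arbitrary: f)
  case 0
  then have "isCont f x" if "x \<in> S" for x
    using that by (auto dest: differentiable_imp_continuous_within)
  then show ?case by (simp add: continuous_at_imp_continuous_on)
next
  case (Suc n)
  then show ?case by (metis times_differentiable_on.simps(2))
qed

lemma Ck_on_add:
  assumes "open S"
  shows "\<lbrakk>Ck_on n f S; Ck_on n g S\<rbrakk>
     \<Longrightarrow> Ck_on n (\<lambda>x. f x + g x) S"
proof (induction n arbitrary: f g)
  case 0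
  then show ?case by (auto intro: continuous_intros)
next
  case (Suc n)
  have d: "((\<lambda>x. f x + g x) has_derivative (\<lambda>v. fderiv f x v + fderiv g x v)) (at x)"
    if "x \<in> S" for x
    using Suc.prems that by (auto intro!: has_derivative_add fderiv_works)
  have "Ck_on n (\<lambda>x. fderiv (\<lambda>x. f x + g x) x v) S" for v
    by (rule Ck_on_cong[OF assms Suc.IH[of "\<lambda>x. fderiv f x v" "\<lambda>x. fderiv g x v"]])
      (use Suc.prems fderiv_eqI[OF d] in auto)
  then show ?case using d by (auto simp: differentiable_def)
qed

lemma Ck_on_const: "Ck_on n (\<lambda>x. c) S"
  by (induction n arbitrary: c) auto

lemma Ck_on_bounded_linear:
  assumes "bounded_linear L"
  shows "Ck_on n L S"
proof (cases n)
  case 0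
  then show ?thesis by (simp add: linear_continuous_on assms)
next
  case (Suc m)
  have "(L has_derivative L) (at x)" for x by (rule bounded_linear_imp_has_derivative[OF assms])
  then have "fderiv L x = L" "L differentiable (at x)" for x
    by (auto intro: fderiv_eqI simp: differentiable_def)
  then show ?thesis by (simp add: Suc Ck_on_const)
qed

lemma Ck_on_bilinear:
  assumes "bounded_bilinear B" "open S"
  shows "\<lbrakk>Ck_on n f S; Ck_on n g S\<rbrakk>
     \<Longrightarrow> Ck_on n (\<lambda>x. B (f x) (g x)) S"
proof (induction n arbitrary: f g)
  case 0
  then show ?case by (auto intro: bounded_bilinear.continuous_on[OF assms(1)])
next
  case (Suc n)
  have d: "((\<lambda>x. B (f x) (g x)) has_derivative (\<lambda>v. B (f x) (fderiv g x v)
    + B (fderiv f x v) (g x))) (at x)"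
    if "x \<in> S" for x
    using Suc.prems that by (auto intro!: bounded_bilinear.FDERIV[OF assms(1)] fderiv_works)
  have "Ck_on n (\<lambda>x. fderiv (\<lambda>x. B (f x) (g x)) x v) S" for v
  proof (rule Ck_on_cong[OF assms(2)])
    show "Ck_on n (\<lambda>x. B (f x) (fderiv g x v) + B (fderiv f x v) (g x)) S"
      using Suc.prems Suc.prems[THEN Ck_on_Suc_imp] by (intro Ck_on_add[OF assms(2)] Suc.IH) simp_all
  qed (use fderiv_eqI[OF d] in auto)
  then show ?case using d by (auto simp: differentiable_def)
qed

lemma Ck_on_sum:
  assumes "open S" "\<And>i. i \<in> I \<Longrightarrow> Ck_on n (f i) S"
  shows "Ck_on n (\<lambda>x. \<Sum>i\<in>I. f i x) S"
  using assms(2)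
  by (induction I rule: infinite_finite_induct) (auto simp: Ck_on_const intro!: Ck_on_add[OF assms(1)])

lemma Ck_on_linear_compose:
  assumes "bounded_linear L" "open S"
  shows "Ck_on n f S \<Longrightarrow> Ck_on n (\<lambda>x. L (f x)) S"
proof (induction n arbitrary: f)
  case 0
  then show ?case by (auto intro: bounded_linear.continuous_on[OF assms(1)])
next
  case (Suc n)
  have d: "((\<lambda>x. L (f x)) has_derivative (\<lambda>v. L (fderiv f x v))) (at x)" if "x \<in> S" for x
    using Suc.prems that by (auto intro!: bounded_linear.has_derivative[OF assms(1)] fderiv_works)
  have "Ck_on n (\<lambda>x. fderiv (\<lambda>x. L (f x)) x v) S" for v
    by (rule Ck_on_cong[OF assms(2) Suc.IH[of "\<lambda>x. fderiv f x v"]])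
      (use Suc.prems fderiv_eqI[OF d] in auto)
  then show ?case using d by (auto simp: differentiable_def)
qed

lemma linear_basis_expand:
  fixes L :: "'a::euclidean_space \<Rightarrow> 'b::real_vector"
  assumes "linear L"
  shows "L u = (\<Sum>i\<in>Basis. (u \<bullet> i) *\<^sub>R L i)"
proof -
  have "L u = L (\<Sum>i\<in>Basis. (u \<bullet> i) *\<^sub>R i)"
    by (simp add: euclidean_representation)
  also have "\<dots> = (\<Sum>i\<in>Basis. (u \<bullet> i) *\<^sub>R L i)"
    by (simp add: linear_sum[OF assms] linear_scale[OF assms])
  finally show ?thesis .
qed

lemma Ck_on_compose:
  fixes g :: "'a::euclidean_space \<Rightarrow> 'b::euclidean_space" and f :: "'b \<Rightarrow> 'c::real_normed_vector"
  assumes "open S" "open T" "g ` S \<subseteq> T"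
  shows "\<lbrakk>Ck_on n f T; Ck_on n g S\<rbrakk>
     \<Longrightarrow> Ck_on n (\<lambda>x. f (g x)) S"
proof (induction n arbitrary: f)
  case 0
  then show ?case
    using assms by (auto intro: continuous_on_compose2)
next
  case (Suc n)
  have df: "(f has_derivative fderiv f (g x)) (at (g x))"
    and dg: "(g has_derivative fderiv g x) (at x)" if "x \<in> S" for x
    using Suc.prems that assms(3) by (auto intro!: fderiv_works)
  have d: "((\<lambda>x. f (g x)) has_derivative (\<lambda>v. \<Sum>i\<in>Basis. (fderiv g x v \<bullet> i) *\<^sub>R fderiv f (g x) i)) (at x)"
    if "x \<in> S" for x
  proof -
    have "((\<lambda>x. f (g x)) has_derivative (\<lambda>v. fderiv f (g x) (fderiv g x v))) (at x)"
      using diff_chain_at[OF dg[OF that] df[OF that]] by (simp add: o_def)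
    moreover have "linear (fderiv f (g x))" using df[OF that] has_derivative_linear by blast
    moreover have "(\<lambda>v. fderiv f (g x) (fderiv g x v))
      = (\<lambda>v. \<Sum>i\<in>Basis. (fderiv g x v \<bullet> i) *\<^sub>R fderiv f (g x) i)"
      by (rule ext) (rule linear_basis_expand[OF calculation(2)])
    ultimately show ?thesis by (blast intro: has_derivative_eq_rhs)
  qed
  have "Ck_on n (\<lambda>x. fderiv (\<lambda>x. f (g x)) x v) S" for v
  proof (rule Ck_on_cong[OF assms(1)])
    show "Ck_on n (\<lambda>x. \<Sum>i\<in>Basis. (fderiv g x v \<bullet> i) *\<^sub>R fderiv f (g x) i) S"
    proof (rule Ck_on_sum[OF assms(1)], rule Ck_on_bilinear[OF bounded_bilinear_scaleR assms(1)])
      fix i :: 'b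
      have g: "Ck_on n (\<lambda>x. fderiv g x v) S"
        using Suc.prems(2) by simp
      show "Ck_on n (\<lambda>x. fderiv g x v \<bullet> i) S"
        by (rule Ck_on_linear_compose[OF bounded_linear_inner_left assms(1) g])
      have f: "Ck_on n (\<lambda>x. fderiv f x i) T"
        using Suc.prems(1) by simp
      show "Ck_on n (\<lambda>x. fderiv f (g x) i) S"
        by (rule Suc.IH[OF f Ck_on_Suc_imp[OF Suc.prems(2)]])
    qed
  qed (use fderiv_eqI[OF d] in auto)
  then show ?case using d by (auto simp: differentiable_def)
qed

lemma smooth_on_subset: "smooth_on S f \<Longrightarrow> T \<subseteq> S \<Longrightarrow> smooth_on T f"
  using Ck_on_subset[of _ f S T] by (auto simp: smooth_on_def)

lemma smooth_on_cong: "\<lbrakk>smooth_on S f; open S; \<And>y. y \<in> S \<Longrightarrow> f y = g y\<rbrakk> \<Longrightarrow> smooth_on S g"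
  unfolding smooth_on_def using Ck_on_cong by metis

lemma smooth_on_local:
  "(\<And>x. x \<in> S \<Longrightarrow> \<exists>T. open T \<and> x \<in> T \<and> smooth_on T f) \<Longrightarrow> smooth_on S f"
  unfolding smooth_on_def by (meson Ck_on_local)

lemma smooth_on_differentiable: "\<lbrakk>smooth_on S f; x \<in> S\<rbrakk> \<Longrightarrow> f differentiable (at x)"
  unfolding smooth_on_def by (metis times_differentiable_on.simps(2))

lemma smooth_on_has_derivative: "\<lbrakk>smooth_on S f; x \<in> S\<rbrakk> \<Longrightarrow> (f has_derivative fderiv f x) (at x)"
  using smooth_on_differentiable fderiv_works by blast

lemma smooth_on_fderiv: "smooth_on S f \<Longrightarrow> smooth_on S (\<lambda>x. fderiv f x v)"
  unfolding smooth_on_def by (metis times_differentiable_on.simps(2))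

lemma smooth_on_continuous: "smooth_on S f \<Longrightarrow> continuous_on S f"
  unfolding smooth_on_def by (metis times_differentiable_on.simps(1))

lemma smooth_on_const: "smooth_on S (\<lambda>x. c)"
  by (simp add: smooth_on_def Ck_on_const)

lemma smooth_on_ident: "smooth_on S (\<lambda>x. x)"
  by (simp add: smooth_on_def Ck_on_bounded_linear bounded_linear_ident)

lemma smooth_on_add: "\<lbrakk>open S; smooth_on S f; smooth_on S g\<rbrakk> \<Longrightarrow> smooth_on S (\<lambda>x. f x + g x)"
  by (simp add: smooth_on_def Ck_on_add)

lemma smooth_on_scaleR:
  "\<lbrakk>open S; smooth_on S f; smooth_on S g\<rbrakk> \<Longrightarrow> smooth_on S (\<lambda>x. f x *\<^sub>R g x)"
  by (simp add: smooth_on_def Ck_on_bilinear bounded_bilinear_scaleR)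

lemma smooth_on_mult:
  fixes f g :: "_ \<Rightarrow> real"
  shows "\<lbrakk>open S; smooth_on S f; smooth_on S g\<rbrakk> \<Longrightarrow> smooth_on S (\<lambda>x. f x * g x)"
  by (simp add: smooth_on_def Ck_on_bilinear bounded_bilinear_mult)

lemma smooth_on_linear_compose:
  "\<lbrakk>open S; bounded_linear L; smooth_on S f\<rbrakk> \<Longrightarrow> smooth_on S (\<lambda>x. L (f x))"
  by (simp add: smooth_on_def Ck_on_linear_compose)

lemma smooth_on_inner_const: "\<lbrakk>open S; smooth_on S f\<rbrakk> \<Longrightarrow> smooth_on S (\<lambda>x. f x \<bullet> i)"
  by (rule smooth_on_linear_compose[OF _ bounded_linear_inner_left])

lemma smooth_on_sum:
  "\<lbrakk>open S; \<And>i. i \<in> I \<Longrightarrow> smooth_on S (f i)\<rbrakk> \<Longrightarrow> smooth_on S (\<lambda>x. \<Sum>i\<in>I. f i x)"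
  by (simp add: smooth_on_def Ck_on_sum)

lemma smooth_on_diff:
  assumes "open S" "smooth_on S f" "smooth_on S g"
  shows "smooth_on S (\<lambda>x. f x - g x)"
proof -
  have "smooth_on S (\<lambda>x. f x + (-1) *\<^sub>R g x)"
    using assms by (intro smooth_on_add smooth_on_scaleR smooth_on_const)
  then show ?thesis by simp
qed

lemma smooth_on_compose:
  fixes g :: "'a::euclidean_space \<Rightarrow> 'b::euclidean_space" and f :: "'b \<Rightarrow> 'c::real_normed_vector"
  shows "\<lbrakk>smooth_on T f; smooth_on S g; open S; open T; g ` S \<subseteq> T\<rbrakk> \<Longrightarrow> smooth_on S (\<lambda>x. f (g x))"
  by (simp add: smooth_on_def Ck_on_compose)

subsection \<open>Fields of bilinear maps\<close>

lemma bilinear_basis_expand: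
  fixes b :: "'e::euclidean_space \<Rightarrow> 'f::euclidean_space \<Rightarrow> 'c::real_vector"
  assumes "bilinear b"
  shows "b u v = (\<Sum>i\<in>Basis. \<Sum>j\<in>Basis. ((u \<bullet> i) * (v \<bullet> j)) *\<^sub>R b i j)"
proof -
  have l: "linear (\<lambda>u. b u v)" "linear (b u)" for u v
    using assms by (auto simp: bilinear_def)
  show ?thesis
    by (subst linear_basis_expand[OF l(1)], rule sum.cong[OF refl],
        subst linear_basis_expand[OF l(2)]) (simp add: scaleR_sum_right)
qed

lemmas bilinear_expand = bilinear_ladd bilinear_radd bilinear_lmul bilinear_rmul bilinear_lsub
  bilinear_rsub bilinear_lneg bilinear_rneg bilinear_lzero bilinear_rzero

text \<open>The arguments \<open>u\<close> and \<open>v\<close> stay fixed while the base point moves in the direction \<open>h\<close>,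
  so that the result is again a bilinear form in \<open>u\<close> and \<open>v\<close>.\<close>

definition bderiv ::
  "('a::euclidean_space \<Rightarrow> 'e \<Rightarrow> 'f \<Rightarrow> 'c::real_normed_vector) \<Rightarrow> 'a \<Rightarrow> 'a \<Rightarrow> 'e \<Rightarrow> 'f \<Rightarrow> 'c" where
  "bderiv b x h u v = fderiv (\<lambda>y. b y u v) x h"

locale smooth_bilinear_field =
  fixes S :: "'a::euclidean_space set"
    and b :: "'a \<Rightarrow> 'e::euclidean_space \<Rightarrow> 'f::euclidean_space \<Rightarrow> 'c::real_normed_vector"
  assumes open_S: "open S"
    and bil: "x \<in> S \<Longrightarrow> bilinear (b x)"
    and smooth: "smooth_on S (\<lambda>x. b x u v)"
begin

lemma has_derivative_const_args: "x \<in> S \<Longrightarrow> ((\<lambda>y. b y u v) has_derivative (\<lambda>h. bderiv b x h u v)) (at x)"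
  unfolding bderiv_def using smooth smooth_on_has_derivative by blast

lemma bilinear_bderiv:
  assumes "x \<in> S" shows "bilinear (bderiv b x h)"
proof -
  have *: "((\<lambda>y. b y (u + u') v) has_derivative (\<lambda>h. bderiv b x h u v + bderiv b x h u' v)) (at x)"
      for u u' v
    by (rule has_derivative_transform_within_open
          [OF has_derivative_add[OF has_derivative_const_args has_derivative_const_args] open_S assms])
      (simp_all add: assms bilinear_ladd[OF bil])
  have **: "((\<lambda>y. b y u (v + v')) has_derivative (\<lambda>h. bderiv b x h u v + bderiv b x h u v')) (at x)"
      for u v v'
    by (rule has_derivative_transform_within_open
          [OF has_derivative_add[OF has_derivative_const_args has_derivative_const_args] open_S assms])
      (simp_all add: assms bilinear_radd[OF bil])
  have ***: "((\<lambda>y. b y (c *\<^sub>R u) v) has_derivative (\<lambda>h. c *\<^sub>R bderiv b x h u v)) (at x)"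
            "((\<lambda>y. b y u (c *\<^sub>R v)) has_derivative (\<lambda>h. c *\<^sub>R bderiv b x h u v)) (at x)" for u v c
    by (rule has_derivative_transform_within_open
          [OF has_derivative_scaleR_right[OF has_derivative_const_args] open_S assms],
        simp_all add: assms bilinear_expand[OF bil])+
  have "bderiv b x h (u + u') v = bderiv b x h u v + bderiv b x h u' v"
       "bderiv b x h u (v + v') = bderiv b x h u v + bderiv b x h u v'"
       "bderiv b x h (c *\<^sub>R u) v = c *\<^sub>R bderiv b x h u v"
       "bderiv b x h u (c *\<^sub>R v) = c *\<^sub>R bderiv b x h u v" for u u' v v' c
    using fderiv_eqI[OF *, THEN fun_cong] fderiv_eqI[OF **, THEN fun_cong]
      fderiv_eqI[OF ***(1), THEN fun_cong] fderiv_eqI[OF ***(2), THEN fun_cong]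
    by (simp_all only: bderiv_def)
  then show ?thesis unfolding bilinear_def by (auto intro!: linearI)
qed

lemma linear_bderiv: "x \<in> S \<Longrightarrow> linear (\<lambda>h. bderiv b x h u v)"
  using has_derivative_const_args has_derivative_linear by blast

lemma smooth_bderiv: "smooth_on S (\<lambda>x. bderiv b x h u v)"
  unfolding bderiv_def by (intro smooth_on_fderiv smooth)

lemma smooth_args:
  fixes P :: "'z::euclidean_space set"
  assumes "open P" "smooth_on P \<Phi>" "\<Phi> ` P \<subseteq> S" "smooth_on P X" "smooth_on P Y"
  shows "smooth_on P (\<lambda>y. b (\<Phi> y) (X y) (Y y))"
proof (rule smooth_on_cong[OF _ assms(1)])
  show "smooth_on P (\<lambda>y. \<Sum>i\<in>Basis. \<Sum>j\<in>Basis. ((X y \<bullet> i) * (Y y \<bullet> j)) *\<^sub>R b (\<Phi> y) i j)"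
    using assms by (intro smooth_on_sum smooth_on_scaleR smooth_on_mult smooth_on_inner_const
        smooth_on_compose[OF smooth] open_S)
qed (rule bilinear_basis_expand[OF bil, symmetric], use assms in auto)

text \<open>The product rule with three factors. After expanding both arguments in a basis, only
  products of scalar functions with fields of constant arguments remain to be
  differentiated.\<close>

lemma has_derivative_args:
  fixes \<Phi> :: "'z::real_normed_vector \<Rightarrow> 'a"
  assumes "open P" "x \<in> P" "\<Phi> ` P \<subseteq> S"
    and d: "(\<Phi> has_derivative \<Phi>') (at x)" "(X has_derivative X') (at x)" "(Y has_derivative Y') (at x)"
  shows "((\<lambda>y. b (\<Phi> y) (X y) (Y y)) has_derivative
     (\<lambda>h. bderiv b (\<Phi> x) (\<Phi>' h) (X x) (Y x) + b (\<Phi> x) (X' h) (Y x) + b (\<Phi> x) (X x) (Y' h))) (at x)"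
proof (rule has_derivative_transform_within_open[OF _ assms(1,2)])
  have x: "\<Phi> x \<in> S" using assms by auto
  have bd: "((\<lambda>y. b (\<Phi> y) i j) has_derivative (\<lambda>h. bderiv b (\<Phi> x) (\<Phi>' h) i j)) (at x)" for i j
    using diff_chain_at[OF d(1) has_derivative_const_args[OF x]] by (simp add: o_def)
  have "((\<lambda>y. \<Sum>i\<in>Basis. \<Sum>j\<in>Basis. ((X y \<bullet> i) * (Y y \<bullet> j)) *\<^sub>R b (\<Phi> y) i j) has_derivative
     (\<lambda>h. \<Sum>i\<in>Basis. \<Sum>j\<in>Basis. ((X x \<bullet> i) * (Y x \<bullet> j)) *\<^sub>R bderiv b (\<Phi> x) (\<Phi>' h) i j
        + ((X x \<bullet> i) * (Y' h \<bullet> j) + (X' h \<bullet> i) * (Y x \<bullet> j)) *\<^sub>R b (\<Phi> x) i j)) (at x)"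
    by (intro has_derivative_sum has_derivative_scaleR has_derivative_mult
        bounded_linear.has_derivative[OF bounded_linear_inner_left] d bd)
  then show "((\<lambda>y. \<Sum>i\<in>Basis. \<Sum>j\<in>Basis. ((X y \<bullet> i) * (Y y \<bullet> j)) *\<^sub>R b (\<Phi> y) i j) has_derivative
     (\<lambda>h. bderiv b (\<Phi> x) (\<Phi>' h) (X x) (Y x) + b (\<Phi> x) (X' h) (Y x) + b (\<Phi> x) (X x) (Y' h))) (at x)"
  proof (rule has_derivative_eq_rhs, intro ext)
    show "(\<Sum>i\<in>Basis. \<Sum>j\<in>Basis. ((X x \<bullet> i) * (Y x \<bullet> j)) *\<^sub>R bderiv b (\<Phi> x) (\<Phi>' h) i j
        + ((X x \<bullet> i) * (Y' h \<bullet> j) + (X' h \<bullet> i) * (Y x \<bullet> j)) *\<^sub>R b (\<Phi> x) i j)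
      = bderiv b (\<Phi> x) (\<Phi>' h) (X x) (Y x) + b (\<Phi> x) (X' h) (Y x) + b (\<Phi> x) (X x) (Y' h)" for h
      unfolding bilinear_basis_expand[OF bilinear_bderiv[OF x], of _ "X x" "Y x"]
        bilinear_basis_expand[OF bil[OF x], of "X' h" "Y x"]
        bilinear_basis_expand[OF bil[OF x], of "X x" "Y' h"]
      by (simp add: sum.distrib scaleR_add_left)
  qed
qed (rule bilinear_basis_expand[OF bil, symmetric], use assms in auto)

end

subsection \<open>Symmetry of second derivatives\<close>

text \<open>The mean value theorem in the direction \<open>u\<close> turns the second difference into a
  difference of two values of the derivative along \<open>u\<close>, to which the expansion at \<open>x\<close> with
  derivative \<open>D\<close> applies. The second difference is symmetric in \<open>u\<close> and \<open>v\<close>; that is how the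
  symmetry of second derivatives arises.\<close>

lemma second_difference_limit:
  fixes f :: "'a::euclidean_space \<Rightarrow> real"
  assumes "open S" "x \<in> S" and diff: "\<And>y. y \<in> S \<Longrightarrow> f differentiable (at y)"
    and d2: "((\<lambda>y. fderiv f y u) has_derivative D) (at x)"
  shows "((\<lambda>h. (f (x + h *\<^sub>R u + h *\<^sub>R v) - f (x + h *\<^sub>R u) - f (x + h *\<^sub>R v) + f x) / h\<^sup>2) \<longlongrightarrow> D v)
     (at_right 0)"
proof -
  obtain r where r: "r > 0" "ball x r \<subseteq> S" using assms(1,2) open_contains_ball by blast
  define M where "M = norm u + norm v + 1"
  have M: "M > 0" by (simp add: M_def add_nonneg_pos)
  interpret D: bounded_linear D using d2 has_derivative_bounded_linear by blast
  have small: "\<exists>\<delta>>0. \<forall>y. norm (y - x) < \<delta> \<longrightarrow> norm (fderiv f y u - fderiv f x u - D (y - x))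
    \<le> e * norm (y - x)"
    if "e > 0" for e
    using d2 that unfolding has_derivative_at_alt by blast
  show ?thesis
  proof (rule tendstoI)
    fix e :: real assume e: "e > 0"
    define e' where "e' = e / (3 * M)"
    have e': "e' > 0" using e M by (simp add: e'_def)
    obtain \<delta> where \<delta>: "\<delta> > 0" "\<And>y. norm (y - x) < \<delta> \<Longrightarrow> \<bar>fderiv f y u - fderiv f x u - D (y - x)\<bar>
      \<le> e' * norm (y - x)"
      using small[OF e'] by auto
    have "dist ((f (x + h *\<^sub>R u + h *\<^sub>R v) - f (x + h *\<^sub>R u) - f (x + h *\<^sub>R v) + f x) / h\<^sup>2) (D v) < e"
      if h: "0 < h" "h < min r \<delta> / M" for h
    proof -
      have hM: "h * M < r" "h * M < \<delta>" using h M by (auto simp: pos_less_divide_eq)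
      have nb: "norm (s *\<^sub>R u + t *\<^sub>R v) \<le> h * M" if "0 \<le> s" "s \<le> h" "0 \<le> t" "t \<le> h" for s t
      proof -
        have "norm (s *\<^sub>R u + t *\<^sub>R v) \<le> s * norm u + t * norm v"
          using norm_triangle_ineq[of "s *\<^sub>R u" "t *\<^sub>R v"] that by simp
        also have "\<dots> \<le> h * norm u + h * norm v" using that by (intro add_mono mult_right_mono) auto
        also have "\<dots> \<le> h * M" using h(1) by (simp add: M_def distrib_left)
        finally show ?thesis .
      qed
      have inS: "x + s *\<^sub>R u + t *\<^sub>R v \<in> S" if "0 \<le> s" "s \<le> h" "0 \<le> t" "t \<le> h" for s t
      proof (rule subsetD[OF r(2)])
        have "dist x (x + s *\<^sub>R u + t *\<^sub>R v) = norm (s *\<^sub>R u + t *\<^sub>R v)"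
          by (metis add.assoc add_diff_cancel_left' dist_commute dist_norm)
        then show "x + s *\<^sub>R u + t *\<^sub>R v \<in> ball x r" using nb[OF that] hM by simp
      qed
      define \<phi> where "\<phi> s = f (x + s *\<^sub>R u + h *\<^sub>R v) - f (x + s *\<^sub>R u)" for s
      have der: "DERIV \<phi> s :> fderiv f (x + s *\<^sub>R u + h *\<^sub>R v) u - fderiv f (x + s *\<^sub>R u) u"
        if s: "0 \<le> s" "s \<le> h" for s
      proof -
        have 1: "(f has_derivative fderiv f (x + s *\<^sub>R u + h *\<^sub>R v)) (at (x + s *\<^sub>R u + h *\<^sub>R v))"
                "(f has_derivative fderiv f (x + s *\<^sub>R u)) (at (x + s *\<^sub>R u))"
          using inS[of s h] inS[of s 0] s h by (auto intro!: fderiv_works diff)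
        have 2: "((\<lambda>s. x + s *\<^sub>R u + h *\<^sub>R v) has_derivative (\<lambda>k. k *\<^sub>R u)) (at s)"
                "((\<lambda>s. x + s *\<^sub>R u) has_derivative (\<lambda>k. k *\<^sub>R u)) (at s)"
          by (auto intro!: derivative_eq_intros)
        have "(\<phi> has_derivative (\<lambda>k. fderiv f (x + s *\<^sub>R u + h *\<^sub>R v) (k *\<^sub>R u) - fderiv f (x
          + s *\<^sub>R u) (k *\<^sub>R u))) (at s)"
          unfolding \<phi>_def using has_derivative_diff[OF diff_chain_at[OF 2(1) 1(1)] diff_chain_at[OF 2(2) 1(2)]]
          by (simp add: o_def)
        moreover have "fderiv f (x + s *\<^sub>R u + h *\<^sub>R v) (k *\<^sub>R u) - fderiv f (x + s *\<^sub>R u) (k *\<^sub>R u)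
           = k * (fderiv f (x + s *\<^sub>R u + h *\<^sub>R v) u - fderiv f (x + s *\<^sub>R u) u)" for k
          using 1[THEN has_derivative_linear] by (simp add: linear_scale right_diff_distrib)
        ultimately show ?thesis
          using has_derivative_imp_has_field_derivative by (metis (no_types, lifting))
      qed
      obtain \<xi> where \<xi>: "0 < \<xi>" "\<xi> < h"
        "\<phi> h - \<phi> 0 = (h - 0) * (fderiv f (x + \<xi> *\<^sub>R u + h *\<^sub>R v) u - fderiv f (x + \<xi> *\<^sub>R u) u)"
        using MVT2[OF h(1) der] by blast
      define p where "p = \<xi> *\<^sub>R u + h *\<^sub>R v"
      define q where "q = \<xi> *\<^sub>R u"
      have np: "norm p \<le> h * M" "norm q \<le> h * M"
        using nb[of \<xi> h] nb[of \<xi> 0] \<xi> h by (auto simp: p_def q_def)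
      have a: "\<bar>fderiv f (x + p) u - fderiv f x u - D p\<bar> \<le> e' * norm p"
           "\<bar>fderiv f (x + q) u - fderiv f x u - D q\<bar> \<le> e' * norm q"
        using \<delta>(2)[of "x + p"] \<delta>(2)[of "x + q"] np hM by auto
      have "D p - D q = h * D v" by (simp add: p_def q_def D.add D.scaleR)
      then have "\<bar>fderiv f (x + p) u - fderiv f (x + q) u - h * D v\<bar> \<le> e' * norm p + e' * norm q"
        using a by argo
      also have "\<dots> \<le> e' * (h * M) + e' * (h * M)"
        using np e' by (intro add_mono mult_left_mono) auto
      also have "\<dots> = h * (2 * e / 3)" using M by (simp add: e'_def)
      also have "\<dots> < h * e" using h e by simp
      finally have *: "\<bar>fderiv f (x + p) u - fderiv f (x + q) u - h * D v\<bar> < h * e" .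
      have "f (x + h *\<^sub>R u + h *\<^sub>R v) - f (x + h *\<^sub>R u) - f (x + h *\<^sub>R v) + f x = \<phi> h - \<phi> 0"
        by (simp add: \<phi>_def)
      also have "\<dots> = h * (fderiv f (x + p) u - fderiv f (x + q) u)"
        using \<xi> by (simp add: p_def q_def add.assoc)
      finally have eq: "f (x + h *\<^sub>R u + h *\<^sub>R v) - f (x + h *\<^sub>R u) - f (x + h *\<^sub>R v) + f x
        = h * (fderiv f (x + p) u - fderiv f (x + q) u)" .
      have "(h * (fderiv f (x + p) u - fderiv f (x + q) u)) / h\<^sup>2 - D v
         = (fderiv f (x + p) u - fderiv f (x + q) u - h * D v) / h"
        using h(1) by (simp add: power2_eq_square diff_divide_distrib)
      moreover have "\<bar>(fderiv f (x + p) u - fderiv f (x + q) u - h * D v) / h\<bar> < e"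
        using * h(1) by (simp add: pos_divide_less_eq mult.commute)
      ultimately show ?thesis unfolding eq dist_norm by (simp only: real_norm_def)
    qed
    moreover have "min r \<delta> / M > 0" using r \<delta> M by simp
    ultimately show "\<forall>\<^sub>F h in at_right 0. dist ((f (x + h *\<^sub>R u + h *\<^sub>R v) - f (x + h *\<^sub>R u) - f (x
      + h *\<^sub>R v) + f x) / h\<^sup>2) (D v) < e"
      unfolding eventually_at_right_field by blast
  qed
qed

lemma second_derivative_symmetric:
  fixes f :: "'a::euclidean_space \<Rightarrow> 'b::euclidean_space"
  assumes "open S" "x \<in> S" "smooth_on S f"
  shows "fderiv (\<lambda>y. fderiv f y u) x v = fderiv (\<lambda>y. fderiv f y v) x u"
proof (rule euclidean_eqI)
  fix i :: 'b
  define F where "F y = f y \<bullet> i" for y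
  have dF: "fderiv F y w = fderiv f y w \<bullet> i" "F differentiable (at y)" if "y \<in> S" for y w
  proof -
    have "(F has_derivative (\<lambda>w. fderiv f y w \<bullet> i)) (at y)"
      unfolding F_def using smooth_on_has_derivative[OF assms(3) that]
      by (rule bounded_linear.has_derivative[OF bounded_linear_inner_left])
    then show "fderiv F y w = fderiv f y w \<bullet> i" "F differentiable (at y)"
      by (auto dest: fderiv_eqI simp: differentiable_def)
  qed
  have d2: "((\<lambda>y. fderiv F y w) has_derivative (\<lambda>h. fderiv (\<lambda>y. fderiv f y w) x h \<bullet> i)) (at x)" for w
  proof (rule has_derivative_transform_within_open[OF _ assms(1,2)])
    show "((\<lambda>y. fderiv f y w \<bullet> i) has_derivative (\<lambda>h. fderiv (\<lambda>y. fderiv f y w) x h \<bullet> i)) (at x)"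
      using smooth_on_has_derivative[OF smooth_on_fderiv[OF assms(3)] assms(2)]
      by (rule bounded_linear.has_derivative[OF bounded_linear_inner_left])
  qed (simp add: dF)
  have sym: "F (x + h *\<^sub>R u + h *\<^sub>R v) - F (x + h *\<^sub>R u) - F (x + h *\<^sub>R v) + F x
     = F (x + h *\<^sub>R v + h *\<^sub>R u) - F (x + h *\<^sub>R v) - F (x + h *\<^sub>R u) + F x" for h
    by (simp add: add.assoc add.commute[of "h *\<^sub>R u"])
  show "fderiv (\<lambda>y. fderiv f y u) x v \<bullet> i = fderiv (\<lambda>y. fderiv f y v) x u \<bullet> i"
    using second_difference_limit[OF assms(1,2) dF(2) d2, of u v]
      second_difference_limit[OF assms(1,2) dF(2) d2, of v u]
    unfolding sym by (intro tendsto_unique[of "at_right (0::real)"]) auto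
qed


subsection \<open>Linear systems depending smoothly on parameters\<close>

lemma scalar_product_bilinear: "scalar_product b \<Longrightarrow> bilinear b"
  and scalar_product_commute: "scalar_product b \<Longrightarrow> b u v = b v u"
  and scalar_product_nondegenerate: "scalar_product b \<Longrightarrow> (\<And>w. b u w = 0) \<Longrightarrow> u = 0"
  by (auto simp: scalar_product_def)

lemma scalar_product_eqI:
  assumes "scalar_product b" "\<And>w. b u w = b v w"
  shows "u = v"
  using scalar_product_nondegenerate[OF assms(1), of "u - v"] assms(2)
  by (simp add: bilinear_lsub[OF scalar_product_bilinear[OF assms(1)]])

text \<open>The endomorphism that represents the form by means of the inner product; the form is
  nondegenerate when this map is injective.\<close>

definition basis_values :: "('e::euclidean_space \<Rightarrow> 'e \<Rightarrow> real) \<Rightarrow> 'e \<Rightarrow> 'e" where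
  "basis_values b u = (\<Sum>i\<in>Basis. b u i *\<^sub>R i)"

lemma basis_values_inner: "i \<in> Basis \<Longrightarrow> basis_values b u \<bullet> i = b u i"
  unfolding basis_values_def by simp

lemma linear_basis_values: "bilinear b \<Longrightarrow> linear (basis_values b)"
  unfolding basis_values_def
  by (auto intro!: linearI simp: bilinear_ladd bilinear_lmul scaleR_left_distrib sum.distrib
    scaleR_sum_right)

lemma inj_basis_values:
  assumes "scalar_product b" shows "inj (basis_values b)"
proof -
  have b: "bilinear b" by (rule scalar_product_bilinear[OF assms])
  have "u = 0" if "basis_values b u = 0" for u
  proof (rule scalar_product_nondegenerate[OF assms])
    have "b u i = 0" if "i \<in> Basis" for i
      using basis_values_inner[OF that, of b u] \<open>basis_values b u = 0\<close> by simp
    then show "b u w = 0" for w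
      using linear_basis_expand[of "b u" w] b by (simp add: bilinear_def)
  qed
  then show ?thesis by (simp add: linear_injective_0[OF linear_basis_values[OF b]])
qed

lemma scalar_product_solve:
  assumes "scalar_product b"
  shows "\<exists>z. \<forall>i\<in>Basis. b z i = r i"
proof -
  have "surj (basis_values b)"
    using linear_injective_imp_surjective[OF linear_basis_values inj_basis_values] assms
      scalar_product_bilinear by blast
  then obtain z where "basis_values b z = (\<Sum>i\<in>Basis. r i *\<^sub>R i)" by (metis surjD)
  then have "b z i = r i" if "i \<in> Basis" for i
    using basis_values_inner[OF that, of b z] that by simp
  then show ?thesis by blast
qed

lemma linear_eq_Basis:
  assumes "linear f" "linear g" "\<And>i. i \<in> Basis \<Longrightarrow> f i = g i"
  shows "f u = g (u::'a::euclidean_space)"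
  using assms linear_eq_stdbasis by metis

lemma scalar_product_eq_Basis:
  assumes "scalar_product b" "\<And>i. i \<in> Basis \<Longrightarrow> b u i = b v i"
  shows "u = v"
proof (rule scalar_product_eqI[OF assms(1)])
  show "b u w = b v w" for w
    by (rule linear_eq_Basis[of "b u" "b v"])
      (use assms scalar_product_bilinear[OF assms(1)] in \<open>auto simp: bilinear_def\<close>)
qed

text \<open>The endomorphism representing \<open>g\<close> is bounded below by some \<open>B > 0\<close>, hence those of
  nearby forms by \<open>B / 2\<close>. Therefore a small error in the equations means a small error in
  the solution.\<close>

lemma solution_tendsto:
  fixes G :: "'a \<Rightarrow> 'e::euclidean_space \<Rightarrow> 'e \<Rightarrow> real"
  assumes g: "scalar_product g"
    and bil: "eventually (\<lambda>y. bilinear (G y)) F"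
    and lim: "\<And>u v. ((\<lambda>y. G y u v) \<longlongrightarrow> g u v) F"
    and sol: "\<And>i. i \<in> Basis \<Longrightarrow> ((\<lambda>y. G y (\<zeta> y) i) \<longlongrightarrow> g z i) F"
  shows "(\<zeta> \<longlongrightarrow> z) F"
proof -
  have lg: "linear (basis_values g)" by (intro linear_basis_values scalar_product_bilinear g)
  obtain B where B: "B > 0" "\<And>u. B * norm u \<le> norm (basis_values g u)"
    using linear_inj_bounded_below_pos[OF lg inj_basis_values[OF g]] by blast
  have "((\<lambda>y. \<Sum>j\<in>Basis. norm (basis_values (G y) j - basis_values g j)) \<longlongrightarrow> (\<Sum>j\<in>Basis. norm
    (basis_values g j - basis_values g j))) F"
    unfolding basis_values_def by (intro tendsto_intros lim)
  then have "eventually (\<lambda>y. (\<Sum>j\<in>Basis. norm (basis_values (G y) j - basis_values g j)) < B / 2) F"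
    using B(1) by (auto dest: order_tendstoD(2)[where a = "B / 2"])
  with bil have ev: "eventually (\<lambda>y. norm (\<zeta> y - z)
    \<le> (2 / B) * norm (basis_values (G y) (\<zeta> y) - basis_values (G y) z)) F"
  proof eventually_elim
    case (elim y)
    let ?D = "\<lambda>u. basis_values (G y) u - basis_values g u"
    define u where "u = \<zeta> y - z"
    have lG: "linear (basis_values (G y))" using linear_basis_values elim(1) by blast
    have "linear ?D" using lG lg by (rule linear_compose_sub)
    then have "norm (?D u) = norm (\<Sum>j\<in>Basis. (u \<bullet> j) *\<^sub>R ?D j)" by (subst linear_basis_expand) auto
    also have "\<dots> \<le> (\<Sum>j\<in>Basis. norm u * norm (?D j))"
      by (intro sum_norm_le) (simp add: mult_right_mono Basis_le_norm)
    also have "\<dots> = norm u * (\<Sum>j\<in>Basis. norm (?D j))" by (simp add: sum_distrib_left)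
    also have "\<dots> \<le> norm u * (B / 2)" using elim(2) by (intro mult_left_mono) auto
    finally have "norm (?D u) \<le> norm u * (B / 2)" .
    moreover have "norm (basis_values g u) \<le> norm (basis_values (G y) u) + norm (?D u)"
      using norm_triangle_ineq4[of "basis_values (G y) u" "?D u"] by simp
    ultimately have "B / 2 * norm u \<le> norm (basis_values (G y) u)"
      using B(2)[of u] by (simp add: mult.commute)
    then show ?case using B(1) by (simp add: u_def linear_diff[OF lG] field_simps)
  qed
  have t: "((\<lambda>y. basis_values (G y) (\<zeta> y) - basis_values (G y) z) \<longlongrightarrow> basis_values g z - basis_values g z) F"
    unfolding basis_values_def by (intro tendsto_intros lim sol)
  have "((\<lambda>y. (2 / B) * norm (basis_values (G y) (\<zeta> y) - basis_values (G y) z)) \<longlongrightarrow> (2 / B) * norm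
    (basis_values g z - basis_values g z)) F"
    by (intro tendsto_intros t)
  then have "((\<lambda>y. (2 / B) * norm (basis_values (G y) (\<zeta> y) - basis_values (G y) z)) \<longlongrightarrow> 0) F" by simp
  from Lim_null_comparison[OF ev this] show ?thesis by (simp add: LIM_zero_iff)
qed

locale metric_field = smooth_bilinear_field S b
  for S :: "'e::euclidean_space set" and b :: "'e \<Rightarrow> 'e \<Rightarrow> 'e \<Rightarrow> real" +
  assumes scalar_product: "x \<in> S \<Longrightarrow> scalar_product (b x)"
begin

lemma tendsto_field: "x \<in> S \<Longrightarrow> ((\<lambda>y. b y u v) \<longlongrightarrow> b x u v) (at x)"
  using has_derivative_const_args has_derivative_continuous isCont_def by blast

lemma eventually_in_S: "x \<in> S \<Longrightarrow> eventually (\<lambda>y. y \<in> S) (at x)"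
  using open_S eventually_at_topological by blast

text \<open>The equation for \<open>z'\<close> comes from differentiating the system formally. The error
  quotient \<open>\<zeta>\<close> then solves a system whose right-hand side tends to \<open>0\<close>, and
  \<open>solution_tendsto\<close> applies.\<close>

lemma solution_has_derivative:
  assumes x: "x \<in> S"
    and sol: "\<And>y i. y \<in> S \<Longrightarrow> i \<in> Basis \<Longrightarrow> b y (z y) i = r i y"
    and r: "\<And>i. i \<in> Basis \<Longrightarrow> (r i has_derivative r' i) (at x)"
    and z': "\<And>h i. i \<in> Basis \<Longrightarrow> b x (z' h) i = r' i h - bderiv b x h (z x) i"
  shows "(z has_derivative z') (at x)"
proof -
  note spx = scalar_product[OF x] and bx = bil[OF x]
  have lr: "linear (r' i)" if "i \<in> Basis" for i using r[OF that] has_derivative_linear by blast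
  note lb = linear_bderiv[OF x]
  have "linear z'"
  proof (rule linearI)
    show "z' (h + k) = z' h + z' k" for h k
      by (rule scalar_product_eq_Basis[OF spx])
        (simp add: z' bilinear_ladd[OF bx] linear_add[OF lr] linear_add[OF lb])
    show "z' (c *\<^sub>R h) = c *\<^sub>R z' h" for c h
      by (rule scalar_product_eq_Basis[OF spx])
        (simp add: z' bilinear_lmul[OF bx] linear_scale[OF lr] linear_scale[OF lb] right_diff_distrib)
  qed
  then have blz: "bounded_linear z'" using linear_conv_bounded_linear by blast
  obtain C where C: "\<And>h. norm (z' h) \<le> C * norm h" using linear_bounded[OF \<open>linear z'\<close>] by blast
  define \<zeta> where "\<zeta> y = (1 / norm (y - x)) *\<^sub>R (z y - z x - z' (y - x))" for y
  have "(\<zeta> \<longlongrightarrow> 0) (at x)"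
  proof (rule solution_tendsto[where G = b, OF spx])
    show "eventually (\<lambda>y. bilinear (b y)) (at x)"
      using eventually_in_S[OF x] by eventually_elim (rule bil)
    show "((\<lambda>y. b y u v) \<longlongrightarrow> b x u v) (at x)" for u v by (rule tendsto_field[OF x])
    fix i :: 'e assume i: "i \<in> Basis"
    have 1: "((\<lambda>y. (r i y - r i x - r' i (y - x)) / norm (y - x)) \<longlongrightarrow> 0) (at x)"
      using r[OF i] unfolding has_derivative_within by (simp add: divide_inverse mult.commute diff_diff_eq)
    have 2: "((\<lambda>y. (b y (z x) i - b x (z x) i - bderiv b x (y - x) (z x) i) / norm (y - x)) \<longlongrightarrow> 0) (at x)"
      using has_derivative_const_args[OF x, of "z x" i] unfolding has_derivative_within
        by (simp add: divide_inverse mult.commute diff_diff_eq)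
    have 3: "((\<lambda>y. (b x (z' (y - x)) i - b y (z' (y - x)) i) / norm (y - x)) \<longlongrightarrow> 0) (at x)"
    proof (rule Lim_null_comparison)
      show "eventually (\<lambda>y. norm ((b x (z' (y - x)) i - b y (z' (y - x)) i) / norm (y - x))
        \<le> C * (\<Sum>j\<in>Basis. \<bar>b x j i - b y j i\<bar>)) (at x)"
        using eventually_in_S[OF x] eventually_neq_at_within[of x x UNIV]
      proof eventually_elim
        case (elim y)
        let ?w = "z' (y - x)"
        have "linear (\<lambda>u. b x u i - b y u i)"
          using bx bil[OF elim(1)] by (intro linear_compose_sub) (auto simp: bilinear_def)
        then have "norm (b x ?w i - b y ?w i) = norm (\<Sum>j\<in>Basis. (?w \<bullet> j) *\<^sub>R (b x j i - b y j i))"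
          by (subst linear_basis_expand) auto
        also have "\<dots> \<le> (\<Sum>j\<in>Basis. norm ?w * \<bar>b x j i - b y j i\<bar>)"
          by (intro sum_norm_le) (simp add: abs_mult mult_right_mono Basis_le_norm)
        also have "\<dots> = norm ?w * (\<Sum>j\<in>Basis. \<bar>b x j i - b y j i\<bar>)" by (simp add: sum_distrib_left)
        also have "\<dots> \<le> C * norm (y - x) * (\<Sum>j\<in>Basis. \<bar>b x j i - b y j i\<bar>)"
          by (intro mult_right_mono C sum_nonneg) auto
        finally show ?case using elim(2) by (simp add: field_simps)
      qed
      have "((\<lambda>y. C * (\<Sum>j\<in>Basis. \<bar>b x j i - b y j i\<bar>)) \<longlongrightarrow> C * (\<Sum>j\<in>Basis. \<bar>b x j i - b x j i\<bar>)) (at x)"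
        by (intro tendsto_intros tendsto_field[OF x])
      then show "((\<lambda>y. C * (\<Sum>j\<in>Basis. \<bar>b x j i - b y j i\<bar>)) \<longlongrightarrow> 0) (at x)" by simp
    qed
    have "eventually (\<lambda>y. (r i y - r i x - r' i (y - x)) / norm (y - x)
        - (b y (z x) i - b x (z x) i - bderiv b x (y - x) (z x) i) / norm (y - x)
        + (b x (z' (y - x)) i - b y (z' (y - x)) i) / norm (y - x) = b y (\<zeta> y) i) (at x)"
      using eventually_in_S[OF x]
    proof eventually_elim
      case (elim y)
      have "b y (\<zeta> y) i = (b y (z y) i - b y (z x) i - b y (z' (y - x)) i) / norm (y - x)"
        by (simp add: \<zeta>_def bilinear_expand[OF bil[OF elim]])
      also have "\<dots> = (r i y - b y (z x) i - b y (z' (y - x)) i) / norm (y - x)"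
        using sol[OF elim i] by simp
      also have "\<dots> = ((r i y - r i x - r' i (y - x)) - (b y (z x) i - b x (z x) i - bderiv b x (y - x)
        (z x) i)
        + (b x (z' (y - x)) i - b y (z' (y - x)) i)) / norm (y - x)"
        using sol[OF x i] z'[OF i, of "y - x"] by simp
      finally show ?case by (simp only: add_divide_distrib diff_divide_distrib)
    qed
    moreover have "((\<lambda>y. (r i y - r i x - r' i (y - x)) / norm (y - x)
        - (b y (z x) i - b x (z x) i - bderiv b x (y - x) (z x) i) / norm (y - x)
        + (b x (z' (y - x)) i - b y (z' (y - x)) i) / norm (y - x)) \<longlongrightarrow> 0 - 0 + 0) (at x)"
      by (intro tendsto_add tendsto_diff 1 2 3)
    ultimately show "((\<lambda>y. b y (\<zeta> y) i) \<longlongrightarrow> b x 0 i) (at x)"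
      by (simp add: bilinear_lzero[OF bx] tendsto_cong)
  qed
  then have "((\<lambda>y. (1 / norm (y - x)) *\<^sub>R (z y - z x - z' (y - x))) \<longlongrightarrow> 0) (at x)"
    by (simp add: \<zeta>_def[abs_def])
  then show ?thesis
    unfolding has_derivative_within using blz by (simp add: diff_diff_eq divide_inverse)
qed

text \<open>The derivative of a solution solves a system with the same coefficients, whose
  right-hand side involves the solution itself and first derivatives of the data. The
  induction on the order of differentiability therefore has to range over all right-hand
  sides.\<close>

lemma solution_smooth:
  assumes sol: "\<And>y i. y \<in> S \<Longrightarrow> i \<in> Basis \<Longrightarrow> b y (z y) i = r i y"
    and r: "\<And>i. i \<in> Basis \<Longrightarrow> smooth_on S (r i)"
  shows "smooth_on S z"
proof -
  have "Ck_on n z S"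
    if "\<And>y i. y \<in> S \<Longrightarrow> i \<in> Basis \<Longrightarrow> b y (z y) i = r i y"
      "\<And>i. i \<in> Basis \<Longrightarrow> Ck_on n (r i) S" for n z r
    using that
  proof (induction n arbitrary: z r)
    case 0
    have "(z \<longlongrightarrow> z x) (at x)" if x: "x \<in> S" for x
    proof (rule solution_tendsto[where G = b, OF scalar_product[OF x]])
      show "eventually (\<lambda>y. bilinear (b y)) (at x)"
        using eventually_in_S[OF x] by eventually_elim (rule bil)
      show "((\<lambda>y. b y u v) \<longlongrightarrow> b x u v) (at x)" for u v by (rule tendsto_field[OF x])
      fix i :: 'e assume i: "i \<in> Basis"
      have "(r i \<longlongrightarrow> r i x) (at x)"
        using 0(2)[OF i] x by (simp add: continuous_on_eq_continuous_at[OF open_S] isCont_def)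
      moreover have "eventually (\<lambda>y. b y (z y) i = r i y) (at x)"
        using eventually_in_S[OF x] by eventually_elim (rule 0(1)[OF _ i])
      ultimately show "((\<lambda>y. b y (z y) i) \<longlongrightarrow> b x (z x) i) (at x)"
        using 0(1)[OF x i] by (simp add: tendsto_cong)
    qed
    then show ?case by (simp add: continuous_on_eq_continuous_at open_S isCont_def)
  next
    case (Suc n)
    have "\<exists>z'. \<forall>i\<in>Basis. b x z' i = fderiv (r i) x h - bderiv b x h (z x) i" if "x \<in> S" for x h
      by (rule scalar_product_solve[OF scalar_product[OF that]])
    then obtain z' where z': "\<And>x h i. \<lbrakk>x \<in> S; i \<in> Basis\<rbrakk> \<Longrightarrow> b x (z' x h) i
      = fderiv (r i) x h - bderiv b x h (z x) i"
      by metis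
    have der: "(z has_derivative z' x) (at x)" if "x \<in> S" for x
    proof (rule solution_has_derivative[where r = r and r' = "\<lambda>i. fderiv (r i) x"])
      show "(r i has_derivative fderiv (r i) x) (at x)" if "i \<in> Basis" for i
        using Suc.prems(2)[OF that] \<open>x \<in> S\<close> by (simp add: fderiv_works)
    qed (use that Suc.prems z' in auto)
    have zn: "Ck_on n z S"
      using Suc.prems(1) Ck_on_Suc_imp[OF Suc.prems(2)] by (rule Suc.IH)
    have "Ck_on n (\<lambda>x. z' x h) S" for h
    proof (rule Suc.IH)
      fix i :: 'e assume i: "i \<in> Basis"
      have *: "Ck_on n (\<lambda>x. bderiv b x h j i) S" for j
        using smooth_bderiv by (auto simp: smooth_on_def)
      have **: "Ck_on n (\<lambda>x. (z x \<bullet> j) * bderiv b x h j i) S" for j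
        by (rule Ck_on_bilinear[OF bounded_bilinear_mult open_S Ck_on_linear_compose[OF bounded_linear_inner_left open_S zn] *])
      have "Ck_on n (\<lambda>x. fderiv (r i) x h + (-1) * (\<Sum>j\<in>Basis. (z x \<bullet> j) * bderiv b x h j i)) S"
        using Suc.prems(2)[OF i]
        by (intro Ck_on_add[OF open_S] Ck_on_bilinear[OF bounded_bilinear_mult open_S Ck_on_const]
          Ck_on_sum[OF open_S] **) simp
      then show "Ck_on n (\<lambda>x. fderiv (r i) x h + (-1) * (\<Sum>j\<in>Basis. (z x \<bullet> j) * bderiv b x h j i)) S" .
      show "b x (z' x h) i = fderiv (r i) x h + (-1) * (\<Sum>j\<in>Basis. (z x \<bullet> j) * bderiv b x h j i)"
        if "x \<in> S" for x
      proof -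
        have "linear (\<lambda>u. bderiv b x h u i)" using bilinear_bderiv[OF that] by (simp add: bilinear_def)
        from linear_basis_expand[OF this, of "z x"] show ?thesis by (simp add: z'[OF that i])
      qed
    qed
    then have "Ck_on n (\<lambda>x. fderiv z x h) S" for h
      by (rule Ck_on_cong[OF open_S]) (use fderiv_eqI[OF der] in auto)
    then show ?case using der by (auto simp: differentiable_def)
  qed
  from this[OF sol] show ?thesis using r by (auto simp: smooth_on_def)
qed

end

section \<open>Metrics on open subsets of a vector space\<close>

text \<open>The Levi-Civita connection on constant fields, \<open>koszul b x u v = (\<nabla>\<^sub>u v)(x)\<close>. For the
  metric in a chart it is the Christoffel form of that chart.\<close>

definition koszul :: "('e::euclidean_space \<Rightarrow> 'e \<Rightarrow> 'e \<Rightarrow> real) \<Rightarrow> 'e \<Rightarrow> 'e \<Rightarrow> 'e \<Rightarrow> 'e" where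
  "koszul b x u v =
     (THE z. \<forall>w. b x z w = (bderiv b x u v w + bderiv b x v u w - bderiv b x w u v) / 2)"

text \<open>On constant fields this is \<open>R(u,v)w = \<nabla>\<^sub>v\<nabla>\<^sub>u w - \<nabla>\<^sub>u\<nabla>\<^sub>v w\<close>, so that \<open>b(R(u,v)u,v)\<close> is
  the numerator of the sectional curvature.\<close>

definition riem :: "('e::euclidean_space \<Rightarrow> 'e \<Rightarrow> 'e \<Rightarrow> real) \<Rightarrow> 'e \<Rightarrow> 'e \<Rightarrow> 'e \<Rightarrow> 'e \<Rightarrow> 'e" where
  "riem b x u v w =
     bderiv (koszul b) x v u w + koszul b x v (koszul b x u w)
   - (bderiv (koszul b) x u v w + koszul b x u (koszul b x v w))"

definition hess ::
  "('e::euclidean_space \<Rightarrow> 'e \<Rightarrow> 'e \<Rightarrow> real) \<Rightarrow> ('e \<Rightarrow> real) \<Rightarrow> 'e \<Rightarrow> 'e \<Rightarrow> 'e \<Rightarrow> real" where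
  "hess b f x u v = fderiv (\<lambda>y. fderiv f y v) x u - fderiv f x (koszul b x u v)"

context metric_field
begin

lemma field_commute: "x \<in> S \<Longrightarrow> b x u v = b x v u"
  by (rule scalar_product_commute[OF scalar_product])

lemma bderiv_commute: "x \<in> S \<Longrightarrow> bderiv b x h u v = bderiv b x h v u"
  unfolding bderiv_def by (rule fun_cong[OF fderiv_cong_open[OF open_S]]) (auto intro: field_commute)

lemma koszul_unique_existence:
  assumes "x \<in> S"
  shows "\<exists>!z. \<forall>w. b x z w = (bderiv b x u v w + bderiv b x v u w - bderiv b x w u v) / 2"
proof -
  let ?r = "\<lambda>w. (bderiv b x u v w + bderiv b x v u w - bderiv b x w u v) / 2"
  have lr: "linear ?r"
    by (rule linearI)
      (simp_all add: bilinear_expand[OF bilinear_bderiv[OF assms]]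
        linear_add[OF linear_bderiv[OF assms]] linear_scale[OF linear_bderiv[OF assms]] field_simps)
  obtain z where "\<forall>i\<in>Basis. b x z i = ?r i" using
    scalar_product_solve[OF scalar_product[OF assms], of ?r] by blast
  moreover have "linear (b x z)" using bil[OF assms] by (simp add: bilinear_def)
  ultimately have "b x z w = ?r w" for w
    using linear_eq_Basis[of "b x z" ?r w] lr by blast
  note z = this
  show ?thesis
  proof (rule ex1I[of _ z])
    show "\<forall>w. b x z w = ?r w" using z by blast
    show "z' = z" if "\<forall>w. b x z' w = ?r w" for z'
      by (rule scalar_product_eqI[OF scalar_product[OF assms]]) (metis z that)
  qed
qed

lemma koszul_char:
  "x \<in> S \<Longrightarrow> b x (koszul b x u v) w = (bderiv b x u v w + bderiv b x v u w - bderiv b x w u v) / 2"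
  unfolding koszul_def using theI'[OF koszul_unique_existence] by blast

lemma koszul_eqI:
  assumes "x \<in> S" "\<And>w. b x z w = (bderiv b x u v w + bderiv b x v u w - bderiv b x w u v) / 2"
  shows "koszul b x u v = z"
  by (rule scalar_product_eqI[OF scalar_product[OF assms(1)]]) (simp add: koszul_char assms)

lemma koszul_commute: "x \<in> S \<Longrightarrow> koszul b x u v = koszul b x v u"
  by (rule koszul_eqI) (simp_all add: koszul_char bderiv_commute[of x _ u v])

lemma bilinear_koszul:
  assumes "x \<in> S" shows "bilinear (koszul b x)"
proof -
  note b = bilinear_bderiv[OF assms] and l = linear_bderiv[OF assms]
  have add: "koszul b x (u + u') v = koszul b x u v + koszul b x u' v" for u u' v
    by (rule koszul_eqI[OF assms])
      (simp add: bilinear_ladd[OF bil[OF assms]] koszul_char[OF assms] bilinear_expand[OF b]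
        linear_add[OF l] field_simps)
  have scale: "koszul b x (c *\<^sub>R u) v = c *\<^sub>R koszul b x u v" for c u v
    by (rule koszul_eqI[OF assms])
      (simp add: bilinear_lmul[OF bil[OF assms]] koszul_char[OF assms] bilinear_expand[OF b]
        linear_scale[OF l] field_simps)
  have "linear (\<lambda>u. koszul b x u v)" for v by (rule linearI) (simp_all add: add scale)
  moreover have "linear (koszul b x u)" for u
    using koszul_commute[OF assms, of u] add scale by (intro linearI) simp_all
  ultimately show ?thesis by (simp add: bilinear_def)
qed

sublocale Chr: smooth_bilinear_field S "koszul b"
proof
  show "smooth_on S (\<lambda>x. koszul b x u v)" for u v
  proof (rule solution_smooth)
    show "b y (koszul b y u v) i = (1 / 2) * (bderiv b y u v i + bderiv b y v u i - bderiv b y i u v)"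
      if "y \<in> S" for y i
      by (simp add: koszul_char[OF that])
    show "smooth_on S (\<lambda>y. (1 / 2) * (bderiv b y u v i + bderiv b y v u i - bderiv b y i u v))" for i
      by (intro smooth_on_mult smooth_on_const smooth_on_diff smooth_on_add open_S smooth_bderiv)
  qed
qed (auto simp: open_S bilinear_koszul)

lemma metric_compatible:
  "x \<in> S \<Longrightarrow> bderiv b x h u v = b x (koszul b x h u) v + b x u (koszul b x h v)"
  using bderiv_commute[of x h u v] by (simp add: field_commute[of x u "koszul b x h v"] koszul_char
    field_simps)

text \<open>Uniqueness of the Levi-Civita connection: in the Koszul combination of the
  compatibility equations everything but \<open>2 b(C(u,v),w)\<close> cancels by the symmetry of \<open>C\<close>.\<close>

lemma koszul_eq_of_metric_compatible:
  assumes "x \<in> S" "\<And>u v. C u v = C v u"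
    and "\<And>h u v. bderiv b x h u v = b x (C h u) v + b x u (C h v)"
  shows "koszul b x u v = C u v"
proof (rule koszul_eqI[OF assms(1)])
  fix w
  have "b x v (C u w) = b x (C w u) v"
    by (simp only: field_commute[OF assms(1), of v] assms(2)[of u w])
  then show "b x (C u v) w = (bderiv b x u v w + bderiv b x v u w - bderiv b x w u v) / 2"
    by (simp only: assms(3) assms(2)[of v u] assms(2)[of w v]) simp
qed

end


subsection \<open>Invariance under local isometries\<close>

lemma has_derivative_linear_field:
  fixes L :: "'a::real_normed_vector \<Rightarrow> 'b::euclidean_space \<Rightarrow> 'c::real_normed_vector"
  assumes "open P" "y \<in> P" and lin: "\<And>z. z \<in> P \<Longrightarrow> linear (L z)"
    and L: "\<And>u. ((\<lambda>z. L z u) has_derivative L' u) (at y)"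
    and w: "(w has_derivative w') (at y)"
  shows "((\<lambda>z. L z (w z)) has_derivative (\<lambda>h. L' (w y) h + L y (w' h))) (at y)"
proof (rule has_derivative_transform_within_open[OF _ assms(1,2)])
  have "((\<lambda>z. L z (u + v)) has_derivative (\<lambda>h. L' u h + L' v h)) (at y)" for u v
    by (rule has_derivative_transform_within_open[OF has_derivative_add[OF L L] assms(1,2)])
      (simp add: linear_add[OF lin])
  moreover have "((\<lambda>z. L z (a *\<^sub>R u)) has_derivative (\<lambda>h. a *\<^sub>R L' u h)) (at y)" for a u
    by (rule has_derivative_transform_within_open[OF has_derivative_scaleR_right[OF L] assms(1,2)])
      (simp add: linear_scale[OF lin])
  ultimately have lin': "linear (\<lambda>u. L' u h)" for h
    by (intro linearI) (use has_derivative_unique[OF L] in metis)+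
  have "((\<lambda>z. \<Sum>j\<in>Basis. (w z \<bullet> j) *\<^sub>R L z j) has_derivative
      (\<lambda>h. \<Sum>j\<in>Basis. (w y \<bullet> j) *\<^sub>R L' j h + (w' h \<bullet> j) *\<^sub>R L y j)) (at y)"
    by (intro has_derivative_sum has_derivative_scaleR
        bounded_linear.has_derivative[OF bounded_linear_inner_left] w L)
  moreover have "(\<Sum>j\<in>Basis. (w y \<bullet> j) *\<^sub>R L' j h + (w' h \<bullet> j) *\<^sub>R L y j) = L' (w y) h + L y (w' h)" for h
    by (simp add: sum.distrib flip: linear_basis_expand[OF lin'] linear_basis_expand[OF lin[OF assms(2)]])
  ultimately show "((\<lambda>z. \<Sum>j\<in>Basis. (w z \<bullet> j) *\<^sub>R L z j) has_derivative
      (\<lambda>h. L' (w y) h + L y (w' h))) (at y)" by simp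
qed (rule linear_basis_expand[OF lin, symmetric])

locale local_isometry = metric_field S b
  for S :: "'e::euclidean_space set" and b :: "'e \<Rightarrow> 'e \<Rightarrow> 'e \<Rightarrow> real" +
  fixes P :: "'e set" and \<Phi> :: "'e \<Rightarrow> 'e" and c :: "'e \<Rightarrow> 'e \<Rightarrow> 'e \<Rightarrow> real"
  assumes open_P: "open P"
    and smooth_map: "smooth_on P \<Phi>"
    and maps_to: "\<Phi> ` P \<subseteq> S"
    and inj_deriv: "y \<in> P \<Longrightarrow> inj (fderiv \<Phi> y)"
    and pullback: "y \<in> P \<Longrightarrow> c y u v = b (\<Phi> y) (fderiv \<Phi> y u) (fderiv \<Phi> y v)"
begin

abbreviation D1 :: "'e \<Rightarrow> 'e \<Rightarrow> 'e" where "D1 y a \<equiv> fderiv \<Phi> y a"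
abbreviation D2 :: "'e \<Rightarrow> 'e \<Rightarrow> 'e \<Rightarrow> 'e" where "D2 y a e \<equiv> fderiv (\<lambda>z. fderiv \<Phi> z e) y a"

lemma in_S: "y \<in> P \<Longrightarrow> \<Phi> y \<in> S"
  using maps_to by auto

lemma linear_D1: "y \<in> P \<Longrightarrow> linear (D1 y)"
  using smooth_on_has_derivative[OF smooth_map] has_derivative_linear by blast

lemma smooth_D1: "smooth_on P (\<lambda>y. D1 y a)"
  by (rule smooth_on_fderiv[OF smooth_map])

lemma D2_commute: "y \<in> P \<Longrightarrow> D2 y a e = D2 y e a"
  by (rule second_derivative_symmetric[OF open_P _ smooth_map])

lemma surj_D1: "y \<in> P \<Longrightarrow> surj (D1 y)"
  using linear_injective_imp_surjective[OF linear_D1 inj_deriv] by blast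

lemma has_derivative_D1: "y \<in> P \<Longrightarrow> ((\<lambda>z. D1 z a) has_derivative (\<lambda>h. D2 y h a)) (at y)"
  by (rule smooth_on_has_derivative[OF smooth_D1])

sublocale c: metric_field P c
proof
  show bl: "bilinear (c y)" if "y \<in> P" for y
    using bil[OF in_S[OF that]] linear_D1[OF that]
    by (auto simp: bilinear_def pullback[OF that] intro!: linearI
        simp: linear_add linear_scale bilinear_expand[OF bil[OF in_S[OF that]]])
  show "smooth_on P (\<lambda>y. c y u v)" for u v
    by (rule smooth_on_cong[OF smooth_args[OF open_P smooth_map maps_to smooth_D1 smooth_D1] open_P])
      (simp add: pullback)
  show "Defs.scalar_product (c y)" if "y \<in> P" for y
  proof -
    have "u = 0" if "\<forall>v. c y u v = 0" for u
    proof -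
      have "b (\<Phi> y) (D1 y u) w = 0" for w
        using surjD[OF surj_D1[OF \<open>y \<in> P\<close>], of w] that pullback[OF \<open>y \<in> P\<close>] by metis
      then have "D1 y u = 0"
        by (rule scalar_product_nondegenerate[OF scalar_product[OF in_S[OF \<open>y \<in> P\<close>]]])
      then show "u = 0"
        using inj_deriv[OF \<open>y \<in> P\<close>] linear_injective_0[OF linear_D1[OF \<open>y \<in> P\<close>]] by blast
    qed
    then show ?thesis
      using bl[OF that] field_commute[OF in_S[OF that]]
      by (auto simp: scalar_product_def pullback[OF that])
  qed
qed (rule open_P)

lemma bderiv_pullback:
  assumes y: "y \<in> P"
  shows "bderiv c y h u v = b (\<Phi> y) (D2 y h u + koszul b (\<Phi> y) (D1 y h) (D1 y u)) (D1 y v)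
    + b (\<Phi> y) (D1 y u) (D2 y h v + koszul b (\<Phi> y) (D1 y h) (D1 y v))"
proof -
  have "((\<lambda>z. c z u v) has_derivative (\<lambda>h. bderiv b (\<Phi> y) (D1 y h) (D1 y u) (D1 y v)
     + b (\<Phi> y) (D2 y h u) (D1 y v) + b (\<Phi> y) (D1 y u) (D2 y h v))) (at y)"
    by (rule has_derivative_transform_within_open[OF has_derivative_args[OF open_P y maps_to
        smooth_on_has_derivative[OF smooth_map y] has_derivative_D1[OF y] has_derivative_D1[OF y]]
          open_P y])
      (simp add: pullback)
  then have "bderiv c y h u v = bderiv b (\<Phi> y) (D1 y h) (D1 y u) (D1 y v)
     + b (\<Phi> y) (D2 y h u) (D1 y v) + b (\<Phi> y) (D1 y u) (D2 y h v)"
    unfolding bderiv_def[of c] by (simp add: fderiv_eqI)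
  then show ?thesis
    by (simp add: metric_compatible[OF in_S[OF y]] bilinear_expand[OF bil[OF in_S[OF y]]])
qed

text \<open>The right-hand side is the covariant derivative along \<open>\<Phi>\<close> of the field \<open>D\<Phi>(v)\<close>. Pulled
  back by \<open>D\<Phi>\<close> it is symmetric and compatible with \<open>c\<close>, hence equal to the Christoffel form
  of \<open>c\<close> by uniqueness.\<close>

lemma push_koszul:
  assumes y: "y \<in> P"
  shows "D1 y (koszul c y u v) = D2 y u v + koszul b (\<Phi> y) (D1 y u) (D1 y v)"
proof -
  let ?Q = "\<lambda>u v. D2 y u v + koszul b (\<Phi> y) (D1 y u) (D1 y v)"
  define C where "C u v = inv (D1 y) (?Q u v)" for u v
  have DC: "D1 y (C u v) = ?Q u v" for u v
    unfolding C_def by (rule surj_f_inv_f[OF surj_D1[OF y]])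
  have "koszul c y u v = C u v"
  proof (rule c.koszul_eq_of_metric_compatible[OF y])
    show "C u v = C v u" for u v
      unfolding C_def using D2_commute[OF y] koszul_commute[OF in_S[OF y]] by metis
    show "bderiv c y h u v = c y (C h u) v + c y u (C h v)" for h u v
      by (simp add: bderiv_pullback[OF y] pullback[OF y] DC)
  qed
  then show ?thesis by (simp add: DC)
qed

text \<open>The derivative of the identity \<open>push_koszul\<close> in the direction \<open>h\<close>.\<close>

lemma push_koszul_deriv:
  assumes y: "y \<in> P"
  shows "D2 y h (koszul c y a e) + D1 y (bderiv (koszul c) y h a e)
    = fderiv (\<lambda>z. D2 z a e) y h + (bderiv (koszul b) (\<Phi> y) (D1 y h) (D1 y a) (D1 y e)
      + koszul b (\<Phi> y) (D2 y h a) (D1 y e) + koszul b (\<Phi> y) (D1 y a) (D2 y h e))"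
proof -
  have 1: "((\<lambda>z. D1 z (koszul c z a e)) has_derivative
      (\<lambda>h. D2 y h (koszul c y a e) + D1 y (bderiv (koszul c) y h a e))) (at y)"
    by (rule has_derivative_linear_field[OF open_P y linear_D1 has_derivative_D1[OF y]
          c.Chr.has_derivative_const_args[OF y]])
  have 2: "((\<lambda>z. D2 z a e + koszul b (\<Phi> z) (D1 z a) (D1 z e)) has_derivative
      (\<lambda>h. fderiv (\<lambda>z. D2 z a e) y h + (bderiv (koszul b) (\<Phi> y) (D1 y h) (D1 y a) (D1 y e)
      + koszul b (\<Phi> y) (D2 y h a) (D1 y e) + koszul b (\<Phi> y) (D1 y a) (D2 y h e)))) (at y)"
    by (intro has_derivative_add smooth_on_has_derivative[OF smooth_on_fderiv[OF smooth_D1] y]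
        Chr.has_derivative_args[OF open_P y maps_to
          smooth_on_has_derivative[OF smooth_map y] has_derivative_D1[OF y] has_derivative_D1[OF y]])
  have 3: "D1 z (koszul c z a e) = D2 z a e + koszul b (\<Phi> z) (D1 z a) (D1 z e)" if "z \<in> P" for z
    by (rule push_koszul[OF that])
  have "((\<lambda>z. D1 z (koszul c z a e)) has_derivative
      (\<lambda>h. fderiv (\<lambda>z. D2 z a e) y h + (bderiv (koszul b) (\<Phi> y) (D1 y h) (D1 y a) (D1 y e)
      + koszul b (\<Phi> y) (D2 y h a) (D1 y e) + koszul b (\<Phi> y) (D1 y a) (D2 y h e)))) (at y)"
    by (rule has_derivative_transform_within_open[OF 2 open_P y 3[symmetric]])
  from has_derivative_unique[OF 1 this, THEN fun_cong] show ?thesis .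
qed

text \<open>Apart from the terms that make up the curvature of \<open>b\<close>, everything that \<open>push_koszul\<close>
  and \<open>push_koszul_deriv\<close> produce is symmetric in \<open>u\<close> and \<open>v\<close>, in particular the third
  derivative of \<open>\<Phi>\<close>, and cancels in the antisymmetrisation.\<close>

lemma push_riem:
  assumes y: "y \<in> P"
  shows "D1 y (riem c y u v w) = riem b (\<Phi> y) (D1 y u) (D1 y v) (D1 y w)"
proof -
  note K = Chr.bil[OF in_S[OF y]]
  have half: "D1 y (bderiv (koszul c) y v u w + koszul c y v (koszul c y u w))
     = fderiv (\<lambda>z. D2 z u w) y v
       + koszul b (\<Phi> y) (D2 y v u) (D1 y w) + koszul b (\<Phi> y) (D1 y u) (D2 y v w)
         + koszul b (\<Phi> y) (D1 y v) (D2 y u w)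
       + (bderiv (koszul b) (\<Phi> y) (D1 y v) (D1 y u) (D1 y w)
          + koszul b (\<Phi> y) (D1 y v) (koszul b (\<Phi> y) (D1 y u) (D1 y w)))" for u v
    using push_koszul_deriv[OF y, where h = v and a = u and e = w]
      push_koszul[OF y, of v "koszul c y u w"] push_koszul[OF y, of u w]
    by (simp add: linear_add[OF linear_D1[OF y]] bilinear_radd[OF K] algebra_simps)
  have sym3: "fderiv (\<lambda>z. D2 z u w) y v = fderiv (\<lambda>z. D2 z v w) y u"
    by (rule second_derivative_symmetric[OF open_P y smooth_D1])
  show ?thesis
    unfolding riem_def linear_diff[OF linear_D1[OF y]] half
    by (simp add: sym3 D2_commute[OF y, of v u])
qed

text \<open>The second derivative of \<open>\<Phi>\<close> that the chain rule brings in is the one by which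
  \<open>push_koszul\<close> differs from the Christoffel form of \<open>b\<close>.\<close>

lemma hess_pullback:
  assumes y: "y \<in> P" and T: "open T" "\<Phi> ` P \<subseteq> T" "smooth_on T f"
  shows "hess c (\<lambda>z. f (\<Phi> z)) y u v = hess b f (\<Phi> y) (D1 y u) (D1 y v)"
proof -
  have df: "(f has_derivative fderiv f (\<Phi> z)) (at (\<Phi> z))" if "z \<in> P" for z
    using T that by (intro smooth_on_has_derivative[OF T(3)]) auto
  have d1: "fderiv (\<lambda>z. f (\<Phi> z)) z v = fderiv f (\<Phi> z) (D1 z v)" if "z \<in> P" for z v
    using diff_chain_at[OF smooth_on_has_derivative[OF smooth_map that] df[OF that]]
    by (auto dest: fderiv_eqI simp: o_def)
  have "((\<lambda>x. fderiv f x a) has_derivative fderiv (\<lambda>x. fderiv f x a) (\<Phi> y)) (at (\<Phi> y))" for a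
    using T y by (intro smooth_on_has_derivative[OF smooth_on_fderiv[OF T(3)]]) auto
  from diff_chain_at[OF smooth_on_has_derivative[OF smooth_map y] this]
  have d2: "((\<lambda>z. fderiv f (\<Phi> z) a) has_derivative (\<lambda>h. fderiv (\<lambda>x. fderiv f x a) (\<Phi> y) (D1 y h))) (at
    y)" for a
    by (simp add: o_def)
  have "((\<lambda>z. fderiv f (\<Phi> z) (D1 z v)) has_derivative
     (\<lambda>h. fderiv (\<lambda>x. fderiv f x (D1 y v)) (\<Phi> y) (D1 y h) + fderiv f (\<Phi> y) (D2 y h v))) (at y)"
    by (rule has_derivative_linear_field[OF open_P y has_derivative_linear[OF df] d2 has_derivative_D1[OF y]])
  then have "fderiv (\<lambda>z. fderiv (\<lambda>z. f (\<Phi> z)) z v) y u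
     = fderiv (\<lambda>x. fderiv f x (D1 y v)) (\<Phi> y) (D1 y u) + fderiv f (\<Phi> y) (D2 y u v)"
    by (subst fderiv_cong_open[OF open_P y d1]) (simp_all add: fderiv_eqI)
  then show ?thesis
    unfolding hess_def
    by (simp add: d1[OF y] push_koszul[OF y] linear_add[OF has_derivative_linear[OF df[OF y]]])
qed

end

section \<open>The energy series\<close>

definition power_series :: "(nat \<Rightarrow> real) \<Rightarrow> real \<Rightarrow> real" where
  "power_series c x = (\<Sum>n. c n * x ^ n)"

definition entire_coeffs :: "(nat \<Rightarrow> real) \<Rightarrow> bool" where
  "entire_coeffs c \<longleftrightarrow> (\<forall>x. summable (\<lambda>n. c n * x ^ n))"

lemma entire_diffs: "entire_coeffs c \<Longrightarrow> entire_coeffs (diffs c)"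
  unfolding entire_coeffs_def using termdiff_converges_all[of c] by blast

lemma DERIV_power_series: "entire_coeffs c \<Longrightarrow> DERIV (power_series c) x :> power_series (diffs c) x"
  using termdiffs_strong_converges_everywhere[of c x]
  by (simp add: entire_coeffs_def power_series_def[abs_def])

lemma sums_power_series: "entire_coeffs c \<Longrightarrow> (\<lambda>n. c n * x ^ n) sums power_series c x"
  unfolding entire_coeffs_def power_series_def by (intro summable_sums) blast

lemma smooth_on_power_series:
  assumes "entire_coeffs c"
  shows "smooth_on UNIV (power_series c)"
proof -
  have "Ck_on n (power_series c) UNIV" if "entire_coeffs c" for n c
    using that
  proof (induction n arbitrary: c)
    case 0
    then show ?case by (auto intro: DERIV_continuous_on DERIV_power_series)
  next
    case (Suc n)
    have d: "(power_series c has_derivative (\<lambda>h. h * power_series (diffs c) x)) (at x)" for x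
      using DERIV_power_series[OF Suc.prems] by (simp add: has_field_derivative_def mult_commute_abs)
    have "Ck_on n (\<lambda>x. v * power_series (diffs c) x) UNIV" for v
      by (rule Ck_on_linear_compose[OF bounded_linear_mult_right open_UNIV Suc.IH[OF entire_diffs[OF Suc.prems]]])
    then show ?case using d by (auto simp: fderiv_eqI[OF d] differentiable_def)
  qed
  then show ?thesis using assms by (simp add: smooth_on_def)
qed

definition energy_coeffs :: "real \<Rightarrow> nat \<Rightarrow> real" where
  "energy_coeffs K n = (if n = 0 then 0 else (- K) ^ (n - 1) / fact (2 * n))"

lemma entire_energy_coeffs: "entire_coeffs (energy_coeffs K)"
  unfolding entire_coeffs_def
proof
  fix x :: real
  show "summable (\<lambda>n. energy_coeffs K n * x ^ n)"
  proof (rule summable_comparison_test[OF _ summable_exp[of "(1 + \<bar>K\<bar>) * \<bar>x\<bar>"]], intro exI allI impI)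
    fix n :: nat
    have "\<bar>K\<bar> ^ (n - 1) \<le> (1 + \<bar>K\<bar>) ^ (n - 1)" by (rule power_mono) auto
    also have "\<dots> \<le> (1 + \<bar>K\<bar>) ^ n" by (rule power_increasing) auto
    finally have "\<bar>energy_coeffs K n\<bar> \<le> (1 + \<bar>K\<bar>) ^ n / fact n"
      by (auto simp: energy_coeffs_def power_abs simp del: fact_Suc intro!: frac_le fact_mono)
    then have "\<bar>energy_coeffs K n\<bar> * \<bar>x\<bar> ^ n \<le> (1 + \<bar>K\<bar>) ^ n / fact n * \<bar>x\<bar> ^ n"
      by (rule mult_right_mono) simp
    then show "norm (energy_coeffs K n * x ^ n) \<le> inverse (fact n) * ((1 + \<bar>K\<bar>) * \<bar>x\<bar>) ^ n"
      by (simp add: abs_mult power_abs power_mult_distrib divide_inverse ac_simps)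
  qed
qed

lemma energy_series_eq: "energy_series K = power_series (energy_coeffs K)"
proof
  fix e
  have "(\<lambda>n. energy_coeffs K (Suc n) * e ^ Suc n) sums (power_series (energy_coeffs K) e -
    energy_coeffs K 0 * e ^ 0)"
    using sums_power_series[OF entire_energy_coeffs, of K e] by (subst sums_Suc_iff) simp
  then show "energy_series K e = power_series (energy_coeffs K) e"
    unfolding energy_series_def by (simp add: sums_iff energy_coeffs_def del: fact_Suc power_Suc
      mult_Suc_right)
qed

definition energy_series' :: "real \<Rightarrow> real \<Rightarrow> real" where
  "energy_series' K = power_series (diffs (energy_coeffs K))"

definition energy_series'' :: "real \<Rightarrow> real \<Rightarrow> real" where
  "energy_series'' K = power_series (diffs (diffs (energy_coeffs K)))"

definition energy_series''' :: "real \<Rightarrow> real \<Rightarrow> real" where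
  "energy_series''' K = power_series (diffs (diffs (diffs (energy_coeffs K))))"

lemma DERIV_energy_series:
  "DERIV (energy_series K) e :> energy_series' K e"
  "DERIV (energy_series' K) e :> energy_series'' K e"
  "DERIV (energy_series'' K) e :> energy_series''' K e"
  unfolding energy_series_eq energy_series'_def energy_series''_def energy_series'''_def
  by (intro DERIV_power_series entire_diffs entire_energy_coeffs)+

lemma smooth_on_energy_series: "smooth_on UNIV (energy_series K)"
  unfolding energy_series_eq by (rule smooth_on_power_series[OF entire_energy_coeffs])

text \<open>For \<open>\<psi>(r) = \<phi>(r\<^sup>2)\<close> with the energy series \<open>\<phi>\<close> this is the equation \<open>\<psi>'' = 1 - K \<psi>\<close> of
  constant curvature. On coefficients it is \<open>(2n + 1)(2n + 2) / (2n + 2)! = 1 / (2n)!\<close>.\<close>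

lemma energy_series_ode: "2 * energy_series' K e + 4 * e * energy_series'' K e = 1 - K * energy_series K e"
proof -
  let ?c = "energy_coeffs K"
  have 1: "(\<lambda>n. 2 * (diffs ?c n * e ^ n)) sums (2 * energy_series' K e)"
    unfolding energy_series'_def by (intro sums_mult sums_power_series entire_diffs entire_energy_coeffs)
  have "(\<lambda>n. e * (diffs (diffs ?c) n * e ^ n)) sums (e * energy_series'' K e)"
    unfolding energy_series''_def by (intro sums_mult sums_power_series entire_diffs entire_energy_coeffs)
  then have "(\<lambda>n. (\<lambda>n. of_nat n * diffs ?c n * e ^ n) (Suc n)) sums (e * energy_series'' K e)"
    by (simp add: diffs_def ac_simps)
  from sums_Suc[OF this] have "(\<lambda>n. of_nat n * diffs ?c n * e ^ n) sums (e * energy_series'' K e)" by simp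
  from sums_add[OF 1 sums_mult[OF this, of 4]]
  have lhs: "(\<lambda>n. (2 + 4 * of_nat n) * diffs ?c n * e ^ n) sums (2 * energy_series' K e
    + 4 * e * energy_series'' K e)"
    by (simp add: algebra_simps)
  have "(\<lambda>n. (if n = 0 then 1 else 0) - K * (?c n * e ^ n)) sums (1 - K * energy_series K e)"
    unfolding energy_series_eq
    by (intro sums_diff sums_mult sums_power_series entire_energy_coeffs) (use
      sums_If_finite_set[of "{0::nat}" "\<lambda>_. 1::real"] in simp)
  moreover have "(2 + 4 * of_nat n) * diffs ?c n * e ^ n = (if n
    = 0 then 1 else 0) - K * (?c n * e ^ n)" for n
  proof -
    have f: "fact (2 * Suc n) = (2 + 4 * real n) * (1 + real n) * fact (2 * n)"
      by (simp add: algebra_simps)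
    have pos: "(2 + 4 * real n) * (1 + real n) \<noteq> 0"
      by (simp add: add_nonneg_pos pos_add_strict less_imp_neq[symmetric])
    have "(2 + 4 * real n) * diffs ?c n = ((2 + 4 * real n) * (1
      + real n)) * ((- K) ^ n / fact (2 * Suc n))"
      by (simp add: diffs_def energy_coeffs_def del: fact_Suc mult_Suc_right)
    also have "\<dots> = (- K) ^ n / fact (2 * n)"
      unfolding f using pos by (simp del: fact_Suc)
    finally have "(2 + 4 * real n) * diffs ?c n = (- K) ^ n / fact (2 * n)" .
    moreover have "(- K) ^ n / fact (2 * n) = (if n = 0 then 1 else 0) - K * ?c n"
      by (cases n) (simp_all add: energy_coeffs_def del: fact_Suc mult_Suc_right)
    ultimately show ?thesis by (cases n) (simp_all add: algebra_simps)
  qed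
  ultimately show ?thesis using lhs sums_unique2 by (metis (no_types, lifting) sums_cong)
qed

lemma energy_series_ode': "6 * energy_series'' K e + 4 * e * energy_series''' K e
  = - K * energy_series' K e"
proof -
  have "DERIV (\<lambda>e. 2 * energy_series' K e + 4 * e * energy_series'' K e) e :>
      2 * energy_series'' K e + (4 * energy_series'' K e + 4 * e * energy_series''' K e)"
    by (auto intro!: derivative_eq_intros DERIV_energy_series)
  moreover have "DERIV (\<lambda>e. 1 - K * energy_series K e) e :> - K * energy_series' K e"
    by (auto intro!: derivative_eq_intros DERIV_energy_series)
  ultimately show ?thesis unfolding energy_series_ode using DERIV_unique by fastforce
qed

text \<open>By \<open>energy_series_ode\<close> the function \<open>t \<mapsto> 2 t \<phi>'(t\<^sup>2 e)\<close> has the derivative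
  \<open>1 - K \<phi>(t\<^sup>2 e)\<close>, and it vanishes at \<open>0\<close>.\<close>

lemma energy_series_deriv_nonneg:
  assumes pos: "\<And>t. t \<in> {0..1} \<Longrightarrow> 1 - K * energy_series K (t\<^sup>2 * e) \<ge> 0"
  shows "energy_series' K e \<ge> 0"
proof -
  have "\<exists>y. DERIV (\<lambda>t. t * (2 * energy_series' K (t\<^sup>2 * e))) t :> y \<and> y \<ge> 0" if "0 \<le> t" "t \<le> 1" for t
  proof (intro exI conjI)
    have "DERIV (\<lambda>t. energy_series' K (t\<^sup>2 * e)) t :> energy_series'' K (t\<^sup>2 * e) * (2 * t * e)"
      by (rule DERIV_chain2[OF DERIV_energy_series(2)]) (auto intro!: derivative_eq_intros)
    then show "DERIV (\<lambda>t. t * (2 * energy_series' K (t\<^sup>2 * e))) t :> 1 - K * energy_series K (t\<^sup>2 * e)"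
      by (auto intro!: derivative_eq_intros simp: energy_series_ode[symmetric] power2_eq_square)
    show "1 - K * energy_series K (t\<^sup>2 * e) \<ge> 0" using pos that by simp
  qed
  from DERIV_nonneg_imp_nondecreasing[OF _ this, of 0 1] show ?thesis by simp
qed

text \<open>The number in question is the cosine of an angle below \<open>\<pi>/2\<close>, or a hyperbolic cosine
  when \<open>K e < 0\<close>.\<close>

lemma one_minus_energy_series_pos:
  assumes "K * e < pi\<^sup>2 / 4"
  shows "1 - K * energy_series K e > 0"
proof (cases "K = 0")
  case False
  define z where "z = csqrt (complex_of_real (K * e))"
  have "complex_of_real (1 - K * energy_series K e) = cos z"
    using False by (simp add: energy_series_closed_form z_def)
  then have eq: "1 - K * energy_series K e = Re (cos z)" by (metis Re_complex_of_real)
  show ?thesis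
  proof (cases "K * e \<ge> 0")
    case True
    have "sqrt (K * e) < pi / 2"
      using assms by (intro real_less_lsqrt) (auto simp: power_divide)
    moreover have "z = complex_of_real (sqrt (K * e))" using True by (simp add: z_def)
    then have "Re (cos z) = cos (sqrt (K * e))" by (simp add: cos_of_real)
    ultimately show ?thesis using True eq cos_gt_zero_pi[of "sqrt (K * e)"]
      by (simp add: order.strict_trans2[of "- (pi / 2)" 0] del: real_sqrt_mult)
  next
    case False
    have "z = \<i> * complex_of_real (sqrt (- (K * e)))"
      using False by (simp add: z_def csqrt_of_real_nonpos del: of_real_mult)
    then have "cos z = cosh (complex_of_real (sqrt (- (K * e))))" by (simp add: cosh_conv_cos)
    then have "Re (cos z) = cosh (sqrt (- (K * e)))" by (simp add: cosh_def exp_of_real flip: of_real_minus)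
    then show ?thesis using eq cosh_real_pos by simp
  qed
qed simp

section \<open>A linear differential inequality for quadratic forms\<close>

lemma semidefinite_null_vector:
  assumes "bilinear B" "\<And>u v. B u v = B v u" "\<And>u. B u u \<ge> (0::real)" "B w w = 0"
  shows "B w v = 0"
proof (rule ccontr)
  assume a: "B w v \<noteq> 0"
  define c where "c = B v v"
  (* The minimum of the quadratic polynomial would be at - B w v / c; the denominator c + 1
     gives a negative value as well and covers c = 0. *)
  define r where "r = - B w v / (c + 1)"
  have c: "c \<ge> 0" using assms(3) by (simp add: c_def)
  have "B (w + r *\<^sub>R v) (w + r *\<^sub>R v) = 2 * r * B w v + r\<^sup>2 * c"
    using assms(2)[of v w] by (simp add: bilinear_expand[OF assms(1)] assms(4) c_def power2_eq_square
      algebra_simps)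
  also have "\<dots> = - ((B w v)\<^sup>2 * (c + 2)) / (c + 1)\<^sup>2"
    using c unfolding r_def by (simp add: power2_eq_square divide_simps) (simp add: algebra_simps)
  also have "\<dots> < 0" using a c by (simp add: divide_neg_pos)
  finally show False using assms(3) by (simp add: not_less[symmetric])
qed

text \<open>The argument is that of the first zero. Adding \<open>\<epsilon> exp((C+1)t) |u|\<^sup>2\<close> to \<open>Y\<close> gives a
  form \<open>Z\<close> that is positive at time \<open>0\<close>. Let \<open>s\<close> be the first time at which some unit vector
  \<open>w\<close> has \<open>Z(w,w) \<le> 0\<close>. At that time \<open>Z\<close> is still semidefinite, so \<open>Z(w,\<cdot>) = 0\<close>, and
  \<open>Y(w, m w)\<close> is at least \<open>- \<epsilon> C exp((C+1)s)\<close>. The derivative of the added term exceeds this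
  loss, so \<open>Z(w,w)\<close> is increasing at \<open>s\<close>, which contradicts its being nonnegative before and
  zero at \<open>s\<close>.\<close>

lemma form_ode_nonneg:
  fixes Y :: "real \<Rightarrow> 'e::euclidean_space \<Rightarrow> 'e \<Rightarrow> real"
  assumes bil: "\<And>t. t \<in> {0..1} \<Longrightarrow> bilinear (Y t)"
    and sym: "\<And>t u v. t \<in> {0..1} \<Longrightarrow> Y t u v = Y t v u"
    and init: "\<And>u. Y 0 u u = 0"
    and der: "\<And>t u. t \<in> {0..1} \<Longrightarrow> ((\<lambda>t. Y t u u)
      has_real_derivative p t u + Y t u (m t u)) (at t within {0..1})"
    and p: "\<And>t u. t \<in> {0..1} \<Longrightarrow> p t u \<ge> 0"
    and m: "\<And>t u. t \<in> {0..1} \<Longrightarrow> norm (m t u) \<le> C * norm u"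
  shows "Y 1 u u \<ge> 0"
proof (rule ccontr)
  assume neg: "\<not> Y 1 u u \<ge> 0"
  then have u: "u \<noteq> 0" using bilinear_lzero[OF bil[of 1]] by auto
  (* With this choice Z vanishes at time 1 on u, so there is a first zero. *)
  define \<epsilon> where "\<epsilon> = - Y 1 u u / (exp (C + 1) * (u \<bullet> u))"
  have \<epsilon>: "\<epsilon> > 0" using neg u by (simp add: \<epsilon>_def divide_neg_pos)
  define Z where "Z t u v = Y t u v + \<epsilon> * exp ((C + 1) * t) * (u \<bullet> v)" for t u v
  have Zbil: "bilinear (Z t)" if "t \<in> {0..1}" for t
    unfolding Z_def bilinear_def
    by (auto intro!: linearI simp: bilinear_expand[OF bil[OF that]] algebra_simps)
  have Zsym: "Z t u v = Z t v u" if "t \<in> {0..1}" for t u v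
    unfolding Z_def using sym[OF that] by (simp add: inner_commute)
  have Zder: "((\<lambda>t. Z t u u) has_real_derivative p t u + Y t u (m t u) + \<epsilon> * ((C + 1) * exp ((C
    + 1) * t)) * (u \<bullet> u))
      (at t within {0..1})" if "t \<in> {0..1}" for t u
    unfolding Z_def by (rule derivative_eq_intros der[OF that] refl | simp)+
  have Zcont1: "continuous_on {0..1} (\<lambda>t. Z t u u)" for u
    using Zder by (rule DERIV_continuous_on)
  have pol: "Z t i j = (Z t (i + j) (i + j) - Z t i i - Z t j j) / 2" if "t \<in> {0..1}" for t i j
    using Zsym[OF that, of i j] by (simp add: bilinear_expand[OF Zbil[OF that]])
  have Zcont2: "continuous_on {0..1} (\<lambda>t. Z t i j)" for i j
    using pol by (subst continuous_on_cong[OF refl pol]) (auto intro!: continuous_intros Zcont1)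
  have Zcont: "continuous_on ({0..1} \<times> UNIV) (\<lambda>q. Z (fst q) (snd q) (snd q))"
  proof -
    have "continuous_on ({0..1} \<times> UNIV) (\<lambda>q. Z (fst q) i j)" for i j
      by (rule continuous_on_compose2[OF Zcont2 continuous_on_fst[OF continuous_on_id]]) auto
    then have "continuous_on ({0..1} \<times> UNIV)
       (\<lambda>q. \<Sum>i\<in>Basis. \<Sum>j\<in>Basis. ((snd q \<bullet> i) * (snd q \<bullet> j)) *\<^sub>R Z (fst q) i j)"
      by (intro continuous_intros)
    then show ?thesis
    proof (rule continuous_on_eq)
      fix q :: "real \<times> 'e" assume "q \<in> {0..1} \<times> UNIV"
      then have "fst q \<in> {0..1}" by auto
      from bilinear_basis_expand[OF Zbil[OF this], of "snd q" "snd q"]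
      show "(\<Sum>i\<in>Basis. \<Sum>j\<in>Basis. ((snd q \<bullet> i) * (snd q \<bullet> j)) *\<^sub>R Z (fst q) i j) = Z (fst q) (snd q) (snd q)"
        by (rule HOL.sym)
    qed
  qed
  define T where "T = ({0..1} \<times> sphere 0 1) \<inter> (\<lambda>q. Z (fst q) (snd q) (snd q)) -` {..0}"
  have "closed T"
    unfolding T_def
    by (intro continuous_closed_preimage continuous_on_subset[OF Zcont] closed_Times closed_atMost) auto
  moreover have "T \<subseteq> {0..1} \<times> sphere 0 1" by (auto simp: T_def)
  ultimately have "compact T"
    using compact_Int_closed[OF compact_Times[OF compact_Icc compact_sphere], of T "0::real" 1 "0::'e" 1]
    by (simp add: Int_absorb1)
  have scale: "Z t (c *\<^sub>R v) (c *\<^sub>R v) = c\<^sup>2 * Z t v v" if "t \<in> {0..1}" for t c v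
    by (simp add: bilinear_expand[OF Zbil[OF that]] power2_eq_square)
  have "Z 1 u u = 0" using u by (simp add: Z_def \<epsilon>_def)
  then have "Z 1 ((1 / norm u) *\<^sub>R u) ((1 / norm u) *\<^sub>R u) = 0" by (simp add: scale)
  then have "(1, (1 / norm u) *\<^sub>R u) \<in> T" using u by (simp add: T_def)
  then have "T \<noteq> {}" by blast
  obtain q where q: "q \<in> T" "\<And>q'. q' \<in> T \<Longrightarrow> fst q \<le> fst q'"
    using continuous_attains_inf[OF \<open>compact T\<close> \<open>T \<noteq> {}\<close> continuous_on_fst[OF continuous_on_id]] by blast
  define s where "s = fst q"
  define w where "w = snd q"
  have s: "s \<in> {0..1}" and w: "norm w = 1" and Zw: "Z s w w \<le> 0"
    using q(1) by (auto simp: T_def s_def w_def)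
  have "Z 0 w w > 0" using \<epsilon> w by (simp add: Z_def init dot_square_norm)
  with Zw have "s \<noteq> 0" by auto
  with s have s0: "s > 0" by auto
  have before: "Z t v v \<ge> 0" if "t \<in> {0..<s}" for t v
  proof (cases "v = 0")
    case False
    have t: "t \<in> {0..1}" using that s by auto
    have "(t, (1 / norm v) *\<^sub>R v) \<notin> T" using q(2) that by (fastforce simp: s_def)
    then have "Z t ((1 / norm v) *\<^sub>R v) ((1 / norm v) *\<^sub>R v) > 0"
      using t False by (auto simp: T_def)
    then show ?thesis by (simp add: scale[OF t] zero_less_mult_iff)
  qed (use that s bilinear_lzero[OF Zbil] in auto)
  have at_s: "Z s v v \<ge> 0" for v
  proof (rule tendsto_lowerbound)
    have "((\<lambda>t. Z t v v) \<longlongrightarrow> Z s v v) (at s within {0..1})"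
      using Zcont1 s by (simp add: continuous_on_def)
    then show "((\<lambda>t. Z t v v) \<longlongrightarrow> Z s v v) (at s within {0..<s})"
      by (rule tendsto_within_subset) (use s in auto)
    show "\<forall>\<^sub>F t in at s within {0..<s}. 0 \<le> Z t v v"
      using before by (simp add: eventually_at_filter)
    have "at s within {0..<s} = at_left s"
      by (rule at_within_nhd[of _ "{0<..}"]) (use s0 in auto)
    then show "at s within {0..<s} \<noteq> bot" by simp
  qed
  have null: "Z s w (m s w) = 0"
    by (rule semidefinite_null_vector[OF Zbil[OF s] Zsym[OF s] at_s]) (use at_s[of w] Zw in auto)
  have "w \<bullet> m s w \<le> norm w * norm (m s w)" by (rule norm_cauchy_schwarz)
  also have "\<dots> \<le> C" using m[OF s, of w] w by simp
  finally have C: "w \<bullet> m s w \<le> C" .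
  have "Y s w (m s w) = - \<epsilon> * exp ((C + 1) * s) * (w \<bullet> m s w)" using null by (simp add: Z_def)
  also have "\<dots> \<ge> - \<epsilon> * exp ((C + 1) * s) * C"
    using C \<epsilon> by (intro mult_left_mono_neg) auto
  finally have "p s w + Y s w (m s w) + \<epsilon> * ((C + 1) * exp ((C + 1) * s)) * (w \<bullet> w) \<ge> \<epsilon> * exp ((C + 1) * s)"
    using p[OF s, of w] w by (simp add: dot_square_norm algebra_simps)
  then have d: "p s w + Y s w (m s w) + \<epsilon> * ((C + 1) * exp ((C + 1) * s)) * (w \<bullet> w) > 0"
    using \<epsilon> by (smt (verit) exp_gt_zero mult_pos_pos)
  obtain \<delta> where \<delta>: "\<delta> > 0" "\<And>h. \<lbrakk>h > 0; s - h \<in> {0..1}; h < \<delta>\<rbrakk> \<Longrightarrow> Z (s - h) w w < Z s w w"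
    using has_real_derivative_pos_inc_left[OF Zder[OF s, of w] d] by blast
  define h where "h = min s (\<delta> / 2)"
  have h: "h > 0" "h \<le> s" "h < \<delta>" using s0 \<delta>(1) by (auto simp: h_def)
  then have "Z (s - h) w w < Z s w w" using s by (intro \<delta>(2)) auto
  moreover have "Z (s - h) w w \<ge> 0" using h by (intro before) auto
  ultimately show False using Zw by simp
qed

section \<open>Normal coordinates\<close>

lemma has_vector_derivative_along_ray:
  assumes "(f has_derivative f') (at (t *\<^sub>R x))"
  shows "((\<lambda>s. f (s *\<^sub>R x)) has_vector_derivative f' x) (at t)"
proof -
  have "((\<lambda>s. s *\<^sub>R x) has_derivative (\<lambda>h. h *\<^sub>R x)) (at t)" by (auto intro!: derivative_eq_intros)
  from diff_chain_at[OF this assms] show ?thesis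
    by (simp add: o_def has_vector_derivative_def linear_scale[OF has_derivative_linear[OF assms]])
qed

text \<open>The condition \<open>radial\<close> says that \<open>t \<mapsto> t x\<close> is a geodesic: its acceleration is \<open>0\<close> in
  the coordinates, so the Christoffel term has to vanish.\<close>

locale normal_coordinates = metric_field S b
  for S :: "'e::euclidean_space set" and b :: "'e \<Rightarrow> 'e \<Rightarrow> 'e \<Rightarrow> real" +
  assumes zero_in: "0 \<in> S"
    and star: "x \<in> S \<Longrightarrow> t \<in> {0..1} \<Longrightarrow> t *\<^sub>R x \<in> S"
    and radial: "x \<in> S \<Longrightarrow> koszul b x x x = 0"
begin

abbreviation \<Gamma> :: "'e \<Rightarrow> 'e \<Rightarrow> 'e \<Rightarrow> 'e" where "\<Gamma> \<equiv> koszul b"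

lemmas form_simps = bilinear_expand[OF bil]

lemma has_derivative_field:
  assumes "x \<in> S" "(X has_derivative X') (at x)" "(Y has_derivative Y') (at x)"
  shows "((\<lambda>y. b y (X y) (Y y)) has_derivative
     (\<lambda>h. bderiv b x h (X x) (Y x) + b x (X' h) (Y x) + b x (X x) (Y' h))) (at x)"
  by (rule has_derivative_args[OF open_S assms(1) _ has_derivative_ident assms(2,3)]) auto

lemma has_derivative_christoffel:
  assumes "x \<in> S" "(X has_derivative X') (at x)" "(Y has_derivative Y') (at x)"
  shows "((\<lambda>y. \<Gamma> y (X y) (Y y)) has_derivative
     (\<lambda>h. bderiv \<Gamma> x h (X x) (Y x) + \<Gamma> x (X' h) (Y x) + \<Gamma> x (X x) (Y' h))) (at x)"
  by (rule Chr.has_derivative_args[OF open_S assms(1) _ has_derivative_ident assms(2,3)]) auto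

lemma has_derivative_center: "((\<lambda>y. b 0 (X y) (Y y)) has_derivative
     (\<lambda>h. b 0 (X' h) (Y x) + b 0 (X x) (Y' h))) (at x)"
  if "(X has_derivative X') (at x)" "(Y has_derivative Y') (at x)"
proof -
  have "bounded_bilinear (b 0)" using bil[OF zero_in] by (simp add: bilinear_conv_bounded_bilinear)
  from bounded_bilinear.FDERIV[OF this that] show ?thesis by (simp add: add.commute)
qed

lemma ray_has_derivative:
  "(f has_derivative f') (at (t *\<^sub>R x)) \<Longrightarrow> ((\<lambda>t. f (t *\<^sub>R x)) has_real_derivative f' x) (at t)"
  unfolding has_real_derivative_iff_has_vector_derivative by (rule has_vector_derivative_along_ray)

lemma radial_scaled:
  assumes "x \<in> S" "0 < t" "t \<le> 1"
  shows "\<Gamma> (t *\<^sub>R x) x x = 0"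
proof -
  have z: "t *\<^sub>R x \<in> S" using star[OF assms(1)] assms by auto
  show ?thesis
    using radial[OF z] assms by (simp add: bilinear_expand[OF Chr.bil[OF z]])
qed

text \<open>A geodesic has constant speed; the speed of \<open>t \<mapsto> t x\<close> is compared at \<open>t = 1\<close> and
  \<open>t = 0\<close>.\<close>

lemma radial_norm:
  assumes x: "x \<in> S" shows "b x x x = b 0 x x"
proof -
  have d: "((\<lambda>t. b (t *\<^sub>R x) x x) has_real_derivative bderiv b (t *\<^sub>R x) x x x) (at t)"
    if "0 \<le> t" "t \<le> 1" for t
    using star[OF x, of t] that by (intro ray_has_derivative has_derivative_const_args) auto
  have "b (1 *\<^sub>R x) x x = b (0 *\<^sub>R x) x x"
  proof (rule DERIV_isconst_end[of 0 1 "\<lambda>t. b (t *\<^sub>R x) x x"])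
    show "continuous_on {0..1} (\<lambda>t. b (t *\<^sub>R x) x x)"
      by (rule DERIV_continuous_on[OF has_field_derivative_at_within[OF d]]) auto
    show "DERIV (\<lambda>t. b (t *\<^sub>R x) x x) t :> 0" if "0 < t" "t < 1" for t
    proof -
      have z: "t *\<^sub>R x \<in> S" using star[OF x] that by auto
      show ?thesis
        using d[of t] that radial_scaled[OF x, of t] by (simp add: metric_compatible[OF z] form_simps[OF z])
    qed
  qed simp
  then show ?thesis by simp
qed

lemma bderiv_radial_norm:
  assumes x: "x \<in> S" shows "bderiv b x a x x + 2 * b x a x = 2 * b 0 a x"
proof -
  have "((\<lambda>y. b y y y) has_derivative (\<lambda>h. bderiv b x h x x + b x h x + b x x h)) (at x)"
    by (rule has_derivative_field[OF x has_derivative_ident has_derivative_ident])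
  moreover have "((\<lambda>y. b y y y) has_derivative (\<lambda>h. b 0 h x + b 0 x h)) (at x)"
    by (rule has_derivative_transform_within_open[OF has_derivative_center[OF has_derivative_ident has_derivative_ident]
         open_S x]) (simp add: radial_norm)
  ultimately have "bderiv b x a x x + b x a x + b x x a = b 0 a x + b 0 x a"
    using has_derivative_unique by (blast dest: fun_cong)
  then show ?thesis using field_commute[OF x, of x a] field_commute[OF zero_in, of x a] by simp
qed

text \<open>The Gauss lemma. Compatibility and the geodesic equation equate the derivative of
  \<open>b(x,w)\<close> along the ray with half the derivative of \<open>b(x,x)\<close> in the direction \<open>w\<close>, which is
  known from \<open>radial_norm\<close>. As a result \<open>t (b\<^bsub>tx\<^esub>(x,w) - b\<^sub>0(x,w))\<close> is constant in \<open>t\<close>.\<close>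

lemma gauss:
  assumes x: "x \<in> S" shows "b x x w = b 0 x w"
proof -
  have d: "((\<lambda>t. b (t *\<^sub>R x) x w) has_real_derivative bderiv b (t *\<^sub>R x) x x w) (at t)"
    if "0 \<le> t" "t \<le> 1" for t
    using star[OF x, of t] that by (intro ray_has_derivative has_derivative_const_args) auto
  let ?\<psi> = "\<lambda>t. t * (b (t *\<^sub>R x) x w - b 0 x w)"
  have d\<psi>: "(?\<psi> has_real_derivative b (t *\<^sub>R x) x w - b 0 x w + t * bderiv b (t *\<^sub>R x) x x w) (at t)"
    if "0 \<le> t" "t \<le> 1" for t
    by (rule DERIV_cong[OF DERIV_mult[OF DERIV_ident DERIV_diff[OF d[OF that] DERIV_const]]]) simp
  have "?\<psi> 1 = ?\<psi> 0"
  proof (rule DERIV_isconst_end[of 0 1 ?\<psi>])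
    show "continuous_on {0..1} ?\<psi>"
      by (rule DERIV_continuous_on[OF has_field_derivative_at_within[OF d\<psi>]]) auto
    show "DERIV ?\<psi> t :> 0" if t: "0 < t" "t < 1" for t
    proof -
      have z: "t *\<^sub>R x \<in> S" using star[OF x] t by auto
      have "bderiv b (t *\<^sub>R x) x x w = b (t *\<^sub>R x) (\<Gamma> (t *\<^sub>R x) w x) x"
        using radial_scaled[OF x, of t] t
        by (simp add: metric_compatible[OF z] form_simps[OF z] koszul_commute[OF z, of x w]
          field_commute[OF z, of x])
      also have "\<dots> = bderiv b (t *\<^sub>R x) w x x / 2"
        by (simp add: metric_compatible[OF z] field_commute[OF z, of x])
      finally have "t * (t * bderiv b (t *\<^sub>R x) x x w) = t * (t * bderiv b (t *\<^sub>R x) w x x) / 2" by simp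
      also have "\<dots> = t * (b 0 x w - b (t *\<^sub>R x) x w)"
        using bderiv_radial_norm[OF z, of w] field_commute[OF z, of w x] field_commute[OF zero_in, of w x]
        by (simp add: bilinear_expand[OF bilinear_bderiv[OF z]] form_simps[OF z]
          form_simps[OF zero_in] algebra_simps)
      finally have "t * bderiv b (t *\<^sub>R x) x x w = b 0 x w - b (t *\<^sub>R x) x w" using t by simp
      then show ?thesis using d\<psi>[of t] t by simp
    qed
  qed simp
  then show ?thesis by simp
qed

lemma bderiv_gauss:
  assumes x: "x \<in> S" shows "bderiv b x a x w = b 0 a w - b x a w"
proof -
  have "((\<lambda>y. b y y w) has_derivative (\<lambda>h. bderiv b x h x w + b x h w + b x x 0)) (at x)"
    by (rule has_derivative_field[OF x has_derivative_ident has_derivative_const])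
  moreover have "((\<lambda>y. b y y w) has_derivative (\<lambda>h. b 0 h w + b 0 x 0)) (at x)"
    by (rule has_derivative_transform_within_open[OF has_derivative_center[OF has_derivative_ident has_derivative_const]
         open_S x]) (simp add: gauss)
  ultimately have "bderiv b x a x w + b x a w + b x x 0 = b 0 a w + b 0 x 0"
    using has_derivative_unique by (blast dest: fun_cong)
  then show ?thesis by (simp add: form_simps[OF x] form_simps[OF zero_in])
qed

text \<open>For the position field \<open>Z(x) = x\<close> one has \<open>\<nabla>\<^sub>u Z = u + \<Gamma>\<^sub>x(x,u)\<close>. So this form is the
  deviation of the Hessian of half the energy from the metric.\<close>

definition radial_form :: "'e \<Rightarrow> 'e \<Rightarrow> 'e \<Rightarrow> real" where
  "radial_form x u w = b x (\<Gamma> x x u) w"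

text \<open>In the Koszul formula for \<open>\<Gamma>\<^sub>x(x,u)\<close> the two derivatives in directions other than \<open>x\<close>
  cancel by the Gauss lemma. What remains is symmetric.\<close>

lemma radial_form_eq: "x \<in> S \<Longrightarrow> radial_form x u w = bderiv b x x u w / 2"
  unfolding radial_form_def koszul_char
  using bderiv_gauss[of x u w] bderiv_gauss[of x w u] field_commute[of x u w]
    field_commute[OF zero_in, of u w]
  by simp

lemma radial_form_commute: "x \<in> S \<Longrightarrow> radial_form x u w = radial_form x w u"
  by (simp add: radial_form_eq bderiv_commute)

lemma bilinear_radial_form: "x \<in> S \<Longrightarrow> bilinear (radial_form x)"
  unfolding bilinear_def
  by (auto simp: radial_form_eq bilinear_expand[OF bilinear_bderiv] add_divide_distrib intro!: linearI)

lemma radial_form_radial: "x \<in> S \<Longrightarrow> radial_form x u x = 0"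
  using radial_form_commute[of x u x] by (simp add: radial_form_def radial form_simps)

definition energy :: "'e \<Rightarrow> real" where
  "energy x = b 0 x x"

lemma has_derivative_energy: "(energy has_derivative (\<lambda>h. 2 * b 0 x h)) (at x)"
proof -
  have "(energy has_derivative (\<lambda>h. b 0 h x + b 0 x h)) (at x)"
    unfolding energy_def[abs_def] by (rule has_derivative_center[OF has_derivative_ident has_derivative_ident])
  then show ?thesis by (simp add: field_commute[OF zero_in, of _ x])
qed

lemma has_derivative_of_energy:
  assumes "DERIV \<phi> (energy x) :> d"
  shows "((\<lambda>y. \<phi> (energy y)) has_derivative (\<lambda>h. d * (2 * b 0 x h))) (at x)"
  using diff_chain_at[OF has_derivative_energy assms[unfolded has_field_derivative_def]]
    by (simp add: o_def)

lemma energy_scaleR: "energy (t *\<^sub>R x) = t\<^sup>2 * energy x"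
  by (simp add: energy_def form_simps[OF zero_in] power2_eq_square)

text \<open>The Christoffel term of the Hessian is \<open>b\<^sub>0(x, \<Gamma>\<^sub>x(u,v))\<close>. The Gauss lemma replaces
  \<open>b\<^sub>0\<close> by \<open>b\<^sub>x\<close> here, and then the Koszul formula evaluates it.\<close>

lemma hess_of_energy:
  assumes x: "x \<in> S"
  shows "hess b (\<lambda>y. energy_series K (energy y)) x u v =
    2 * energy_series' K (energy x) * (b x u v + radial_form x u v)
    + 4 * energy_series'' K (energy x) * b 0 x u * b 0 x v"
proof -
  have d1: "fderiv (\<lambda>y. energy_series K (energy y)) y v = energy_series' K (energy y) * (2 * b 0 y v)"
    for y v
    using fderiv_eqI[OF has_derivative_of_energy[OF DERIV_energy_series(1)]] by simp
  have "((\<lambda>y. energy_series' K (energy y) * (2 * b 0 y v)) has_derivative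
      (\<lambda>h. energy_series' K (energy x) * (2 * (b 0 h v + b 0 x 0))
         + energy_series'' K (energy x) * (2 * b 0 x h) * (2 * b 0 x v))) (at x)"
    by (intro has_derivative_mult has_derivative_mult_right has_derivative_of_energy DERIV_energy_series
        has_derivative_center[OF has_derivative_ident has_derivative_const])
  from fderiv_eqI[OF this] have d2: "fderiv (\<lambda>y. fderiv (\<lambda>y. energy_series K (energy y)) y v) x u
     = 2 * energy_series' K (energy x) * b 0 u v + 4 * energy_series'' K (energy x) * b 0 x u * b 0 x v"
    by (simp add: d1 form_simps[OF zero_in])
  have "b 0 x (\<Gamma> x u v) = b x (\<Gamma> x u v) x"
    using gauss[OF x, of "\<Gamma> x u v"] field_commute[OF x, of x] by simp
  also have "\<dots> = b 0 u v - b x u v - radial_form x u v"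
    unfolding koszul_char[OF x] radial_form_eq[OF x]
    using bderiv_gauss[OF x, of u v] bderiv_gauss[OF x, of v u] bderiv_commute[OF x, of u v x]
      bderiv_commute[OF x, of v u x] field_commute[OF x, of u v] field_commute[OF zero_in, of u v]
    by (simp add: field_simps)
  finally have eq: "b 0 x (\<Gamma> x u v) = b 0 u v - b x u v - radial_form x u v" .
  show ?thesis
    unfolding hess_def d2 unfolding d1 eq by (simp add: algebra_simps)
qed

definition defect :: "real \<Rightarrow> 'e \<Rightarrow> 'e \<Rightarrow> 'e \<Rightarrow> real" where
  "defect K x u v = hess b (\<lambda>y. energy_series K (energy y)) x u v
     - (1 - K * energy_series K (energy x)) * b x u v"

lemma defect_eq:
  "x \<in> S \<Longrightarrow> defect K x u v = 2 * energy_series' K (energy x) * radial_form x u v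
    + (2 * energy_series' K (energy x) - (1 - K * energy_series K (energy x))) * b x u v
    + 4 * energy_series'' K (energy x) * b 0 x u * b 0 x v"
  by (simp add: defect_def hess_of_energy algebra_simps)

lemma bilinear_defect: "x \<in> S \<Longrightarrow> bilinear (defect K x)"
  unfolding bilinear_def
  by (auto simp: defect_eq form_simps form_simps[OF zero_in] bilinear_expand[OF bilinear_radial_form]
    algebra_simps intro!: linearI)

lemma defect_commute: "x \<in> S \<Longrightarrow> defect K x u v = defect K x v u"
  by (simp add: defect_eq radial_form_commute[of x u v] field_commute[of x u v])

text \<open>The Riccati equation for \<open>N = \<Gamma>\<^sub>x(x,\<cdot>)\<close>. Differentiating \<open>\<Gamma>\<^sub>y(y,y) = 0\<close> in the
  direction \<open>u\<close> shows that the derivative of \<open>\<Gamma>\<close> along \<open>u\<close>, applied to \<open>(x,x)\<close>, is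
  \<open>- 2 N u\<close>. The definition of the curvature then determines the derivative of \<open>\<Gamma>\<close> along
  \<open>x\<close>, applied to \<open>(x,u)\<close>.\<close>

lemma radial_form_riccati:
  assumes x: "x \<in> S"
  obtains D where "((\<lambda>y. radial_form y u u) has_derivative D) (at x)"
    and "D x = b x (\<Gamma> x x u) (\<Gamma> x x u) - b x (riem b x x u x) u - radial_form x u u"
proof -
  let ?N = "\<Gamma> x x"
  note G = Chr.bil[OF x]
  have "((\<lambda>y. \<Gamma> y y y) has_derivative (\<lambda>h. bderiv \<Gamma> x h x x + \<Gamma> x h x + \<Gamma> x x h)) (at x)"
    by (rule has_derivative_christoffel[OF x has_derivative_ident has_derivative_ident])
  moreover have "((\<lambda>y. \<Gamma> y y y) has_derivative (\<lambda>h. 0)) (at x)"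
    by (rule has_derivative_transform_within_open[OF has_derivative_const open_S x]) (simp add: radial)
  ultimately have "bderiv \<Gamma> x u x x + \<Gamma> x u x + \<Gamma> x x u = 0"
    using has_derivative_unique by (blast dest: fun_cong)
  then have g2: "bderiv \<Gamma> x u x x = - 2 *\<^sub>R ?N u"
    using add_eq_0_iff2[of "bderiv \<Gamma> x u x x" "?N u + ?N u"]
    by (simp add: koszul_commute[OF x, of u x] scaleR_2 add.assoc)
  have "bderiv \<Gamma> x x u x = bderiv \<Gamma> x x x u"
    unfolding bderiv_def by (rule fun_cong[OF fderiv_cong_open[OF open_S x]]) (rule koszul_commute)
  then have R: "riem b x x u x = - 2 *\<^sub>R ?N u - bderiv \<Gamma> x x x u - ?N (?N u)"
    unfolding riem_def g2 radial[OF x] by (simp add: bilinear_rzero[OF G] koszul_commute[OF x, of u x])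
  have dN: "((\<lambda>y. \<Gamma> y y u) has_derivative (\<lambda>h. bderiv \<Gamma> x h x u + \<Gamma> x h u + \<Gamma> x x 0)) (at x)"
    by (rule has_derivative_christoffel[OF x has_derivative_ident has_derivative_const])
  let ?D = "\<lambda>h. bderiv b x h (?N u) u + b x (bderiv \<Gamma> x h x u + \<Gamma> x h u + \<Gamma> x x 0) u + b x (?N u) 0"
  have "((\<lambda>y. radial_form y u u) has_derivative ?D) (at x)"
    unfolding radial_form_def by (rule has_derivative_field[OF x dN has_derivative_const])
  moreover have "?D x = b x (?N u) (?N u) - b x (riem b x x u x) u - radial_form x u u"
  proof -
    have 1: "bderiv b x x (?N u) u = 2 * b x (?N u) (?N u)"
      using radial_form_eq[OF x, of "?N u" u] radial_form_commute[OF x, of "?N u" u]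
        by (simp add: radial_form_def)
    have 2: "b x (?N (?N u)) u = b x (?N u) (?N u)"
      using radial_form_commute[OF x, of "?N u" u] by (simp add: radial_form_def)
    have 3: "bderiv \<Gamma> x x x u = - 2 *\<^sub>R ?N u - ?N (?N u) - riem b x x u x" by (simp add: R)
    show ?thesis unfolding 1 3
      by (simp add: form_simps[OF x] bilinear_rzero[OF G] 2 radial_form_def)
  qed
  ultimately show thesis by (rule that)
qed

text \<open>The quadratic term \<open>b(N u, N u)\<close> of the Riccati equation is absorbed by
  \<open>defect K x u (N u)\<close>. The remaining multiples of \<open>n\<close>, of \<open>b(u,u)\<close> and of \<open>b\<^sub>0(x,u)\<^sup>2\<close>
  agree by the differential equation for the energy series and its derivative.\<close>

lemma defect_radial_derivative:
  assumes x: "x \<in> S"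
  obtains D where "((\<lambda>y. defect K y u u) has_derivative D) (at x)"
    and "D x = 2 * energy_series' K (energy x) * (K * (energy x * b x u u - (b x x u)\<^sup>2) - b x (riem b
      x x u x) u)
      - defect K x u u + defect K x u (\<Gamma> x x u)"
proof -
  define \<phi> where "\<phi> = energy_series K (energy x)"
  define \<phi>1 where "\<phi>1 = energy_series' K (energy x)"
  define \<phi>2 where "\<phi>2 = energy_series'' K (energy x)"
  define \<phi>3 where "\<phi>3 = energy_series''' K (energy x)"
  define q where "q = b 0 x u"
  define n where "n = radial_form x u u"
  define N where "N = \<Gamma> x x u"
  define R where "R = b x (riem b x x u x) u"
  obtain Dn where Dn: "((\<lambda>y. radial_form y u u) has_derivative Dn) (at x)" "Dn x = b x N N - R - n"
    using radial_form_riccati[OF x] unfolding n_def N_def R_def by metis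
  let ?D = "\<lambda>h. (2 * \<phi>1 * Dn h + 2 * (\<phi>2 * (2 * b 0 x h)) * n)
     + ((2 * \<phi>1 - (1 - K * \<phi>)) * bderiv b x h u u
       + (2 * (\<phi>2 * (2 * b 0 x h)) - (0 - K * (\<phi>1 * (2 * b 0 x h)))) * b x u u)
     + (4 * \<phi>2 * q * (b 0 h u + b 0 x 0) + (4 * \<phi>2 * (b 0 h u + b 0 x 0)
       + 4 * (\<phi>3 * (2 * b 0 x h)) * q) * q)"
  have "((\<lambda>y. 2 * energy_series' K (energy y) * radial_form y u u
    + (2 * energy_series' K (energy y) - (1 - K * energy_series K (energy y))) * b y u u
    + 4 * energy_series'' K (energy y) * b 0 y u * b 0 y u) has_derivative ?D) (at x)"
    unfolding \<phi>_def \<phi>1_def \<phi>2_def \<phi>3_def q_def n_def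
    by (intro has_derivative_add has_derivative_mult has_derivative_diff has_derivative_mult_right
      has_derivative_const
        has_derivative_of_energy DERIV_energy_series Dn has_derivative_const_args[OF x]
        has_derivative_center[OF has_derivative_ident has_derivative_const])
  then have "((\<lambda>y. defect K y u u) has_derivative ?D) (at x)"
    by (rule has_derivative_transform_within_open[OF _ open_S x]) (simp add: defect_eq)
  moreover have "?D x = 2 * \<phi>1 * (K * (energy x * b x u u - (b x x u)\<^sup>2) - R) - defect K x u u
    + defect K x u N"
  proof -
    have "radial_form x u N = b x N N" by (simp add: radial_form_def N_def)
    moreover have "b 0 x N = 0"
      using gauss[OF x, of N] field_commute[OF x, of x N] radial_form_radial[OF x, of u]
      by (simp add: radial_form_def N_def)
    moreover have "b x u N = n" using field_commute[OF x, of u N] by (simp add: n_def radial_form_def N_def)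
    ultimately have BN: "defect K x u N = 2 * \<phi>1 * b x N N + (2 * \<phi>1 - (1 - K * \<phi>)) * n"
      by (simp add: defect_eq[OF x] \<phi>_def \<phi>1_def)
    have B: "defect K x u u = 2 * \<phi>1 * n + (2 * \<phi>1 - (1 - K * \<phi>)) * b x u u + 4 * \<phi>2 * q\<^sup>2"
      by (simp add: defect_eq[OF x] \<phi>_def \<phi>1_def \<phi>2_def n_def q_def power2_eq_square)
    have g: "bderiv b x x u u = 2 * n" by (simp add: n_def radial_form_eq[OF x])
    have ode: "1 - K * \<phi> = 2 * \<phi>1 + 4 * energy x * \<phi>2"
      by (simp add: \<phi>_def \<phi>1_def \<phi>2_def energy_series_ode)
    have ode': "K * \<phi>1 = - 6 * \<phi>2 - 4 * energy x * \<phi>3"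
      using energy_series_ode'[of K "energy x"] by (simp add: \<phi>1_def \<phi>2_def \<phi>3_def)
    have e: "b 0 x x = energy x" by (simp add: energy_def)
    have "?D x = 2 * \<phi>1 * (b x N N - R - n) + 4 * \<phi>2 * energy x * n
       - 4 * energy x * \<phi>2 * (2 * n) + (4 * \<phi>2 + 2 * (K * \<phi>1)) * energy x * b x u u
       + 8 * \<phi>2 * q\<^sup>2 + 8 * energy x * \<phi>3 * q\<^sup>2"
      unfolding Dn(2) g e ode q_def[symmetric] form_simps(10)[OF zero_in]
      by (simp add: algebra_simps power2_eq_square)
    also have "\<dots> = 2 * (K * \<phi>1) * (energy x * b x u u - q\<^sup>2) - 2 * \<phi>1 * R - defect K x u u + defect K x u N"
      unfolding B BN ode ode' by (simp add: algebra_simps power2_eq_square)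
    also have "\<dots> = 2 * \<phi>1 * (K * (energy x * b x u u - (b x x u)\<^sup>2) - R) - defect K x u u + defect K x u N"
      by (simp add: gauss[OF x] q_def algebra_simps)
    finally show ?thesis .
  qed
  ultimately show thesis
    unfolding \<phi>1_def R_def N_def by (rule that)
qed

text \<open>Along the ray, \<open>t\<close> times the defect at \<open>t x\<close> satisfies the hypotheses of
  \<open>form_ode_nonneg\<close>: the factor \<open>t\<close> makes it vanish at \<open>0\<close>, accounts for the summand
  \<open>- D(u,u)\<close> in the derivative of the defect \<open>D\<close>, and turns \<open>\<Gamma>\<^bsub>tx\<^esub>(tx,u)\<close> into \<open>t\<close> times the
  bounded \<open>m t u\<close>.\<close>

lemma defect_nonneg:
  assumes curv: "\<And>x u. x \<in> S \<Longrightarrow> b x (riem b x x u x) u \<le> K * (b x x x * b x u u - (b x x u)\<^sup>2)"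
    and pos: "\<And>x. x \<in> S \<Longrightarrow> 1 - K * energy_series K (energy x) > 0"
    and x: "x \<in> S"
  shows "defect K x u u \<ge> 0"
proof -
  define Y where "Y t u v = t * defect K (t *\<^sub>R x) u v" for t u v
  define m where "m t u = \<Gamma> (t *\<^sub>R x) x u" for t u
  define p where "p t u = 2 * energy_series' K (energy (t *\<^sub>R x)) *
     (K * (energy (t *\<^sub>R x) * b (t *\<^sub>R x) u u - (b (t *\<^sub>R x) (t *\<^sub>R x) u)\<^sup>2)
       - b (t *\<^sub>R x) (riem b (t *\<^sub>R x) (t *\<^sub>R x) u (t *\<^sub>R x)) u)" for t u
  have z: "t *\<^sub>R x \<in> S" if "t \<in> {0..1}" for t by (rule star[OF x that])
  have cont: "continuous_on {0..1} (\<lambda>t. norm (m t i))" for i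
    unfolding m_def
    by (intro continuous_on_norm continuous_on_compose2[OF smooth_on_continuous[OF Chr.smooth]]
      continuous_intros)
      (use z in auto)
  have "\<exists>M. \<forall>t\<in>{0..1}. norm (m t i) \<le> M" for i
    using continuous_attains_sup[OF compact_Icc _ cont[of i]] by fastforce
  then obtain M where M: "\<And>t i. t \<in> {0..1} \<Longrightarrow> norm (m t i) \<le> M i" by metis
  have "Y 1 u u \<ge> 0"
  proof (rule form_ode_nonneg[where Y = Y and m = m and p = p and C = "\<Sum>i\<in>Basis. M i"])
    fix t :: real and u v :: 'e assume t: "t \<in> {0..1}"
    note zt = z[OF t]
    show "bilinear (Y t)"
      unfolding Y_def bilinear_def
      by (auto intro!: linearI simp: bilinear_expand[OF bilinear_defect[OF zt]] algebra_simps)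
    show "Y t u v = Y t v u" unfolding Y_def by (simp only: defect_commute[OF zt, of K u v])
    obtain D where D: "((\<lambda>y. defect K y u u) has_derivative D) (at (t *\<^sub>R x))"
      "D (t *\<^sub>R x) = p t u - defect K (t *\<^sub>R x) u u + defect K (t *\<^sub>R x) u (\<Gamma> (t *\<^sub>R x) (t *\<^sub>R x) u)"
      using defect_radial_derivative[OF zt] unfolding p_def by metis
    have "\<Gamma> (t *\<^sub>R x) (t *\<^sub>R x) u = t *\<^sub>R m t u" by (simp add: m_def bilinear_lmul[OF Chr.bil[OF zt]])
    then have tD: "t * D x = p t u - defect K (t *\<^sub>R x) u u + Y t u (m t u)"
      using D(2) linear_scale[OF has_derivative_linear[OF D(1)], of t x]
      by (simp add: Y_def bilinear_rmul[OF bilinear_defect[OF zt]])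
    have "((\<lambda>t. t * defect K (t *\<^sub>R x) u u) has_real_derivative 1 * defect K (t *\<^sub>R x) u u
      + D x * t) (at t)"
      by (rule DERIV_mult[OF DERIV_ident ray_has_derivative[OF D(1)]])
    then have "((\<lambda>t. Y t u u) has_real_derivative p t u + Y t u (m t u)) (at t)"
      using tD by (simp add: Y_def mult.commute)
    then show "((\<lambda>t. Y t u u) has_real_derivative p t u + Y t u (m t u)) (at t within {0..1})"
      by (rule has_field_derivative_at_within)
    have "energy_series' K (energy (t *\<^sub>R x)) \<ge> 0"
    proof (rule energy_series_deriv_nonneg)
      fix s :: real assume s: "s \<in> {0..1}"
      show "0 \<le> 1 - K * energy_series K (s\<^sup>2 * energy (t *\<^sub>R x))"
        using pos[OF star[OF zt s]] by (simp only: energy_scaleR[of s "t *\<^sub>R x"] less_imp_le)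
    qed
    then show "p t u \<ge> 0"
      unfolding p_def using curv[OF zt, of u] radial_norm[OF zt] by (simp add: energy_def)
    have "norm (m t u) = norm (\<Sum>i\<in>Basis. (u \<bullet> i) *\<^sub>R m t i)"
      using linear_basis_expand[of "m t" u] Chr.bil[OF zt] by (simp add: bilinear_def m_def[abs_def])
    also have "\<dots> \<le> (\<Sum>i\<in>Basis. norm u * M i)"
      by (intro sum_norm_le) (simp add: mult_mono Basis_le_norm M[OF t])
    finally show "norm (m t u) \<le> (\<Sum>i\<in>Basis. M i) * norm u" by (simp add: sum_distrib_left mult.commute)
  qed (simp add: Y_def)
  then show ?thesis by (simp add: Y_def)
qed

end

section \<open>Lorentzian signature\<close>

text \<open>When \<open>T\<close> is a hyperplane and the dimension is at least \<open>2\<close>, a symmetric form with such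
  a splitting has Lorentzian signature. In contrast to the index, the condition is visibly
  stable under perturbation of the form.\<close>

definition timelike_split :: "('e::euclidean_space \<Rightarrow> 'e \<Rightarrow> real) \<Rightarrow> 'e \<Rightarrow> 'e set \<Rightarrow> bool" where
  "timelike_split B v T \<longleftrightarrow> B v v < 0 \<and> (\<forall>w\<in>T. w \<noteq> 0 \<longrightarrow> B w w > 0)"

lemma finite_negative_dims:
  "finite {dim S | S :: 'e::euclidean_space set. subspace S \<and> (\<forall>x\<in>S. x \<noteq> 0 \<longrightarrow> b x x < (0::real))}"
  by (rule finite_subset[of _ "{..DIM('e)}"]) (auto simp: dim_subset_UNIV)

lemma form_index_ge:
  "\<lbrakk>subspace S; \<And>x. x \<in> S \<Longrightarrow> x \<noteq> 0 \<Longrightarrow> b x x < 0\<rbrakk> \<Longrightarrow> dim S \<le> form_index b"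
  unfolding form_index_def by (rule Max_ge[OF finite_negative_dims]) blast

lemma form_index_attained:
  obtains S where "subspace S" "\<And>x. x \<in> S \<Longrightarrow> x \<noteq> 0 \<Longrightarrow> b x x < 0" "dim S = form_index b"
proof -
  have "subspace {0::'a} \<and> (\<forall>x\<in>{0}. x \<noteq> 0 \<longrightarrow> b x x < 0)" by simp
  then have "{dim S | S. subspace S \<and> (\<forall>x\<in>S. x \<noteq> 0 \<longrightarrow> b x x < 0)} \<noteq> {}" by blast
  from Max_in[OF finite_negative_dims[of b] this] show thesis
    using that unfolding form_index_def by auto
qed

text \<open>Let \<open>w \<noteq> 0\<close> be orthogonal to a negative vector \<open>v\<close>. If \<open>b w w < 0\<close>, then \<open>v\<close> and \<open>w\<close>
  span a negative plane, which the index excludes. If \<open>b w w = 0\<close>, nondegeneracy yields \<open>y'\<close>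
  orthogonal to \<open>v\<close> with \<open>b w y' \<noteq> 0\<close>, and adding a multiple of \<open>w\<close> to \<open>y'\<close> gives a negative
  vector orthogonal to \<open>v\<close>.\<close>

lemma lorentzian_signature_split:
  assumes L: "lorentzian_signature b"
  obtains v where "timelike_split b v {w. b v w = 0}"
proof -
  have sp: "scalar_product b" and ind: "form_index b = 1"
    using L by (auto simp: lorentzian_signature_def)
  note bil = scalar_product_bilinear[OF sp]
  note bl = bilinear_expand[OF bil]
  note comm = scalar_product_commute[OF sp]
  obtain S where S: "\<And>x. x \<in> S \<Longrightarrow> x \<noteq> 0 \<Longrightarrow> b x x < 0" "dim S = 1"
    using form_index_attained[of b] ind by metis
  have "\<not> S \<subseteq> {0}" using S(2) dim_subset[of S "{0}"] by auto
  then obtain v where v: "v \<in> S" "v \<noteq> 0" by blast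
  have bv: "b v v < 0" using S(1) v by blast
  have no_neg: "\<not> b w w < 0" if w: "b v w = 0" for w
  proof
    assume neg: "b w w < 0"
    have "v \<notin> span {w}"
    proof
      assume "v \<in> span {w}"
      then obtain k where "v = k *\<^sub>R w" by (auto simp: span_singleton)
      then have "b v v = b v (k *\<^sub>R w)" by (rule arg_cong)
      then have "b v v = k * b v w" by (simp add: bl)
      then show False using bv w by simp
    qed
    moreover have "w \<noteq> 0" using neg bl by auto
    ultimately have "independent {v, w}" "v \<noteq> w"
      by (auto simp: independent_insert span_base)
    then have "dim (span {v, w}) = 2" by (simp add: dim_eq_card_independent)
    moreover have "dim (span {v, w}) \<le> form_index b"
    proof (rule form_index_ge)
      fix x assume "x \<in> span {v, w}" "x \<noteq> 0"
      then obtain k l where x: "x = k *\<^sub>R v + l *\<^sub>R w"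
        by (auto simp: span_insert span_singleton algebra_simps)
      have "b x x = k\<^sup>2 * b v v + l\<^sup>2 * b w w"
        using w comm[of w v] by (simp add: x bl power2_eq_square algebra_simps)
      moreover have "k \<noteq> 0 \<or> l \<noteq> 0" using x \<open>x \<noteq> 0\<close> by auto
      ultimately show "b x x < 0" using bv neg
        by (smt (verit) mult_nonneg_nonpos zero_le_power2 mult_pos_neg zero_less_power2)
    qed simp
    ultimately show False using ind by simp
  qed
  have "b w w > 0" if w: "b v w = 0" "w \<noteq> 0" for w
  proof (rule ccontr)
    assume "\<not> b w w > 0"
    then have w0: "b w w = 0" using no_neg[OF w(1)] by simp
    obtain y where y: "b w y \<noteq> 0" using scalar_product_nondegenerate[OF sp] w(2) by blast
    define y' where "y' = y - (b v y / b v v) *\<^sub>R v"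
    have y': "b v y' = 0" "b w y' = b w y"
      using bv w(1) comm[of w v] by (simp_all add: y'_def bl)
    define r where "r = - (b y' y' + 1) / (2 * b w y)"
    define w' where "w' = y' + r *\<^sub>R w"
    have "b v w' = 0" using y' w by (simp add: w'_def bl)
    moreover have "b w' w' = b y' y' + 2 * r * b w y'"
      using w0 comm[of y' w] by (simp add: w'_def bl algebra_simps)
    moreover have "2 * r * b w y = - (b y' y' + 1)" using y by (simp add: r_def)
    ultimately have "b v w' = 0" "b w' w' = - 1" by (simp_all add: y')
    then show False using no_neg by fastforce
  qed
  then show thesis using bv that[of v] by (simp add: timelike_split_def)
qed

text \<open>A negative subspace meets the hyperplane \<open>l = 0\<close> only in \<open>0\<close>, so its dimension is at
  most \<open>1\<close>. For nondegeneracy, split a null vector of the form as \<open>\<alpha> v + w\<close> with \<open>l w = 0\<close>;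
  pairing it with \<open>v\<close> and with \<open>w\<close> gives \<open>B w w = \<alpha>\<^sup>2 B v v \<le> 0\<close>.\<close>

lemma lorentzian_signatureI:
  fixes B :: "'e::euclidean_space \<Rightarrow> 'e \<Rightarrow> real"
  assumes B: "bilinear B" "\<And>x y. B x y = B y x" and l: "linear l" "l v \<noteq> (0::real)"
    and split: "timelike_split B v {w. l w = 0}" and dim: "DIM('e) \<ge> 2"
  shows "lorentzian_signature B"
proof -
  note bl = bilinear_expand[OF B(1)]
  have neg: "B v v < 0" and pos: "\<And>w. l w = 0 \<Longrightarrow> w \<noteq> 0 \<Longrightarrow> B w w > 0"
    using split by (auto simp: timelike_split_def)
  have "z = 0" if z: "\<forall>y. B z y = 0" for z
  proof -
    define \<alpha> where "\<alpha> = l z / l v"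
    define w where "w = z - \<alpha> *\<^sub>R v"
    have "l w = 0" using l(2) by (simp add: w_def \<alpha>_def linear_diff[OF l(1)] linear_scale[OF l(1)])
    have "B z v = 0" "B z w = 0" using z by auto
    moreover have "z = \<alpha> *\<^sub>R v + w" by (simp add: w_def)
    ultimately have 1: "\<alpha> * B v v + B w v = 0" "\<alpha> * B v w + B w w = 0"
      by (simp_all add: bl)
    then have "B v w = - \<alpha> * B v v" "B w w = - \<alpha> * B v w" using B(2)[of v w] by simp_all
    then have "B w w = \<alpha>\<^sup>2 * B v v" by (simp add: power2_eq_square)
    then have "B w w \<le> 0" using neg by (simp add: mult_nonneg_nonpos)
    then have "w = 0" using pos[OF \<open>l w = 0\<close>] by force
    then have "\<alpha> = 0" using 1(1) neg by (simp add: bl)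
    then show "z = 0" using \<open>w = 0\<close> by (simp add: w_def)
  qed
  then have sp: "scalar_product B" using B by (auto simp: scalar_product_def)
  have "v \<noteq> 0" using neg bl by auto
  have "dim (span {v}) \<le> form_index B"
  proof (rule form_index_ge)
    fix x assume "x \<in> span {v}" "x \<noteq> 0"
    then obtain k where "x = k *\<^sub>R v" "k \<noteq> 0" by (auto simp: span_singleton)
    then show "B x x < 0" using neg by (simp add: bl mult_pos_neg mult.assoc[symmetric]
      zero_less_mult_iff flip: power2_eq_square)
  qed simp
  moreover have "dim (span {v}) = 1"
    using \<open>v \<noteq> 0\<close> by (simp add: dim_eq_card_independent[of "{v}"])
  moreover have "form_index B \<le> 1"
  proof -
    obtain S where S: "subspace S" "\<And>x. x \<in> S \<Longrightarrow> x \<noteq> 0 \<Longrightarrow> B x x < 0" "dim S = form_index B"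
      using form_index_attained by metis
    have "\<exists>w. S \<subseteq> span {w}"
    proof (cases "S \<subseteq> {0}")
      case True
      then show ?thesis using span_zero by blast
    next
      case False
      then obtain w where w: "w \<in> S" "w \<noteq> 0" by blast
      have zero: "x = 0" if "x \<in> S" "l x = 0" for x using S(2) pos that by force
      have lw: "l w \<noteq> 0" using zero w by blast
      have "y \<in> span {w}" if y: "y \<in> S" for y
      proof -
        have "l (y - (l y / l w) *\<^sub>R w) = 0"
          using lw by (simp add: linear_diff[OF l(1)] linear_scale[OF l(1)])
        moreover have "y - (l y / l w) *\<^sub>R w \<in> S" using S(1) w y by (intro subspace_diff subspace_scale)
        ultimately have "y = (l y / l w) *\<^sub>R w" using zero by (metis eq_iff_diff_eq_0)
        then show ?thesis by (metis span_base span_scale insertI1)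
      qed
      then show ?thesis by blast
    qed
    then obtain w where "S \<subseteq> span {w}" by blast
    then have "dim S \<le> dim {w}" using dim_subset dim_span by metis
    also have "\<dots> \<le> 1" using dim_le_card'[of "{w}"] by simp
    finally show ?thesis using S(3) by simp
  qed
  ultimately show ?thesis using sp dim by (simp add: lorentzian_signature_def)
qed

lemma lorentzian_signature_pullback:
  fixes B C :: "'e::euclidean_space \<Rightarrow> 'e \<Rightarrow> real"
  assumes T: "linear T" "bij T" and eq: "\<And>u w. C u w = B (T u) (T w)" and L: "lorentzian_signature B"
  shows "lorentzian_signature C"
proof -
  have sp: "scalar_product B" and dim: "DIM('e) \<ge> 2" using L by (auto simp: lorentzian_signature_def)
  note bil = scalar_product_bilinear[OF sp]
  obtain v where v: "timelike_split B v {w. B v w = 0}" by (rule lorentzian_signature_split[OF L])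
  define v' where "v' = inv T v"
  have Tv: "T v' = v" unfolding v'_def using T(2) by (simp add: bij_is_surj surj_f_inv_f)
  show ?thesis
  proof (rule lorentzian_signatureI[where v = v' and l = "\<lambda>w. B v (T w)"])
    show "bilinear C" unfolding bilinear_def eq
      by (auto intro!: linearI simp: linear_add[OF T(1)] linear_scale[OF T(1)] bilinear_expand[OF bil])
    show "C x y = C y x" for x y unfolding eq by (rule scalar_product_commute[OF sp])
    show "linear (\<lambda>w. B v (T w))"
      by (auto intro!: linearI simp: linear_add[OF T(1)] linear_scale[OF T(1)] bilinear_expand[OF bil])
    show "B v (T v') \<noteq> 0" using v by (simp add: Tv timelike_split_def)
    have "T w \<noteq> 0" if "w \<noteq> 0" for w
      using that linear_injective_0[OF T(1)] bij_is_inj[OF T(2)] by blast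
    then show "timelike_split C v' {w. B v (T w) = 0}"
      using v by (auto simp: timelike_split_def eq Tv)
  qed (rule dim)
qed

lemma bilinear_diagonal_bound:
  fixes B :: "'e::euclidean_space \<Rightarrow> 'e \<Rightarrow> real"
  assumes "bilinear B"
  shows "\<bar>B w w\<bar> \<le> (\<Sum>i\<in>Basis. \<Sum>j\<in>Basis. \<bar>B i j\<bar>) * (norm w)\<^sup>2"
proof -
  have "\<bar>B w w\<bar> \<le> (\<Sum>i\<in>Basis. \<bar>\<Sum>j\<in>Basis. (w \<bullet> i * (w \<bullet> j)) * B i j\<bar>)"
    unfolding bilinear_basis_expand[OF assms, of w w] real_scaleR_def by (rule sum_abs)
  also have "\<dots> \<le> (\<Sum>i\<in>Basis. \<Sum>j\<in>Basis. \<bar>(w \<bullet> i * (w \<bullet> j)) * B i j\<bar>)"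
    by (intro sum_mono sum_abs)
  also have "\<dots> \<le> (\<Sum>i\<in>Basis. \<Sum>j\<in>Basis. \<bar>B i j\<bar> * (norm w)\<^sup>2)"
    by (intro sum_mono) (simp add: abs_mult power2_eq_square mult.commute mult_left_mono mult_mono
      Basis_le_norm)
  finally show ?thesis by (simp add: sum_distrib_right)
qed

text \<open>The hyperplane orthogonal to a timelike vector \<open>v\<close> of \<open>b\<close> serves all nearby forms: on
  it \<open>b w w \<ge> \<mu> |w|\<^sup>2\<close> by compactness of the unit sphere, which leaves room for
  perturbations smaller than \<open>\<mu>\<close>.\<close>

lemma eventually_lorentzian_signature:
  fixes H :: "'a \<Rightarrow> 'e::euclidean_space \<Rightarrow> 'e \<Rightarrow> real"
  assumes b: "lorentzian_signature b"
    and lim: "\<And>u w. ((\<lambda>x. H x u w) \<longlongrightarrow> b u w) F"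
    and H: "\<forall>\<^sub>F x in F. bilinear (H x) \<and> (\<forall>u w. H x u w = H x w u)"
  shows "\<forall>\<^sub>F x in F. lorentzian_signature (H x)"
proof -
  have sp: "scalar_product b" and dim: "DIM('e) \<ge> 2" using b by (auto simp: lorentzian_signature_def)
  note bil = scalar_product_bilinear[OF sp]
  obtain v where v: "timelike_split b v {w. b v w = 0}" by (rule lorentzian_signature_split[OF b])
  have bcont: "continuous_on UNIV (\<lambda>w. b w w)"
    using bounded_bilinear.continuous_on[of b UNIV "\<lambda>w. w" "\<lambda>w. w"] bil
    by (simp add: bilinear_conv_bounded_bilinear continuous_on_id)
  have lb: "linear (b v)" using bil by (simp add: bilinear_def)
  have "\<exists>\<mu>>0. \<forall>w. b v w = 0 \<longrightarrow> b w w \<ge> \<mu> * (norm w)\<^sup>2"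
  proof -
    let ?C = "sphere 0 1 \<inter> {w. b v w = 0}"
    have "closed {w. b v w = 0}"
      by (rule closed_Collect_eq) (auto intro: linear_continuous_on
        linear_conv_bounded_linear[THEN iffD1, OF lb])
    then have "compact ?C" by (intro compact_Int_closed) simp_all
    show ?thesis
    proof (cases "?C = {}")
      case True
      have "w = 0" if "b v w = 0" for w
      proof (rule ccontr)
        assume "w \<noteq> 0"
        then have "(1 / norm w) *\<^sub>R w \<in> ?C" using that by (simp add: linear_scale[OF lb])
        then show False using True by blast
      qed
      then have "b w w \<ge> 1 * (norm w)\<^sup>2" if "b v w = 0" for w
      proof -
        have "w = 0" using \<open>\<And>w. b v w = 0 \<Longrightarrow> w = 0\<close> that by blast
        then show ?thesis by (simp add: bilinear_lzero[OF bil])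
      qed
      then show ?thesis using zero_less_one by blast
    next
      case False
      obtain w0 where w0: "w0 \<in> ?C" "\<And>w. w \<in> ?C \<Longrightarrow> b w0 w0 \<le> b w w"
        using continuous_attains_inf[OF \<open>compact ?C\<close> False continuous_on_subset[OF bcont subset_UNIV]]
          by blast
      have "b w0 w0 > 0" using v w0(1) by (force simp: timelike_split_def)
      moreover have "b w0 w0 * (norm w)\<^sup>2 \<le> b w w" if "b v w = 0" for w
      proof (cases "w = 0")
        case False
        then have "(1 / norm w) *\<^sub>R w \<in> ?C" using that by (simp add: linear_scale[OF lb])
        from w0(2)[OF this] show ?thesis using False
          by (simp add: bilinear_expand[OF bil] field_simps power2_eq_square)
      qed (simp add: bilinear_lzero[OF bil])
      ultimately show ?thesis by blast
    qed
  qed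
  then obtain \<mu> where \<mu>: "\<mu> > 0" "\<And>w. b v w = 0 \<Longrightarrow> b w w \<ge> \<mu> * (norm w)\<^sup>2" by blast
  have "((\<lambda>x. \<Sum>i\<in>Basis. \<Sum>j\<in>Basis. \<bar>H x i j - b i j\<bar>) \<longlongrightarrow> (\<Sum>i\<in>Basis. \<Sum>j\<in>Basis. \<bar>b i j - b i j\<bar>)) F"
    by (intro tendsto_intros lim)
  then have "\<forall>\<^sub>F x in F. (\<Sum>i\<in>Basis. \<Sum>j\<in>Basis. \<bar>H x i j - b i j\<bar>) < \<mu>"
    using \<mu>(1) by (auto dest: order_tendstoD(2)[where a = \<mu>])
  moreover have "\<forall>\<^sub>F x in F. H x v v < 0"
    using lim[of v v] v by (auto simp: timelike_split_def dest: order_tendstoD(2)[where a = 0])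
  ultimately show ?thesis using H
  proof eventually_elim
    case (elim x)
    have bilD: "bilinear (\<lambda>u w. H x u w - b u w)"
      using elim(3) bil by (auto simp: bilinear_def intro!: linear_compose_sub)
    show ?case
    proof (rule lorentzian_signatureI[OF _ _ lb _ _ dim, where v = v])
      show "timelike_split (H x) v {w. b v w = 0}"
        unfolding timelike_split_def
      proof (intro conjI ballI impI)
        fix w assume w: "w \<in> {w. b v w = 0}" "w \<noteq> 0"
        have "\<bar>H x w w - b w w\<bar> \<le> (\<Sum>i\<in>Basis. \<Sum>j\<in>Basis. \<bar>H x i j - b i j\<bar>) * (norm w)\<^sup>2"
          by (rule bilinear_diagonal_bound[OF bilD])
        also have "\<dots> < \<mu> * (norm w)\<^sup>2" using elim(1) w(2) by (intro mult_strict_right_mono) auto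
        finally show "H x w w > 0" using \<mu>(2)[of w] w(1) by auto
      qed (rule elim(2))
    qed (use elim(3) v in \<open>auto simp: timelike_split_def\<close>)
  qed
qed

section \<open>Uniqueness for ordinary differential equations\<close>

lemma smooth_on_locally_lipschitz:
  fixes f :: "'a::euclidean_space \<Rightarrow> 'b::real_normed_vector"
  assumes "open S" "x \<in> S" "smooth_on S f"
  obtains r L where "r > 0" "L \<ge> 0"
    "\<And>y z. \<lbrakk>y \<in> ball x r; z \<in> ball x r\<rbrakk> \<Longrightarrow> norm (f y - f z) \<le> L * norm (y - z)"
proof -
  obtain r where r: "r > 0" "cball x r \<subseteq> S" using assms(1,2) open_contains_cball by blast
  have cont: "continuous_on (cball x r) (\<lambda>y. \<Sum>i\<in>Basis. norm (fderiv f y i))"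
    by (intro continuous_on_sum continuous_on_norm
        continuous_on_subset[OF smooth_on_continuous[OF smooth_on_fderiv[OF assms(3)]] r(2)])
  have "cball x r \<noteq> {}" using r(1) by simp
  then obtain y0 where y0: "\<And>y. y \<in> cball x r \<Longrightarrow> (\<Sum>i\<in>Basis. norm (fderiv f y i))
    \<le> (\<Sum>i\<in>Basis. norm (fderiv f y0 i))"
    using continuous_attains_sup[OF compact_cball _ cont] by blast
  define L where "L = (\<Sum>i\<in>Basis. norm (fderiv f y0 i))"
  have "norm (f y - f z) \<le> L * norm (y - z)" if "y \<in> ball x r" "z \<in> ball x r" for y z
  proof (rule differentiable_bound[OF convex_ball[of x r] _ _ that])
    fix w assume w: "w \<in> ball x r"
    then have wS: "w \<in> S" using r(2) by auto
    show "(f has_derivative fderiv f w) (at w within ball x r)"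
      by (rule has_derivative_at_withinI[OF smooth_on_has_derivative[OF assms(3) wS]])
    have "onorm (fderiv f w) \<le> (\<Sum>i\<in>Basis. norm (fderiv f w i))"
      by (rule onorm_componentwise[OF has_derivative_bounded_linear[OF smooth_on_has_derivative[OF assms(3) wS]]])
    also have "\<dots> \<le> L" unfolding L_def using w by (intro y0) auto
    finally show "onorm (fderiv f w) \<le> L" .
  qed
  moreover have "L \<ge> 0" unfolding L_def by (intro sum_nonneg) auto
  ultimately show thesis using that r(1) by blast
qed

text \<open>On an interval of radius \<open>\<delta>\<close> the mean value inequality bounds the maximum of the
  distance of the two solutions by \<open>L \<delta>\<close> times itself, where \<open>L \<delta> < 1\<close>.\<close>

lemma ode_unique_locally:
  fixes f :: "'a::euclidean_space \<Rightarrow> 'a"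
  assumes f: "open S" "smooth_on S f" and init: "y t0 = z t0" "y t0 \<in> S"
    and sol: "open J" "t0 \<in> J"
      "\<And>t. t \<in> J \<Longrightarrow> (y has_vector_derivative f (y t)) (at t)"
      "\<And>t. t \<in> J \<Longrightarrow> (z has_vector_derivative f (z t)) (at t)"
  shows "\<exists>\<delta>>0. \<forall>t. \<bar>t - t0\<bar> < \<delta> \<longrightarrow> y t = z t"
proof -
  obtain r L where r: "r > 0" "L \<ge> 0"
    "\<And>u w. \<lbrakk>u \<in> ball (y t0) r; w \<in> ball (y t0) r\<rbrakk> \<Longrightarrow> norm (f u - f w) \<le> L * norm (u - w)"
    using smooth_on_locally_lipschitz[OF f(1) init(2) f(2)] by blast
  have cont: "isCont y t0" "isCont z t0"
    using sol has_vector_derivative_continuous by blast+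
  obtain \<delta>1 where \<delta>1: "\<delta>1 > 0" "ball t0 \<delta>1 \<subseteq> J" using sol(1,2) open_contains_ball by blast
  obtain \<delta>2 where \<delta>2: "\<delta>2 > 0" "\<And>t. dist t t0 < \<delta>2 \<Longrightarrow> dist (y t) (y t0) < r"
    using cont(1) r(1) unfolding continuous_at_eps_delta by metis
  obtain \<delta>3 where \<delta>3: "\<delta>3 > 0" "\<And>t. dist t t0 < \<delta>3 \<Longrightarrow> dist (z t) (z t0) < r"
    using cont(2) r(1) unfolding continuous_at_eps_delta by metis
  define \<delta> where "\<delta> = min (min \<delta>1 (min \<delta>2 \<delta>3) / 2) (1 / (2 * (L + 1)))"
  have \<delta>: "\<delta> > 0" "\<delta> < \<delta>1" "\<delta> < \<delta>2" "\<delta> < \<delta>3" "L * \<delta> < 1"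
  proof -
    show "\<delta> > 0" "\<delta> < \<delta>1" "\<delta> < \<delta>2" "\<delta> < \<delta>3" using \<delta>1 \<delta>2 \<delta>3 r(2) by (auto simp: \<delta>_def)
    have "L * \<delta> \<le> L * (1 / (2 * (L + 1)))" using r(2) by (intro mult_left_mono) (auto simp: \<delta>_def)
    also have "\<dots> < 1" using r(2) by (simp add: divide_simps)
    finally show "L * \<delta> < 1" .
  qed
  let ?I = "cball t0 \<delta>"
  have I: "t \<in> J" "y t \<in> ball (y t0) r" "z t \<in> ball (y t0) r" if "t \<in> ?I" for t
    using that \<delta> \<delta>1(2) \<delta>2(2)[of t] \<delta>3(2)[of t] init(1) by (auto simp: dist_commute subset_iff)
  define d where "d t = y t - z t" for t
  have dd: "(d has_vector_derivative f (y t) - f (z t)) (at t)" if "t \<in> ?I" for t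
    unfolding d_def using I[OF that] by (intro has_vector_derivative_diff sol)
  have "continuous_on ?I (\<lambda>t. norm (d t))"
    using has_vector_derivative_continuous[OF dd]
    by (intro continuous_on_norm continuous_at_imp_continuous_on) blast
  then obtain s where s: "s \<in> ?I" "\<And>t. t \<in> ?I \<Longrightarrow> norm (d t) \<le> norm (d s)"
    using continuous_attains_sup[of ?I "\<lambda>t. norm (d t)"] \<delta>(1) by (auto simp del: mem_cball)
  have "norm (d s - d t0) \<le> L * norm (d s) * norm (s - t0)"
  proof (rule differentiable_bound[OF convex_cball[of t0 \<delta>]])
    fix t assume t: "t \<in> ?I"
    show "(d has_derivative (\<lambda>h. h *\<^sub>R (f (y t) - f (z t)))) (at t within ?I)"
      using dd[OF t] unfolding has_vector_derivative_def by (rule has_derivative_at_withinI)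
    have "norm (f (y t) - f (z t)) \<le> L * norm (d t)" unfolding d_def by (rule r(3)[OF I(2,3)[OF t]])
    also have "\<dots> \<le> L * norm (d s)" using s(2)[OF t] r(2) by (intro mult_left_mono)
    finally have "norm (f (y t) - f (z t)) \<le> L * norm (d s)" .
    then show "onorm (\<lambda>h. h *\<^sub>R (f (y t) - f (z t))) \<le> L * norm (d s)"
      by (intro onorm_le) (simp add: mult.commute mult_left_mono)
  qed (use s \<delta>(1) in auto)
  moreover have "norm (s - t0) \<le> \<delta>" using s(1) by (simp add: dist_norm norm_minus_commute)
  moreover have "d t0 = 0" by (simp add: d_def init)
  ultimately have "norm (d s) \<le> L * norm (d s) * \<delta>"
    using r(2) by (smt (verit) diff_zero mult_left_mono mult_nonneg_nonneg norm_ge_zero)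
  then have "norm (d s) * (1 - L * \<delta>) \<le> 0" by (simp add: algebra_simps)
  then have "norm (d s) = 0" using \<delta>(5) by (smt (verit) mult_pos_pos norm_ge_zero)
  then have "y t = z t" if "\<bar>t - t0\<bar> < \<delta>" for t
    using s(2)[of t] that by (simp add: d_def dist_real_def abs_minus_commute)
  then show ?thesis using \<delta>(1) by blast
qed

section \<open>Charts and geodesics\<close>

locale semi_riemannian_manifold =
  fixes A :: "('m::{t2_space, second_countable_topology}, 'e::euclidean_space) chart set"
    and g :: "('m, 'e) metric"
  assumes semi_riemannian: "semi_riemannian A g"
begin

abbreviation "metric_at \<equiv> metric_in_chart A g"

lemma smooth_atlas: "smooth_atlas A"
  using semi_riemannian by (simp add: semi_riemannian_def)

lemma chart_open: "c \<in> A \<Longrightarrow> open (cdom c)" "c \<in> A \<Longrightarrow> open (cimage c)"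
  and chart_homeomorphism: "c \<in> A \<Longrightarrow> homeomorphism (cdom c) (cimage c) (coord c) (param c)"
  and transition_smooth: "\<lbrakk>c \<in> A; c' \<in> A\<rbrakk> \<Longrightarrow> smooth_on (coord c ` (cdom c \<inter> cdom c')) (coord c' \<circ> param c)"
  using smooth_atlas unfolding smooth_atlas_def by blast+

lemma charts_atD: "c \<in> charts_at A p \<Longrightarrow> c \<in> A" "c \<in> charts_at A p \<Longrightarrow> p \<in> cdom c"
  by (auto simp: charts_at_def)

lemma chart_at_in: "chart_at A p \<in> charts_at A p"
proof -
  have "p \<in> (\<Union>c\<in>A. cdom c)" using smooth_atlas by (simp add: smooth_atlas_def)
  then have "\<exists>c. c \<in> charts_at A p" by (auto simp: charts_at_def)
  then show ?thesis unfolding chart_at_def by (rule someI_ex)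
qed

lemma param_coord: "\<lbrakk>c \<in> A; p \<in> cdom c\<rbrakk> \<Longrightarrow> param c (coord c p) = p"
  using chart_homeomorphism by (auto simp: homeomorphism_def)

lemma open_coord_image:
  assumes "c \<in> A" "open W"
  shows "open (coord c ` (W \<inter> cdom c))"
proof -
  have "openin (top_of_set (cimage c)) (coord c ` (W \<inter> cdom c))"
    by (rule homeomorphism_imp_open_map[OF chart_homeomorphism[OF assms(1)]])
      (use assms(2) in \<open>auto simp: openin_open\<close>)
  then show ?thesis using chart_open(2)[OF assms(1)] by (simp add: openin_open_eq)
qed

lemma coord_continuous: "c \<in> A \<Longrightarrow> continuous_on (cdom c) (coord c)"
  using chart_homeomorphism by (auto simp: homeomorphism_def)

lemma transition_has_derivative:
  assumes "c \<in> charts_at A p" "c' \<in> charts_at A p"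
  shows "((coord c' \<circ> param c) has_derivative change_deriv c c' p) (at (coord c p))"
  unfolding change_deriv_def
  by (rule smooth_on_has_derivative[OF transition_smooth]) (use assms charts_atD in blast)+

lemma linear_change_deriv: "\<lbrakk>c \<in> charts_at A p; c' \<in> charts_at A p\<rbrakk> \<Longrightarrow> linear (change_deriv c c' p)"
  by (rule has_derivative_linear[OF transition_has_derivative])

lemma tangent_of_self:
  assumes "c \<in> charts_at A p" shows "tangent_of A p c a c = a"
  unfolding tangent_of_def change_deriv_compose(2)[OF smooth_atlas assms assms assms]
  using assms by simp

lemma tangent_of_component:
  assumes "v \<in> tangent_space A p" "c \<in> charts_at A p"
  shows "tangent_of A p c (v c) = v"
proof -
  have inj: "inj_on (\<lambda>v. v c) (tangent_space A p)"
    using bij_betw_tangent_space[OF smooth_atlas assms(2)] by (rule bij_betw_imp_inj_on)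
  show ?thesis
    by (rule inj_onD[OF inj _ tangent_of_in_tangent_space[OF smooth_atlas assms(2)] assms(1)])
      (rule tangent_of_self[OF assms(2)])
qed

lemma scale_tangent_of: "c \<in> charts_at A p \<Longrightarrow> scale_tangent t (tangent_of A p c a)
  = tangent_of A p c (t *\<^sub>R a)"
  using linear_change_deriv by (auto simp: scale_tangent_def tangent_of_def fun_eq_iff linear_scale)

lemma metric_tangent_of:
  "c \<in> charts_at A p \<Longrightarrow> g p (tangent_of A p c a) (tangent_of A p c b) = metric_at c (coord c p) a b"
  by (simp add: metric_in_chart_def form_in_chart_def param_coord charts_atD)

lemma metric_field_chart:
  assumes "c \<in> A" shows "metric_field (cimage c) (metric_at c)"
proof
  have sp: "scalar_product (metric_at c x)" if "x \<in> cimage c" for x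
    using semi_riemannian assms that by (auto simp: semi_riemannian_def)
  show "open (cimage c)" by (rule chart_open(2)[OF assms])
  show "scalar_product (metric_at c x)" if "x \<in> cimage c" for x by (rule sp[OF that])
  show "bilinear (metric_at c x)" if "x \<in> cimage c" for x
    by (rule scalar_product_bilinear[OF sp[OF that]])
  show "smooth_on (cimage c) (\<lambda>x. metric_at c x u v)" for u v
    using semi_riemannian assms by (auto simp: semi_riemannian_def)
qed

lemma christoffel_eq: "christoffel A g c = koszul (metric_at c)"
  by (simp add: fun_eq_iff christoffel_def koszul_def bderiv_def)

lemma curvature_in_chart_eq: "curvature_in_chart A g c = riem (metric_at c)"
  by (simp add: fun_eq_iff curvature_in_chart_def riem_def bderiv_def cov_deriv_def[abs_def] christoffel_eq)

lemma hessian_in_chart_eq: "hessian_in_chart A g c = hess (metric_at c)"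
  by (simp add: fun_eq_iff hessian_in_chart_def hess_def cov_deriv_def christoffel_eq)

lemma has_derivative_change_chart:
  fixes F :: "'a::real_normed_vector \<Rightarrow> 'm"
  assumes c: "c \<in> charts_at A (F x)" "c' \<in> charts_at A (F x)" and F: "isCont F x"
    and D: "((coord c \<circ> F) has_derivative D) (at x)"
  shows "((coord c' \<circ> F) has_derivative (\<lambda>h. change_deriv c c' (F x) (D h))) (at x)"
proof -
  have *: "((coord c' \<circ> param c \<circ> (coord c \<circ> F)) has_derivative change_deriv c c' (F x) \<circ> D) (at x)"
    using diff_chain_at[OF D, of "coord c' \<circ> param c" "change_deriv c c' (F x)"]
      transition_has_derivative[OF c]
    by simp
  have "\<forall>\<^sub>F y in at x. F y \<in> cdom c"
    using F chart_open(1)[OF charts_atD(1)[OF c(1)]] charts_atD(2)[OF c(1)]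
    by (auto simp: isCont_def dest: topological_tendstoD)
  then have ev: "\<forall>\<^sub>F y in at x. (coord c' \<circ> param c \<circ> (coord c \<circ> F)) y = (coord c' \<circ> F) y"
    by eventually_elim (simp add: param_coord charts_atD(1)[OF c(1)])
  show ?thesis
    using has_derivative_transform_eventually[OF * ev]
    by (simp add: o_def param_coord charts_atD[OF c(1)])
qed

lemma velocity_eq:
  assumes c: "c \<in> charts_at A (\<gamma> t)" and \<gamma>: "isCont \<gamma> t"
    and D: "((coord c \<circ> \<gamma>) has_vector_derivative w) (at t)"
  shows "velocity A \<gamma> t = tangent_of A (\<gamma> t) c w"
proof
  fix c'
  show "velocity A \<gamma> t c' = tangent_of A (\<gamma> t) c w c'"
  proof (cases "c' \<in> charts_at A (\<gamma> t)")
    case True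
    have "((coord c' \<circ> \<gamma>) has_vector_derivative change_deriv c c' (\<gamma> t) w) (at t)"
      using has_derivative_change_chart[where F = \<gamma>, OF c True \<gamma> D[unfolded has_vector_derivative_def]]
        linear_scale[OF linear_change_deriv[OF c True]]
      by (simp add: has_vector_derivative_def)
    then show ?thesis
      using True by (simp add: velocity_def tangent_of_def vector_derivative_at)
  qed (simp add: velocity_def tangent_of_def)
qed

lemma geodesic_onD:
  assumes "geodesic_on A g I \<gamma>" "t \<in> I"
  shows "open I" "is_interval I" "continuous_on I \<gamma>" "isCont \<gamma> t"
  using assms by (auto simp: geodesic_on_def continuous_on_eq_continuous_at)

lemma geodesic_equation:
  assumes "geodesic_on A g I \<gamma>" "t \<in> I" "c \<in> charts_at A (\<gamma> t)"
  shows "((coord c \<circ> \<gamma>) has_vector_derivative vector_derivative (coord c \<circ> \<gamma>) (at t)) (at t)"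
    and "((\<lambda>s. vector_derivative (coord c \<circ> \<gamma>) (at s)) has_vector_derivative
       - koszul (metric_at c) (coord c (\<gamma> t)) (vector_derivative (coord c \<circ> \<gamma>) (at t))
           (vector_derivative (coord c \<circ> \<gamma>) (at t))) (at t)"
  using assms by (auto simp: geodesic_on_def Let_def vector_derivative_works[symmetric] christoffel_eq)

lemma geodesic_velocity:
  assumes "geodesic_on A g I \<gamma>" "t \<in> I" "c \<in> charts_at A (\<gamma> t)"
  shows "velocity A \<gamma> t = tangent_of A (\<gamma> t) c (vector_derivative (coord c \<circ> \<gamma>) (at t))"
  by (rule velocity_eq[OF assms(3) geodesic_onD(4)[OF assms(1,2)] geodesic_equation(1)[OF assms]])

lemma geodesic_field_smooth:
  assumes "c \<in> A"
  shows "smooth_on (cimage c \<times> UNIV) (\<lambda>p. (snd p, - koszul (metric_at c) (fst p) (snd p) (snd p)))"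
proof -
  interpret metric_field "cimage c" "metric_at c" by (rule metric_field_chart[OF assms])
  have op: "open (cimage c \<times> (UNIV :: 'e set))" by (intro open_Times open_S open_UNIV)
  have sm: "smooth_on (cimage c \<times> (UNIV :: 'e set)) (\<lambda>p. fst p)"
      "smooth_on (cimage c \<times> (UNIV :: 'e set)) (\<lambda>p. snd p)"
    by (simp_all add: smooth_on_def Ck_on_bounded_linear bounded_linear_fst bounded_linear_snd)
  have "smooth_on (cimage c \<times> UNIV) (\<lambda>p. koszul (metric_at c) (fst p) (snd p) (snd p))"
    by (rule Chr.smooth_args[OF op sm(1) _ sm(2) sm(2)]) auto
  then have "smooth_on (cimage c \<times> UNIV) (\<lambda>p. (0::'e, - koszul (metric_at c) (fst p) (snd p) (snd p)))"
    by (rule smooth_on_linear_compose[where L = "\<lambda>a. (0, - a)", OF op, rotated])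
      (intro bounded_linear_Pair bounded_linear_zero bounded_linear_minus bounded_linear_ident)
  moreover have "smooth_on (cimage c \<times> UNIV) (\<lambda>p. (snd p :: 'e, 0::'e))"
    by (rule smooth_on_linear_compose[where L = "\<lambda>a. (a, 0)", OF op _ sm(2)])
      (intro bounded_linear_Pair bounded_linear_zero bounded_linear_ident)
  ultimately have "smooth_on (cimage c \<times> UNIV)
      (\<lambda>p. (snd p, 0::'e) + (0::'e, - koszul (metric_at c) (fst p) (snd p) (snd p)))"
    by (intro smooth_on_add op)
  then show ?thesis by simp
qed

text \<open>In a chart, position and velocity together solve a smooth system of first order.\<close>

lemma geodesic_unique_locally:
  assumes \<gamma>1: "geodesic_on A g I \<gamma>1" "t0 \<in> I" and \<gamma>2: "geodesic_on A g J \<gamma>2" "t0 \<in> J"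
    and init: "\<gamma>1 t0 = \<gamma>2 t0" "velocity A \<gamma>1 t0 = velocity A \<gamma>2 t0"
  shows "\<exists>\<delta>>0. \<forall>t. \<bar>t - t0\<bar> < \<delta> \<longrightarrow> \<gamma>1 t = \<gamma>2 t \<and> velocity A \<gamma>1 t = velocity A \<gamma>2 t"
proof -
  define c where "c = chart_at A (\<gamma>1 t0)"
  have c: "c \<in> charts_at A (\<gamma>1 t0)" "c \<in> charts_at A (\<gamma>2 t0)" using chart_at_in init(1)
    by (auto simp: c_def)
  note cA = charts_atD(1)[OF c(1)]
  define N where "N = (I \<inter> \<gamma>1 -` cdom c) \<inter> (J \<inter> \<gamma>2 -` cdom c)"
  have "open (I \<inter> \<gamma>1 -` cdom c)" "open (J \<inter> \<gamma>2 -` cdom c)"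
    using geodesic_onD[OF \<gamma>1] geodesic_onD[OF \<gamma>2] chart_open(1)[OF cA] continuous_open_preimage by blast+
  then have N: "open N" "t0 \<in> N"
    unfolding N_def using \<gamma>1(2) \<gamma>2(2) charts_atD(2)[OF c(1)] charts_atD(2)[OF c(2)] by auto
  let ?v1 = "\<lambda>t. vector_derivative (coord c \<circ> \<gamma>1) (at t)"
  let ?v2 = "\<lambda>t. vector_derivative (coord c \<circ> \<gamma>2) (at t)"
  let ?f = "\<lambda>p. (snd p, - koszul (metric_at c) (fst p) (snd p) (snd p))"
  have Nc: "c \<in> charts_at A (\<gamma>1 t)" "c \<in> charts_at A (\<gamma>2 t)" "t \<in> I" "t \<in> J" if "t \<in> N" for t
    using that cA by (auto simp: N_def charts_at_def)
  have "\<exists>\<delta>>0. \<forall>t. \<bar>t - t0\<bar> < \<delta> \<longrightarrow> ((coord c \<circ> \<gamma>1) t, ?v1 t) = ((coord c \<circ> \<gamma>2) t, ?v2 t)"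
  proof (rule ode_unique_locally[OF _ geodesic_field_smooth[OF cA] _ _ N])
    show "open (cimage c \<times> (UNIV :: 'e set))" by (intro open_Times chart_open(2)[OF cA] open_UNIV)
    have "?v1 t0 = ?v2 t0"
      using fun_cong[OF init(2), of c] c by (simp add: velocity_def)
    then show "((coord c \<circ> \<gamma>1) t0, ?v1 t0) = ((coord c \<circ> \<gamma>2) t0, ?v2 t0)"
      using init(1) by simp
    show "((coord c \<circ> \<gamma>1) t0, ?v1 t0) \<in> cimage c \<times> UNIV" using charts_atD(2)[OF c(1)] by auto
    fix t assume t: "t \<in> N"
    show "((\<lambda>t. ((coord c \<circ> \<gamma>1) t, ?v1 t)) has_vector_derivative ?f ((coord c \<circ> \<gamma>1) t, ?v1 t)) (at t)"
      using has_vector_derivative_Pair[OF geodesic_equation[OF \<gamma>1(1) Nc(3,1)[OF t]]] by simp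
    show "((\<lambda>t. ((coord c \<circ> \<gamma>2) t, ?v2 t)) has_vector_derivative ?f ((coord c \<circ> \<gamma>2) t, ?v2 t)) (at t)"
      using has_vector_derivative_Pair[OF geodesic_equation[OF \<gamma>2(1) Nc(4,2)[OF t]]] by simp
  qed
  then obtain \<delta>1 where \<delta>1: "\<delta>1 > 0" "\<And>t. \<bar>t - t0\<bar> < \<delta>1 \<Longrightarrow> coord c (\<gamma>1 t) = coord c (\<gamma>2 t) \<and> ?v1 t = ?v2 t"
    by auto
  obtain \<delta>2 where \<delta>2: "\<delta>2 > 0" "ball t0 \<delta>2 \<subseteq> N" using N open_contains_ball by blast
  have "\<gamma>1 t = \<gamma>2 t \<and> velocity A \<gamma>1 t = velocity A \<gamma>2 t" if t: "\<bar>t - t0\<bar> < min \<delta>1 \<delta>2" for t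
  proof -
    have "t \<in> N" using \<delta>2(2) t by (auto simp: dist_real_def abs_minus_commute)
    note tc = Nc[OF this]
    have d: "coord c (\<gamma>1 t) = coord c (\<gamma>2 t)" "?v1 t = ?v2 t" using \<delta>1(2)[of t] t by auto
    have "\<gamma>1 t = param c (coord c (\<gamma>1 t))" by (rule param_coord[OF cA charts_atD(2)[OF tc(1)], symmetric])
    also have "\<dots> = \<gamma>2 t" unfolding d by (rule param_coord[OF cA charts_atD(2)[OF tc(2)]])
    finally have eq: "\<gamma>1 t = \<gamma>2 t" .
    have "velocity A \<gamma>1 t = tangent_of A (\<gamma>1 t) c (?v1 t)" by (rule geodesic_velocity[OF \<gamma>1(1) tc(3,1)])
    also have "\<dots> = velocity A \<gamma>2 t"
      unfolding d eq by (rule geodesic_velocity[OF \<gamma>2(1) tc(4,2), symmetric])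
    finally show ?thesis using eq by blast
  qed
  then show ?thesis using \<delta>1(1) \<delta>2(1) by (intro exI[of _ "min \<delta>1 \<delta>2"]) auto
qed

text \<open>The times at which the two geodesics have the same position and velocity form a subset
  of \<open>[0,1]\<close> that is open by local uniqueness and closed by continuity and the Hausdorff
  property.\<close>

lemma geodesic_unique:
  assumes \<gamma>1: "geodesic_on A g I \<gamma>1" "{0..1} \<subseteq> I" and \<gamma>2: "geodesic_on A g J \<gamma>2" "{0..1} \<subseteq> J"
    and init: "\<gamma>1 0 = \<gamma>2 0" "velocity A \<gamma>1 0 = velocity A \<gamma>2 0" and t: "t \<in> {0..1}"
  shows "\<gamma>1 t = \<gamma>2 t"
proof -
  define T where "T = {t \<in> {0..1}. \<gamma>1 t = \<gamma>2 t \<and> velocity A \<gamma>1 t = velocity A \<gamma>2 t}"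
  have "openin (top_of_set {0..1}) T"
    unfolding openin_euclidean_subtopology_iff
  proof (intro conjI ballI)
    fix s assume s: "s \<in> T"
    then have sI: "s \<in> I" "s \<in> J" using \<gamma>1(2) \<gamma>2(2) by (auto simp: T_def)
    obtain \<delta> where "\<delta> > 0" "\<And>t. \<bar>t - s\<bar> < \<delta> \<Longrightarrow> \<gamma>1 t = \<gamma>2 t \<and> velocity A \<gamma>1 t = velocity A \<gamma>2 t"
      using geodesic_unique_locally[OF \<gamma>1(1) sI(1) \<gamma>2(1) sI(2)] s unfolding T_def by blast
    then show "\<exists>e>0. \<forall>x'\<in>{0..1}. dist x' s < e \<longrightarrow> x' \<in> T"
      by (intro exI[of _ \<delta>]) (auto simp: T_def dist_real_def)
  qed (auto simp: T_def)
  moreover have "closed T"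
    unfolding closed_sequential_limits
  proof (intro allI impI, elim conjE)
    fix s l assume sT: "\<forall>n. s n \<in> T" and lim: "s \<longlonglongrightarrow> l"
    have "l \<in> {0..1}"
      using closed_sequentially[OF closed_atLeastAtMost _ lim, of 0 1] sT by (auto simp: T_def)
    then have l: "l \<in> I" "l \<in> J" using \<gamma>1(2) \<gamma>2(2) by auto
    note cont = geodesic_onD(4)[OF \<gamma>1(1) l(1)] geodesic_onD(4)[OF \<gamma>2(1) l(2)]
    have lim1: "(\<lambda>n. \<gamma>1 (s n)) \<longlonglongrightarrow> \<gamma>1 l" and lim2: "(\<lambda>n. \<gamma>2 (s n)) \<longlonglongrightarrow> \<gamma>2 l"
      using cont lim by (auto intro: isCont_tendsto_compose)
    moreover have s_eq: "\<gamma>1 (s n) = \<gamma>2 (s n)" "velocity A \<gamma>1 (s n) = velocity A \<gamma>2 (s n)" for n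
      using sT by (auto simp: T_def)
    ultimately have eq: "\<gamma>1 l = \<gamma>2 l" using LIMSEQ_unique by fastforce
    define c where "c = chart_at A (\<gamma>1 l)"
    have c: "c \<in> charts_at A (\<gamma>1 l)" "c \<in> charts_at A (\<gamma>2 l)" using chart_at_in eq by (auto simp: c_def)
    let ?v1 = "\<lambda>t. vector_derivative (coord c \<circ> \<gamma>1) (at t)"
    let ?v2 = "\<lambda>t. vector_derivative (coord c \<circ> \<gamma>2) (at t)"
    have v1: "(\<lambda>n. ?v1 (s n)) \<longlonglongrightarrow> ?v1 l"
      using has_vector_derivative_continuous[OF geodesic_equation(2)[OF \<gamma>1(1) l(1) c(1)]] lim
      by (rule isCont_tendsto_compose)
    have v2: "(\<lambda>n. ?v2 (s n)) \<longlonglongrightarrow> ?v2 l"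
      using has_vector_derivative_continuous[OF geodesic_equation(2)[OF \<gamma>2(1) l(2) c(2)]] lim
      by (rule isCont_tendsto_compose)
    have "\<forall>\<^sub>F n in sequentially. \<gamma>1 (s n) \<in> cdom c"
      using topological_tendstoD[OF lim1 chart_open(1)[OF charts_atD(1)[OF c(1)]] charts_atD(2)[OF c(1)]] .
    then have ev: "\<forall>\<^sub>F n in sequentially. ?v1 (s n) = ?v2 (s n)"
    proof eventually_elim
      case (elim n)
      then have "c \<in> charts_at A (\<gamma>1 (s n))" "c \<in> charts_at A (\<gamma>2 (s n))"
        using charts_atD(1)[OF c(1)] s_eq(1)[of n] by (auto simp: charts_at_def)
      then show ?case using fun_cong[OF s_eq(2)[of n], of c] by (simp add: velocity_def)
    qed
    have "?v1 l = ?v2 l"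
      using LIMSEQ_unique[OF v1] v2 tendsto_cong[OF ev] by blast
    then have "velocity A \<gamma>1 l = velocity A \<gamma>2 l"
      unfolding geodesic_velocity[OF \<gamma>1(1) l(1) c(1)] geodesic_velocity[OF \<gamma>2(1) l(2) c(2)]
      by (simp only: eq)
    then show "l \<in> T" using eq \<open>l \<in> {0..1}\<close> by (simp add: T_def)
  qed
  then have "closedin (top_of_set {0..1}) T"
    by (intro closed_subset) (auto simp: T_def)
  moreover have "0 \<in> T" using init by (simp add: T_def)
  ultimately have "T = {0..1}"
    using connected_clopen[of "{0..1::real}"] connected_Icc[of "0::real" 1] by blast
  then have "t \<in> T" using t by simp
  then show ?thesis by (simp add: T_def)
qed

lemma exp_map_eq:
  assumes "exp_curve A g q v \<gamma>"
  shows "exp_map A g q v = \<gamma> 1"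
  unfolding exp_map_def
proof (rule the_equality)
  show "\<exists>\<gamma>'. exp_curve A g q v \<gamma>' \<and> \<gamma>' 1 = \<gamma> 1" using assms by blast
  fix p assume "\<exists>\<gamma>'. exp_curve A g q v \<gamma>' \<and> \<gamma>' 1 = p"
  then obtain \<gamma>' where \<gamma>': "exp_curve A g q v \<gamma>'" "\<gamma>' 1 = p" by blast
  obtain I J where I: "geodesic_on A g I \<gamma>'" "{0..1} \<subseteq> I" and J: "geodesic_on A g J \<gamma>" "{0..1} \<subseteq> J"
    using \<gamma>'(1) assms unfolding exp_curve_def by blast
  have "\<gamma>' 1 = \<gamma> 1"
    by (rule geodesic_unique[OF I J]) (use \<gamma>'(1) assms in \<open>simp_all add: exp_curve_def\<close>)
  then show "p = \<gamma> 1" using \<gamma>'(2) by simp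
qed

lemma exp_curve_scale:
  assumes \<gamma>: "exp_curve A g q v \<gamma>" and t: "t \<in> {0..1}"
  shows "exp_curve A g q (scale_tangent t v) (\<lambda>s. \<gamma> (t * s))"
proof -
  obtain I where I: "{0..1} \<subseteq> I" "geodesic_on A g I \<gamma>" and q: "\<gamma> 0 = q" "velocity A \<gamma> 0 = v"
    using \<gamma> by (auto simp: exp_curve_def)
  have I0: "0 \<in> I" using I(1) by auto
  define I' where "I' = (\<lambda>s. t * s) -` I"
  have "open I'" unfolding I'_def by (intro open_vimage geodesic_onD(1)[OF I(2) I0] continuous_intros)
  have der: "((coord c \<circ> (\<lambda>s. \<gamma> (t * s))) has_vector_derivative t *\<^sub>R vector_derivative (coord c \<circ> \<gamma>)
    (at (t * s))) (at s)"
    if "s \<in> I'" "c \<in> charts_at A (\<gamma> (t * s))" for s c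
  proof -
    have "((\<lambda>s. t * s) has_vector_derivative t) (at s)"
      by (auto intro!: derivative_eq_intros simp: has_vector_derivative_def)
    from vector_diff_chain_at[OF this, of "coord c \<circ> \<gamma>"] geodesic_equation(1)[OF I(2) _ that(2)] that(1)
    show ?thesis by (simp add: I'_def o_def)
  qed
  have cont: "continuous_on I' (\<lambda>s. \<gamma> (t * s))"
    by (rule continuous_on_compose2[OF geodesic_onD(3)[OF I(2) I0]]) (auto simp: I'_def intro!:
      continuous_intros)
  have "geodesic_on A g I' (\<lambda>s. \<gamma> (t * s))"
    unfolding geodesic_on_def Let_def
  proof (intro conjI ballI)
    show "is_interval I'"
      unfolding is_interval_1
    proof (intro ballI allI impI)
      fix a b x assume ab: "a \<in> I'" "b \<in> I'" "a \<le> x \<and> x \<le> b"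
      then have "t * a \<le> t * x" "t * x \<le> t * b" using t by (auto intro: mult_left_mono)
      then have "t * x \<in> I"
        using geodesic_onD(2)[OF I(2) I0] ab(1,2) unfolding is_interval_1 I'_def by blast
      then show "x \<in> I'" by (simp add: I'_def)
    qed
    fix s c assume s: "s \<in> I'" and c: "c \<in> charts_at A (\<gamma> (t * s))"
    note cA = charts_atD(1)[OF c]
    interpret metric_field "cimage c" "metric_at c" by (rule metric_field_chart[OF cA])
    let ?x = "coord c \<circ> \<gamma>"
    show "(coord c \<circ> (\<lambda>s. \<gamma> (t * s))) differentiable at s"
      using der[OF s c] by (auto simp: has_vector_derivative_def differentiable_def)
    define N where "N = I' \<inter> (\<lambda>s. \<gamma> (t * s)) -` cdom c"
    have N: "open N" "s \<in> N"
      unfolding N_def using s charts_atD(2)[OF c]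
        continuous_open_preimage[OF cont \<open>open I'\<close> chart_open(1)[OF cA]] by auto
    have ts: "t * s \<in> I" using s by (simp add: I'_def)
    have x: "coord c (\<gamma> (t * s)) \<in> cimage c" using charts_atD(2)[OF c] by auto
    have "((\<lambda>s. t * s) has_vector_derivative t) (at s)"
      by (auto intro!: derivative_eq_intros simp: has_vector_derivative_def)
    from vector_diff_chain_at[OF this geodesic_equation(2)[OF I(2) ts c]]
    have "((\<lambda>s. t *\<^sub>R vector_derivative ?x (at (t * s))) has_vector_derivative
       t *\<^sub>R (t *\<^sub>R - koszul (metric_at c) (coord c (\<gamma> (t * s))) (vector_derivative ?x (at (t * s)))
         (vector_derivative ?x (at (t * s))))) (at s)"
      by (intro bounded_linear.has_vector_derivative[OF bounded_linear_scaleR_right]) (simp add: o_def)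
    then have "((\<lambda>s. vector_derivative (coord c \<circ> (\<lambda>s. \<gamma> (t * s))) (at s)) has_vector_derivative
       t *\<^sub>R (t *\<^sub>R - koszul (metric_at c) (coord c (\<gamma> (t * s))) (vector_derivative ?x (at (t * s)))
         (vector_derivative ?x (at (t * s))))) (at s)"
    proof (rule has_vector_derivative_transform_within_open[OF _ N])
      fix r assume r: "r \<in> N"
      then have "c \<in> charts_at A (\<gamma> (t * r))" "r \<in> I'" using cA by (auto simp: N_def charts_at_def)
      then show "t *\<^sub>R vector_derivative ?x (at (t * r))
        = vector_derivative (coord c \<circ> (\<lambda>s. \<gamma> (t * s))) (at r)"
        using vector_derivative_at[OF der] by simp
    qed
    then show "((\<lambda>s. vector_derivative (coord c \<circ> (\<lambda>s. \<gamma> (t * s))) (at s)) has_vector_derivative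
      - christoffel A g c ((coord c \<circ> (\<lambda>s. \<gamma> (t * s))) s) (vector_derivative (coord c \<circ> (\<lambda>s. \<gamma> (t *
        s))) (at s))
         (vector_derivative (coord c \<circ> (\<lambda>s. \<gamma> (t * s))) (at s))) (at s)"
      by (simp add: vector_derivative_at[OF der[OF s c]] christoffel_eq bilinear_expand[OF Chr.bil[OF x]])
  qed (use \<open>open I'\<close> cont in auto)
  moreover have "{0..1} \<subseteq> I'"
  proof
    fix s :: real assume "s \<in> {0..1}"
    then have "t * s \<in> {0..1}" using t by (auto simp: mult_le_one)
    then show "s \<in> I'" using I(1) by (auto simp: I'_def)
  qed
  moreover have "velocity A (\<lambda>s. \<gamma> (t * s)) 0 = scale_tangent t v"
    using der[of 0] I0 by (auto simp: fun_eq_iff velocity_def scale_tangent_def I'_def q(2)[symmetric]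
      vector_derivative_at)
  ultimately show ?thesis using q(1) by (auto simp: exp_curve_def)
qed

lemma exp_map_ray:
  assumes "exp_curve A g q v \<gamma>" "t \<in> {0..1}"
  shows "exp_map A g q (scale_tangent t v) = \<gamma> t"
  using exp_map_eq[OF exp_curve_scale[OF assms]] by simp

end

section \<open>The exponential chart\<close>

lemma hess_cong:
  assumes "open P" "x \<in> P" "\<And>y. y \<in> P \<Longrightarrow> f y = h y"
  shows "hess b f x u v = hess b h x u v"
proof -
  have 1: "fderiv f y = fderiv h y" if "y \<in> P" for y
    by (rule fderiv_cong_open[OF assms(1) that assms(3)])
  then have "fderiv (\<lambda>y. fderiv f y v) x = fderiv (\<lambda>y. fderiv h y v) x"
    by (intro fderiv_cong_open[OF assms(1,2)]) simp
  then show ?thesis by (simp add: hess_def 1[OF assms(2)])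
qed

locale exponential_chart = semi_riemannian_manifold A g
  for A :: "('m::{t2_space, second_countable_topology}, 'e::euclidean_space) chart set"
    and g :: "('m, 'e) metric" +
  fixes q :: 'm and \<Omega> :: "('m, 'e) tangent set" and U :: "'m set"
  assumes star_region: "star_region A q \<Omega>"
    and exp_diffeo: "exp_diffeo A g q \<Omega> U"
begin

text \<open>The component in the chart \<open>c0\<close> identifies the tangent space at \<open>q\<close> with \<open>'e\<close>. In
  these terms \<open>S\<close> is the star-shaped region, \<open>F\<close> the exponential map and \<open>L\<close> its inverse;
  \<open>push x\<close> is the derivative of \<open>F\<close> at \<open>x\<close>, and \<open>b\<close> is the pulled back metric.\<close>

definition c0 :: "('m, 'e) chart" where "c0 = chart_at A q"
definition S :: "'e set" where "S = (\<lambda>v. v c0) ` \<Omega>"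
definition F :: "'e \<Rightarrow> 'm" where "F x = exp_map A g q (tangent_of A q c0 x)"
definition L :: "'m \<Rightarrow> 'e" where "L p = inv_into \<Omega> (exp_map A g q) p c0"
definition region :: "('m, 'e) chart \<Rightarrow> 'e set" where "region c = S \<inter> F -` cdom c"
abbreviation "DF c \<equiv> fderiv (coord c \<circ> F)"
definition push :: "'e \<Rightarrow> 'e \<Rightarrow> ('m, 'e) tangent" where
  "push x u = (\<lambda>c. if c \<in> charts_at A (F x) then DF c x u else 0)"
definition b :: "'e \<Rightarrow> 'e \<Rightarrow> 'e \<Rightarrow> real" where
  "b x u w = g (F x) (push x u) (push x w)"

lemma c0_in: "c0 \<in> charts_at A q"
  unfolding c0_def by (rule chart_at_in)

lemma open_S: "open S" and zero_in_S: "0 \<in> S" and star_S: "\<lbrakk>x \<in> S; t \<in> {0..1}\<rbrakk> \<Longrightarrow> t *\<^sub>R x \<in> S"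
proof -
  have *: "open S" "0 \<in> S" "\<forall>x\<in>S. closed_segment 0 x \<subseteq> S"
    using star_region c0_in unfolding star_region_def S_def Let_def by blast+
  then show "open S" "0 \<in> S" by auto
  show "t *\<^sub>R x \<in> S" if "x \<in> S" "t \<in> {0..1}"
    using *(3) that unfolding closed_segment_def by force
qed

lemma Omega_tangent: "\<Omega> \<subseteq> tangent_space A q"
  using star_region by (simp add: star_region_def)

lemma tangent_of_S: "x \<in> S \<Longrightarrow> tangent_of A q c0 x \<in> \<Omega>"
  using Omega_tangent tangent_of_component[OF _ c0_in] by (auto simp: S_def)

lemma bij_exp: "bij_betw (exp_map A g q) \<Omega> U"
  using exp_diffeo by (simp add: exp_diffeo_def)

lemma open_U: "open U"
  using exp_diffeo by (simp add: exp_diffeo_def)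

lemma F_in_U: "x \<in> S \<Longrightarrow> F x \<in> U"
  unfolding F_def using bij_betwE[OF bij_exp] tangent_of_S by blast

lemma L_F: "x \<in> S \<Longrightarrow> L (F x) = x"
  unfolding F_def L_def
  by (simp add: inv_into_f_f[OF bij_betw_imp_inj_on[OF bij_exp] tangent_of_S] tangent_of_self[OF c0_in])

lemma inv_exp: "p \<in> U \<Longrightarrow> inv_into \<Omega> (exp_map A g q) p \<in> \<Omega>"
  using bij_betwE[OF bij_betw_inv_into[OF bij_exp]] by blast

lemma tangent_of_L: "p \<in> U \<Longrightarrow> tangent_of A q c0 (L p) = inv_into \<Omega> (exp_map A g q) p"
  unfolding L_def using tangent_of_component[OF _ c0_in] inv_exp Omega_tangent by blast

lemma L_in_S: "p \<in> U \<Longrightarrow> L p \<in> S"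
  unfolding L_def S_def using inv_exp by blast

lemma F_L: "p \<in> U \<Longrightarrow> F (L p) = p"
  unfolding F_def by (simp add: tangent_of_L bij_betw_inv_into_right[OF bij_exp])

lemma continuous_F: "continuous_on S F"
  and smooth_F: "c \<in> A \<Longrightarrow> smooth_on (region c) (coord c \<circ> F)"
  using exp_diffeo c0_in unfolding exp_diffeo_def smooth_into_def S_def region_def F_def[abs_def] by blast+

lemma smooth_L: "c \<in> A \<Longrightarrow> smooth_on (coord c ` (U \<inter> cdom c)) (L \<circ> param c)"
  using exp_diffeo c0_in unfolding exp_diffeo_def smooth_from_def L_def[abs_def] by blast

lemma isCont_F: "x \<in> S \<Longrightarrow> isCont F x"
  using continuous_F open_S by (simp add: continuous_on_eq_continuous_at)

lemma open_region: "c \<in> A \<Longrightarrow> open (region c)"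
  unfolding region_def by (rule continuous_open_preimage[OF continuous_F open_S chart_open(1)])

lemma regionI: "\<lbrakk>x \<in> S; c \<in> charts_at A (F x)\<rbrakk> \<Longrightarrow> x \<in> region c"
  by (simp add: region_def charts_atD)

lemma F_has_derivative:
  "\<lbrakk>x \<in> S; c \<in> charts_at A (F x)\<rbrakk> \<Longrightarrow> ((coord c \<circ> F) has_derivative DF c x) (at x)"
  by (rule smooth_on_has_derivative[OF smooth_F[OF charts_atD(1)] regionI])

lemma push_eq:
  assumes "x \<in> S" "c \<in> charts_at A (F x)"
  shows "push x u = tangent_of A (F x) c (DF c x u)"
proof
  fix c'
  show "push x u c' = tangent_of A (F x) c (DF c x u) c'"
    using fderiv_eqI[OF has_derivative_change_chart[where F = F, OF assms(2) _ isCont_F[OF assms(1)] F_has_derivative[OF assms]], of c']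
    by (simp add: push_def tangent_of_def)
qed

lemma b_chart:
  assumes "x \<in> S" "c \<in> charts_at A (F x)"
  shows "b x u w = metric_at c (coord c (F x)) (DF c x u) (DF c x w)"
  unfolding b_def push_eq[OF assms] by (rule metric_tangent_of[OF assms(2)])

lemma region_chart: "c \<in> A \<Longrightarrow> x \<in> region c \<Longrightarrow> x \<in> S \<and> c \<in> charts_at A (F x)"
  by (simp add: region_def charts_at_def)

text \<open>The derivative of \<open>F\<close> is injective because \<open>L\<close> is a smooth left inverse.\<close>

lemma local_isometry_chart:
  assumes c: "c \<in> A"
  shows "local_isometry (cimage c) (metric_at c) (region c) (coord c \<circ> F) b"
proof -
  interpret metric_field "cimage c" "metric_at c" by (rule metric_field_chart[OF c])
  show ?thesis
  proof
    show "open (region c)" by (rule open_region[OF c])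
    show "smooth_on (region c) (coord c \<circ> F)" by (rule smooth_F[OF c])
    show "(coord c \<circ> F) ` region c \<subseteq> cimage c" by (auto simp: region_def)
    fix x assume x: "x \<in> region c"
    note xc = conjunct1[OF region_chart[OF c x]] conjunct2[OF region_chart[OF c x]]
    show "b x u v = metric_at c ((coord c \<circ> F) x) (DF c x u) (DF c x v)" for u v
      using b_chart[OF xc] by simp
    let ?y = "coord c (F x)"
    have "?y \<in> coord c ` (U \<inter> cdom c)" using F_in_U[OF xc(1)] charts_atD(2)[OF xc(2)] by blast
    then have DL: "((L \<circ> param c) has_derivative fderiv (L \<circ> param c) ?y) (at ((coord c \<circ> F) x))"
      using smooth_on_has_derivative[OF smooth_L[OF c]] by simp
    have "((L \<circ> param c \<circ> (coord c \<circ> F)) has_derivative fderiv (L \<circ> param c) ?y \<circ> DF c x) (at x)"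
      by (rule diff_chain_at[OF F_has_derivative[OF xc] DL])
    moreover have "((L \<circ> param c \<circ> (coord c \<circ> F)) has_derivative (\<lambda>h. h)) (at x)"
      by (rule has_derivative_transform_within_open[OF has_derivative_ident open_region[OF c] x])
        (use region_chart[OF c] charts_atD(2) in \<open>simp add: param_coord[OF c] L_F\<close>)
    ultimately have eq: "fderiv (L \<circ> param c) ?y \<circ> DF c x = (\<lambda>h. h)"
      by (rule has_derivative_unique)
    show "inj (DF c x)"
      by (rule inj_on_inverseI[where g = "fderiv (L \<circ> param c) ?y"]) (use fun_cong[OF eq] in simp)
  qed
qed

lemma metric_field_b: "metric_field S b"
proof
  show "open S" by (rule open_S)
  fix x assume x: "x \<in> S"
  define c where "c = chart_at A (F x)"
  have c: "c \<in> charts_at A (F x)" unfolding c_def by (rule chart_at_in)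
  interpret I: local_isometry "cimage c" "metric_at c" "region c" "coord c \<circ> F" b
    by (rule local_isometry_chart[OF charts_atD(1)[OF c]])
  show "bilinear (b x)" "scalar_product (b x)"
    using I.c.bil[OF regionI[OF x c]] I.c.scalar_product[OF regionI[OF x c]] .
next
  show "smooth_on S (\<lambda>x. b x u v)" for u v
  proof (rule smooth_on_local)
    fix x assume x: "x \<in> S"
    define c where "c = chart_at A (F x)"
    have c: "c \<in> charts_at A (F x)" unfolding c_def by (rule chart_at_in)
    interpret I: local_isometry "cimage c" "metric_at c" "region c" "coord c \<circ> F" b
      by (rule local_isometry_chart[OF charts_atD(1)[OF c]])
    show "\<exists>T. open T \<and> x \<in> T \<and> smooth_on T (\<lambda>x. b x u v)"
      using I.c.smooth I.open_P regionI[OF x c] by blast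
  qed
qed

lemma ray_is_geodesic:
  assumes "x \<in> S"
  obtains \<gamma> I where "geodesic_on A g I \<gamma>" "{0..1} \<subseteq> I" "\<And>t. t \<in> {0..1} \<Longrightarrow> F (t *\<^sub>R x) = \<gamma> t"
proof -
  have "tangent_of A q c0 x \<in> exp_domain A g q"
    using exp_diffeo tangent_of_S[OF assms] by (auto simp: exp_diffeo_def)
  then obtain \<gamma> where \<gamma>: "exp_curve A g q (tangent_of A q c0 x) \<gamma>" by (auto simp: exp_domain_def)
  have "F (t *\<^sub>R x) = \<gamma> t" if "t \<in> {0..1}" for t
    using exp_map_ray[OF \<gamma> that] by (simp add: F_def scale_tangent_of[OF c0_in])
  then show thesis using that \<gamma> by (auto simp: exp_curve_def)
qed

lemma ray_vector_derivative:
  assumes "t *\<^sub>R x \<in> S" "c \<in> charts_at A (F (t *\<^sub>R x))"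
  shows "((\<lambda>t. (coord c \<circ> F) (t *\<^sub>R x)) has_vector_derivative DF c (t *\<^sub>R x) x) (at t)"
  by (rule has_vector_derivative_along_ray[OF F_has_derivative[OF assms]])

text \<open>That \<open>F (t v)\<close> runs along a geodesic is known only for \<open>t\<close> in \<open>[0,1]\<close>, whereas the
  geodesic equation involves two-sided derivatives. So \<open>x\<close> is reached at the interior time
  \<open>\<tau> = 1/k\<close> of the ray through a slightly longer vector \<open>v = k x\<close>.\<close>

lemma koszul_radial:
  assumes x: "x \<in> S"
  shows "koszul b x x x = 0"
proof -
  have "open ((\<lambda>s. s *\<^sub>R x) -` S)" by (intro open_vimage open_S continuous_intros)
  moreover have "1 \<in> (\<lambda>s. s *\<^sub>R x) -` S" using x by simp
  ultimately obtain e where e: "e > 0" "ball 1 e \<subseteq> (\<lambda>s. s *\<^sub>R x) -` S"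
    using open_contains_ball by blast
  define k where "k = 1 + e / 2"
  have k: "k > 1" "k *\<^sub>R x \<in> S" using e by (auto simp: k_def dist_real_def subset_iff)
  define v where "v = k *\<^sub>R x"
  define \<tau> where "\<tau> = 1 / k"
  have \<tau>: "0 < \<tau>" "\<tau> < 1" "x = \<tau> *\<^sub>R v" using k(1) by (auto simp: \<tau>_def v_def)
  obtain \<gamma> I where \<gamma>: "geodesic_on A g I \<gamma>" "{0..1} \<subseteq> I" "\<And>t. t \<in> {0..1} \<Longrightarrow> F (t *\<^sub>R v) = \<gamma> t"
    by (rule ray_is_geodesic[OF k(2)[folded v_def]]) (rule that)
  define c where "c = chart_at A (F x)"
  have c: "c \<in> charts_at A (F x)" unfolding c_def by (rule chart_at_in)
  note cA = charts_atD(1)[OF c]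
  interpret I: local_isometry "cimage c" "metric_at c" "region c" "coord c \<circ> F" b
    by (rule local_isometry_chart[OF cA])
  have xP: "x \<in> region c" by (rule regionI[OF x c])
  define N where "N = {0<..<1} \<inter> (\<lambda>s. s *\<^sub>R v) -` region c"
  have N: "open N" "\<tau> \<in> N"
    unfolding N_def using \<tau> xP by (auto intro!: open_Int open_vimage I.open_P continuous_intros)
  have \<gamma>N: "F (s *\<^sub>R v) = \<gamma> s" "s *\<^sub>R v \<in> S" "c \<in> charts_at A (F (s *\<^sub>R v))" "s \<in> I" if "s \<in> N" for s
    using that \<gamma>(3)[of s] \<gamma>(2) region_chart[OF cA, of "s *\<^sub>R v"] by (auto simp: N_def)
  have d1: "((coord c \<circ> \<gamma>) has_vector_derivative DF c (s *\<^sub>R v) v) (at s)" if "s \<in> N" for s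
    by (rule has_vector_derivative_transform_within_open[OF ray_vector_derivative[OF \<gamma>N(2,3)[OF that]] N(1) that])
      (simp add: \<gamma>N(1))
  have d2: "((\<lambda>s. DF c (s *\<^sub>R v) v) has_vector_derivative I.D2 x v v) (at \<tau>)"
    by (rule has_vector_derivative_along_ray) (unfold \<tau>(3)[symmetric], rule I.has_derivative_D1[OF xP])
  have "((\<lambda>s. vector_derivative (coord c \<circ> \<gamma>) (at s)) has_vector_derivative I.D2 x v v) (at \<tau>)"
    by (rule has_vector_derivative_transform_within_open[OF d2 N]) (simp add: vector_derivative_at[OF d1])
  moreover have "((\<lambda>s. vector_derivative (coord c \<circ> \<gamma>) (at s)) has_vector_derivative
      - koszul (metric_at c) (coord c (F x)) (I.D1 x v) (I.D1 x v)) (at \<tau>)"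
    using geodesic_equation(2)[OF \<gamma>(1) \<gamma>N(4)[OF N(2)], of c] c \<gamma>N(1)[OF N(2)] \<tau>(3)
      vector_derivative_at[OF d1[OF N(2)]] by simp
  ultimately have "I.D2 x v v = - koszul (metric_at c) (coord c (F x)) (I.D1 x v) (I.D1 x v)"
    by (rule vector_derivative_unique_at)
  then have "I.D1 x (koszul b x v v) = 0"
    using I.push_koszul[OF xP, of v v] by simp
  then have "koszul b x v v = 0"
    using I.inj_deriv[OF xP] linear_injective_0[OF I.linear_D1[OF xP]] by blast
  then show ?thesis
    using \<tau>(3) bilinear_expand[OF I.c.Chr.bil[OF xP]]
    by (metis scaleR_zero_right)
qed

sublocale normal: normal_coordinates S b
  by (rule normal_coordinates.intro[OF metric_field_b normal_coordinates_axioms.intro])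
    (auto intro: zero_in_S star_S koszul_radial)

end

section \<open>Convexity of the energy function\<close>

context exponential_chart
begin

lemma radial_geodesic_eq: "p \<in> U \<Longrightarrow> radial_geodesic A g q \<Omega> p = (\<lambda>t. F (t *\<^sub>R L p))"
  by (simp add: radial_geodesic_def F_def scale_tangent_of[OF c0_in, symmetric] tangent_of_L)

lemma radial_speed:
  assumes x: "x \<in> S" and t: "t \<in> {0..1}"
  shows "g (F (t *\<^sub>R x)) (velocity A (\<lambda>t. F (t *\<^sub>R x)) t) (velocity A (\<lambda>t. F (t *\<^sub>R x)) t)
    = normal.energy x"
proof -
  have tx: "t *\<^sub>R x \<in> S" by (rule star_S[OF x t])
  have "velocity A (\<lambda>t. F (t *\<^sub>R x)) t = push (t *\<^sub>R x) x"
    using vector_derivative_at[OF ray_vector_derivative[OF tx]]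
      by (auto simp: fun_eq_iff velocity_def push_def o_def)
  then have "g (F (t *\<^sub>R x)) (velocity A (\<lambda>t. F (t *\<^sub>R x)) t) (velocity A (\<lambda>t. F (t *\<^sub>R x)) t)
    = b (t *\<^sub>R x) x x"
    by (simp add: b_def)
  also have "\<dots> = b 0 x x"
    using normal.radial_norm[OF tx]
    by (cases "t = 0") (simp_all add: normal.form_simps[OF tx] normal.form_simps[OF zero_in_S])
  finally show ?thesis by (simp add: normal.energy_def)
qed

lemma signed_energy_eq:
  assumes p: "p \<in> U"
  shows "signed_energy A g q \<Omega> p = normal.energy (L p)"
proof -
  define \<rho> where "\<rho> = (\<lambda>t. F (t *\<^sub>R L p))"
  define e where "e = normal.energy (L p)"
  have speed: "g (\<rho> t) (velocity A \<rho> t) (velocity A \<rho> t) = e" if "t \<in> {0..1}" for t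
    unfolding \<rho>_def e_def by (rule radial_speed[OF L_in_S[OF p] that])
  have "curve_length A g \<rho> = integral {0..1} (\<lambda>t::real. sqrt \<bar>e\<bar>)"
    unfolding curve_length_def by (rule integral_cong) (simp only: speed)
  then have length: "curve_length A g \<rho> = sqrt \<bar>e\<bar>" by simp
  have sign: "causal_sign A g \<rho> = (if e > 0 then 1 else if e < 0 then - 1 else 0)"
  proof -
    have "(\<forall>t\<in>{0..1}. P (g (\<rho> t) (velocity A \<rho> t) (velocity A \<rho> t))) \<longleftrightarrow> P e" for P
      using speed speed[of 0] by auto
    from this[of "\<lambda>s. s > 0"] this[of "\<lambda>s. s < 0"]
    show ?thesis unfolding causal_sign_def Let_def by (simp only:)
  qed
  show ?thesis
    unfolding signed_energy_def radial_geodesic_eq[OF p] \<rho>_def[symmetric] sign length e_def[symmetric]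
    by simp
qed

lemma f_energy_eq: "p \<in> U \<Longrightarrow> f_energy A g K q \<Omega> p = energy_series K (normal.energy (L p))"
  by (simp add: f_energy_def signed_energy_eq)

lemma F_zero: "F 0 = q"
proof -
  have "tangent_of A q c0 0 \<in> exp_domain A g q"
    using exp_diffeo tangent_of_S[OF zero_in_S] by (auto simp: exp_diffeo_def)
  then obtain \<gamma> where \<gamma>: "exp_curve A g q (tangent_of A q c0 0) \<gamma>" by (auto simp: exp_domain_def)
  show ?thesis
    using exp_map_ray[OF \<gamma>, of 0] \<gamma> by (simp add: F_def scale_tangent_of[OF c0_in] exp_curve_def)
qed

lemma smooth_energy: "smooth_on UNIV normal.energy"
proof -
  have bb: "bounded_bilinear (b 0)" using normal.bil[OF zero_in_S]
    by (simp add: bilinear_conv_bounded_bilinear)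
  have "Ck_on n (\<lambda>x. b 0 x x) UNIV" for n
    by (rule Ck_on_bilinear[OF bb open_UNIV]) (simp_all add: Ck_on_bounded_linear bounded_linear_ident)
  then show ?thesis by (simp add: smooth_on_def normal.energy_def[abs_def])
qed

lemma smooth_energy_series: "smooth_on UNIV (\<lambda>x. energy_series K (normal.energy x))"
  by (rule smooth_on_compose[OF smooth_on_energy_series smooth_energy]) auto

lemma smooth_f_energy_chart:
  assumes c: "c \<in> A"
  shows "smooth_on (coord c ` (U \<inter> cdom c)) (f_energy A g K q \<Omega> \<circ> param c)"
proof (rule smooth_on_cong)
  show op: "open (coord c ` (U \<inter> cdom c))" by (rule open_coord_image[OF c open_U])
  show "smooth_on (coord c ` (U \<inter> cdom c)) (\<lambda>y. energy_series K (normal.energy ((L \<circ> param c) y)))"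
    by (rule smooth_on_compose[OF smooth_energy_series smooth_L[OF c] op open_UNIV]) simp
qed (auto simp: param_coord[OF c] f_energy_eq)

lemma smooth_f_energy: "smooth_from A U (f_energy A g K q \<Omega>)"
  by (simp add: smooth_from_def smooth_f_energy_chart)

lemma smooth_modulus: "smooth_from A U (\<lambda>p. 1 - K * f_energy A g K q \<Omega> p)"
  unfolding smooth_from_def
proof
  fix c assume c: "c \<in> A"
  have "smooth_on (coord c ` (U \<inter> cdom c)) (\<lambda>x. 1 - K * (f_energy A g K q \<Omega> \<circ> param c) x)"
    by (intro smooth_on_diff smooth_on_mult smooth_on_const smooth_f_energy_chart c open_coord_image open_U)
  then show "smooth_on (coord c ` (U \<inter> cdom c)) ((\<lambda>p. 1 - K * f_energy A g K q \<Omega> p) \<circ> param c)"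
    by (simp add: o_def)
qed

text \<open>In a chart around \<open>F x\<close> this is \<open>hess_pullback\<close>, since the function composed with \<open>F\<close>
  is the energy series of the energy polynomial.\<close>

lemma hessian_push:
  assumes x: "x \<in> S"
  shows "hessian A g (f_energy A g K q \<Omega>) (F x) (push x u) (push x w)
    = hess b (\<lambda>y. energy_series K (normal.energy y)) x u w"
proof -
  define c where "c = chart_at A (F x)"
  have c: "c \<in> charts_at A (F x)" unfolding c_def by (rule chart_at_in)
  note cA = charts_atD(1)[OF c]
  interpret I: local_isometry "cimage c" "metric_at c" "region c" "coord c \<circ> F" b
    by (rule local_isometry_chart[OF cA])
  have xP: "x \<in> region c" by (rule regionI[OF x c])
  let ?f = "f_energy A g K q \<Omega> \<circ> param c"
  have "hessian A g (f_energy A g K q \<Omega>) (F x) (push x u) (push x w)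
     = hess (metric_at c) ?f ((coord c \<circ> F) x) (I.D1 x u) (I.D1 x w)"
    using c by (simp add: hessian_def Let_def c_def[symmetric] hessian_in_chart_eq push_def)
  also have "\<dots> = hess b (\<lambda>z. ?f ((coord c \<circ> F) z)) x u w"
  proof (rule I.hess_pullback[OF xP _ _ smooth_f_energy_chart[OF cA], symmetric])
    show "open (coord c ` (U \<inter> cdom c))" by (rule open_coord_image[OF cA open_U])
    show "(coord c \<circ> F) ` region c \<subseteq> coord c ` (U \<inter> cdom c)" using F_in_U by (auto simp: region_def)
  qed
  also have "\<dots> = hess b (\<lambda>y. energy_series K (normal.energy y)) x u w"
  proof (rule hess_cong[OF I.open_P xP])
    fix y assume "y \<in> region c"
    then have "y \<in> S" "F y \<in> cdom c" by (auto simp: region_def)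
    then show "?f ((coord c \<circ> F) y) = energy_series K (normal.energy y)"
      by (simp add: param_coord[OF cA] f_energy_eq F_in_U L_F)
  qed
  finally show ?thesis .
qed

lemma tangent_vector_is_push:
  assumes x: "x \<in> S" and v: "v \<in> tangent_space A (F x)"
  obtains u where "v = push x u"
proof -
  define c where "c = chart_at A (F x)"
  have c: "c \<in> charts_at A (F x)" unfolding c_def by (rule chart_at_in)
  interpret I: local_isometry "cimage c" "metric_at c" "region c" "coord c \<circ> F" b
    by (rule local_isometry_chart[OF charts_atD(1)[OF c]])
  obtain u where "v c = I.D1 x u" using surjD[OF I.surj_D1[OF regionI[OF x c]]] by blast
  then have "v = push x u" using tangent_of_component[OF v c] push_eq[OF x c] by simp
  then show thesis by (rule that)
qed

lemma curvature_pulled_back: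
  assumes K: "curvature_le A g K" and x: "x \<in> S"
  shows "b x (riem b x v u v) u \<le> K * (b x v v * b x u u - (b x v u)\<^sup>2)"
proof -
  define c where "c = chart_at A (F x)"
  have c: "c \<in> charts_at A (F x)" unfolding c_def by (rule chart_at_in)
  interpret I: local_isometry "cimage c" "metric_at c" "region c" "coord c \<circ> F" b
    by (rule local_isometry_chart[OF charts_atD(1)[OF c]])
  have xP: "x \<in> region c" by (rule regionI[OF x c])
  have push_c: "push x a c = I.D1 x a" for a using c by (simp add: push_def)
  have "curvature A g (F x) (push x v) (push x u) (push x v)
    = tangent_of A (F x) c (I.D1 x (riem b x v u v))"
    by (simp add: curvature_def Let_def c_def[symmetric] curvature_in_chart_eq push_c I.push_riem[OF xP])
  also have "\<dots> = push x (riem b x v u v)" by (rule push_eq[OF x c, symmetric])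
  finally have R: "curvature A g (F x) (push x v) (push x u) (push x v) = push x (riem b x v u v)" .
  have tan: "push x a \<in> tangent_space A (F x)" for a
    unfolding push_eq[OF x c] by (rule tangent_of_in_tangent_space[OF smooth_atlas c])
  show ?thesis
    using K[unfolded curvature_le_def, rule_format, OF tan tan, of v u] unfolding R b_def .
qed

lemma energy_convex:
  assumes K: "curvature_le A g K"
    and pos: "\<And>p. p \<in> U \<Longrightarrow> 1 - K * f_energy A g K q \<Omega> p > 0"
  shows "lambda_convex_on A g U (\<lambda>p. 1 - K * f_energy A g K q \<Omega> p) (f_energy A g K q \<Omega>)"
  unfolding lambda_convex_on_def
proof (intro conjI ballI smooth_f_energy smooth_modulus)
  fix p v assume p: "p \<in> U" and v: "v \<in> tangent_space A p"
  define x where "x = L p"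
  have x: "x \<in> S" "p = F x" using L_in_S[OF p] F_L[OF p] by (simp_all add: x_def)
  obtain u where u: "v = push x u" using tangent_vector_is_push[OF x(1)] v x(2) by blast
  have "normal.defect K x u u \<ge> 0"
  proof (rule normal.defect_nonneg[OF _ _ x(1)])
    show "b y (riem b y y u y) u \<le> K * (b y y y * b y u u - (b y y u)\<^sup>2)" if "y \<in> S" for y u
      by (rule curvature_pulled_back[OF K that])
    show "1 - K * energy_series K (normal.energy y) > 0" if "y \<in> S" for y
      using pos[OF F_in_U[OF that]] by (simp add: f_energy_eq[OF F_in_U[OF that]] L_F[OF that])
  qed
  then show "(1 - K * f_energy A g K q \<Omega> p) * g p v v \<le> hessian A g (f_energy A g K q \<Omega>) p v v"
    using hessian_push[OF x(1), of K u u]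
    by (simp add: normal.defect_def x(2) u b_def f_energy_eq[OF F_in_U[OF x(1)]] L_F[OF x(1)])
qed

text \<open>By \<open>hess_of_energy\<close> the Hessian depends continuously on \<open>x\<close>, and at \<open>0\<close> its radial
  form and its last summand vanish, while \<open>2 \<phi>'(0) = 1\<close> for the energy series \<open>\<phi>\<close>.\<close>

lemma tendsto_hess_center:
  "((\<lambda>x. hess b (\<lambda>y. energy_series K (normal.energy y)) x u w) \<longlongrightarrow> b 0 u w) (nhds 0)"
proof -
  let ?H = "\<lambda>x. 2 * energy_series' K (normal.energy x) * (b x u w + b x (koszul b x x u) w)
    + 4 * energy_series'' K (normal.energy x) * b 0 x u * b 0 x w"
  have e: "continuous_on S normal.energy"
    using smooth_on_continuous[OF smooth_energy] continuous_on_subset by blast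
  have s: "continuous_on UNIV (energy_series' K)" "continuous_on UNIV (energy_series'' K)"
    by (intro DERIV_continuous_on[OF DERIV_energy_series(2)]
      DERIV_continuous_on[OF DERIV_energy_series(3)])+
  have k: "smooth_on S (\<lambda>x. koszul b x x u)"
    by (rule normal.Chr.smooth_args[OF open_S smooth_on_ident _ smooth_on_ident smooth_on_const]) auto
  have r: "smooth_on S (\<lambda>x. b x (koszul b x x u) w)"
    by (rule normal.smooth_args[OF open_S smooth_on_ident _ k smooth_on_const]) auto
  have l: "continuous_on S (\<lambda>x. b 0 x w)" for w
    using normal.bil[OF zero_in_S] unfolding bilinear_def
    by (intro linear_continuous_on) (simp add: linear_conv_bounded_linear[symmetric])
  have "continuous_on S ?H"
    by (intro continuous_on_add continuous_on_mult continuous_on_const l smooth_on_continuous[OF r]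
        smooth_on_continuous[OF normal.smooth] continuous_on_compose2[OF s(1) e]
          continuous_on_compose2[OF s(2) e]) auto
  then have "isCont ?H 0" using zero_in_S by (simp only: continuous_on_eq_continuous_at[OF open_S])
  then have "(?H \<longlongrightarrow> ?H 0) (nhds 0)" unfolding isCont_def
    by (rule tendsto_at_iff_tendsto_nhds[of ?H 0, THEN iffD1])
  moreover have "?H 0 = b 0 u w"
  proof -
    have e0: "normal.energy 0 = 0" by (simp add: normal.energy_def normal.form_simps[OF zero_in_S])
    have "energy_series K 0 = 0" by (simp add: energy_series_def)
    then have "2 * energy_series' K 0 = 1" using energy_series_ode[of K 0] by simp
    then show ?thesis
      by (simp add: e0 normal.form_simps[OF zero_in_S] bilinear_lzero[OF normal.Chr.bil[OF zero_in_S]])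
  qed
  moreover have "\<forall>\<^sub>F x in nhds 0. ?H x = hess b (\<lambda>y. energy_series K (normal.energy y)) x u w"
    unfolding eventually_nhds
    using open_S zero_in_S normal.hess_of_energy normal.radial_form_def by (intro exI[of _ S]) auto
  ultimately show ?thesis by (simp add: tendsto_cong)
qed

text \<open>Near \<open>0\<close> the Hessian in normal coordinates is close to \<open>b\<^sub>0\<close>, which is the metric at
  \<open>q\<close> in other coordinates. The signature does not change when the form is expressed in a
  chart of the atlas, because \<open>D F\<close> is bijective.\<close>

lemma space_time_convex_near_center:
  assumes lor: "lorentzian A g" and pos: "\<And>p. p \<in> U \<Longrightarrow> 1 - K * f_energy A g K q \<Omega> p > 0"
    and conv: "lambda_convex_on A g U (\<lambda>p. 1 - K * f_energy A g K q \<Omega> p) (f_energy A g K q \<Omega>)"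
  shows "\<exists>V. open V \<and> q \<in> V \<and> V \<subseteq> U \<and> space_time_convex_on A g V (f_energy A g K q \<Omega>)"
proof -
  let ?H = "hess b (\<lambda>y. energy_series K (normal.energy y))"
  have bij_D1: "linear (DF c x)" "bij (DF c x)"
    if "x \<in> S" "c \<in> charts_at A (F x)" for x c
  proof -
    interpret I: local_isometry "cimage c" "metric_at c" "region c" "coord c \<circ> F" b
      by (rule local_isometry_chart[OF charts_atD(1)[OF that(2)]])
    note xP = regionI[OF that]
    show "linear (DF c x)" by (rule I.linear_D1[OF xP])
    show "bij (DF c x)" using I.inj_deriv[OF xP] I.surj_D1[OF xP] by (simp add: bij_def)
  qed
  have b0: "lorentzian_signature (b 0)"
  proof -
    have c: "c0 \<in> charts_at A (F 0)" using c0_in F_zero by simp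
    show ?thesis
    proof (rule lorentzian_signature_pullback[OF bij_D1[OF zero_in_S c]])
      show "lorentzian_signature (form_in_chart A (F 0) (g (F 0)) c0)"
        using lor c by (auto simp: lorentzian_def)
      show "b 0 u w = form_in_chart A (F 0) (g (F 0)) c0 (DF c0 0 u) (DF c0 0 w)" for u w
        by (simp add: b_def push_eq[OF zero_in_S c] form_in_chart_def)
    qed
  qed
  have "\<forall>\<^sub>F x in nhds 0. lorentzian_signature (?H x)"
  proof (rule eventually_lorentzian_signature[OF b0 tendsto_hess_center])
    have "bilinear (?H x) \<and> (\<forall>u w. ?H x u w = ?H x w u)" if "x \<in> S" for x
    proof -
      have H: "?H x u w = normal.defect K x u w
        + (1 - K * energy_series K (normal.energy x)) * b x u w" for u w
        by (simp add: normal.defect_def)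
      show ?thesis
        unfolding bilinear_def H
        using normal.defect_commute[OF that] normal.field_commute[OF that]
        by (auto intro!: linearI simp: normal.form_simps[OF that]
          bilinear_expand[OF normal.bilinear_defect[OF that]] algebra_simps)
    qed
    then show "\<forall>\<^sub>F x in nhds 0. bilinear (?H x) \<and> (\<forall>u w. ?H x u w = ?H x w u)"
      unfolding eventually_nhds using open_S zero_in_S by blast
  qed
  then obtain W where W: "open W" "0 \<in> W" "\<And>x. x \<in> W \<Longrightarrow> lorentzian_signature (?H x)"
    unfolding eventually_nhds by blast
  define V where "V = U \<inter> L -` W"
  have qU: "q \<in> U" "L q = 0" using F_in_U[OF zero_in_S] L_F[OF zero_in_S] F_zero by auto
  have "open V"
  proof (rule Topological_Spaces.openI)
    fix p assume p: "p \<in> V"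
    define c where "c = chart_at A p"
    have c: "c \<in> A" "p \<in> cdom c" using charts_atD[OF chart_at_in] by (auto simp: c_def)
    have "continuous_on (U \<inter> cdom c) (\<lambda>p. (L \<circ> param c) (coord c p))"
      by (rule continuous_on_compose2[OF smooth_on_continuous[OF smooth_L[OF c(1)]]
            continuous_on_subset[OF coord_continuous[OF c(1)]]]) auto
    then have "continuous_on (U \<inter> cdom c) L"
      by (rule continuous_on_eq) (simp add: param_coord[OF c(1)])
    then have "open (U \<inter> cdom c \<inter> L -` W)"
      by (rule continuous_open_preimage) (intro open_Int open_U chart_open c W)+
    then show "\<exists>T. open T \<and> p \<in> T \<and> T \<subseteq> V" using p c(2)
      by (intro exI[of _ "U \<inter> cdom c \<inter> L -` W"]) (auto simp: V_def)
  qed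
  moreover have "q \<in> V" "V \<subseteq> U" using qU W(2) by (auto simp: V_def)
  moreover have "space_time_convex_on A g V (f_energy A g K q \<Omega>)"
    unfolding space_time_convex_on_def
  proof (intro conjI exI ballI)
    show "lorentzian A g" by (rule lor)
    show "1 - K * f_energy A g K q \<Omega> p > 0" if "p \<in> V" for p using pos that by (simp add: V_def)
    have "smooth_from A V f" if "smooth_from A U f" for f :: "'m \<Rightarrow> real"
      using that smooth_on_subset \<open>V \<subseteq> U\<close> unfolding smooth_from_def
        by (metis Int_mono image_mono subset_refl)
    then show "lambda_convex_on A g V (\<lambda>p. 1 - K * f_energy A g K q \<Omega> p) (f_energy A g K q \<Omega>)"
      using conv \<open>V \<subseteq> U\<close> unfolding lambda_convex_on_def by blast
    fix p c assume p: "p \<in> V" and c: "c \<in> charts_at A p"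
    define x where "x = L p"
    have x: "x \<in> S" "p = F x" "x \<in> W" using p L_in_S F_L by (auto simp: x_def V_def)
    have c': "c \<in> charts_at A (F x)" using c x(2) by simp
    let ?T = "DF c x"
    let ?B = "form_in_chart A p (hessian A g (f_energy A g K q \<Omega>) p) c"
    have HB: "?H x u w = ?B (?T u) (?T w)" for u w
      unfolding hessian_push[OF x(1), symmetric] push_eq[OF x(1) c'] x(2) form_in_chart_def ..
    show "lorentzian_signature ?B"
    proof (rule lorentzian_signature_pullback[OF _ _ _ W(3)[OF x(3)]])
      show "linear (inv ?T)"
        using linear_injective_imp_surjective bij_D1[OF x(1) c']
          by (metis bij_is_inj bij_imp_bij_inv inj_linear_imp_inv_linear)
      show "bij (inv ?T)" by (rule bij_imp_bij_inv[OF bij_D1(2)[OF x(1) c']])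
      show "?B u w = ?H x (inv ?T u) (inv ?T w)" for u w
        unfolding HB by (simp add: surj_f_inv_f[OF bij_is_surj[OF bij_D1(2)[OF x(1) c']]])
    qed
  qed
  ultimately show ?thesis by blast
qed

end

theorem corollary5p1:
  fixes A :: "('m::{t2_space, second_countable_topology}, 'e::euclidean_space) chart set"
    and g :: "('m, 'e) metric"
    and K :: real
    and q :: 'm
    and \<Omega> :: "('m, 'e) tangent set"
    and U :: "'m set"
  assumes "semi_riemannian A g"
    and "curvature_le A g K"
    and "star_region A q \<Omega>"
    and "exp_diffeo A g q \<Omega> U"
    and "K > 0 \<Longrightarrow> \<forall>p\<in>U. signed_energy A g q \<Omega> p < pi\<^sup>2 / (4 * K)"
    and "K < 0 \<Longrightarrow> \<forall>p\<in>U. signed_energy A g q \<Omega> p > pi\<^sup>2 / (4 * K)"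
  shows "(\<forall>p\<in>U. 1 - K * f_energy A g K q \<Omega> p > 0) \<and>
    lambda_convex_on A g U (\<lambda>p. 1 - K * f_energy A g K q \<Omega> p) (f_energy A g K q \<Omega>) \<and>
    (lorentzian A g \<longrightarrow>
       (\<exists>V. open V \<and> q \<in> V \<and> V \<subseteq> U \<and> space_time_convex_on A g V (f_energy A g K q \<Omega>)))"
proof -
  interpret exponential_chart A g q \<Omega> U
    using assms(1,3,4) by (simp add: exponential_chart_def exponential_chart_axioms_def semi_riemannian_manifold_def)
  have pos: "1 - K * f_energy A g K q \<Omega> p > 0" if "p \<in> U" for p
    unfolding f_energy_def
  proof (rule one_minus_energy_series_pos)
    show "K * signed_energy A g q \<Omega> p < pi\<^sup>2 / 4"
    proof (cases "K = 0")
      case False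
      then show ?thesis
        using assms(5,6) that by (cases "K > 0") (fastforce simp: field_simps)+
    qed simp
  qed
  moreover have conv: "lambda_convex_on A g U (\<lambda>p. 1 - K * f_energy A g K q \<Omega> p) (f_energy A g K q \<Omega>)"
    by (rule energy_convex[OF assms(2) pos])
  ultimately show ?thesis using space_time_convex_near_center[OF _ pos conv] by blast
qed

end
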